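(* Let $G$ be a Gromov-hyperbolic group with Cayley graph $\Gamma=\Gamma(G,S)$, and let $\rho$ satisfy (i)–(iii) of the context. For any fixed direction $\xi\in\partial G$, for $\mathbb{P}$-a.e. $\omega\in\Omega$ and all $o_1,o_2\in G$, the $\omega$-geodesic rays $[o_1,\xi)_\omega$ and $[o_2,\xi)_\omega$ coalesce.
   Context: $G$ is a finitely generated (Gromov-)hyperbolic group, $S$ a finite symmetric generating set, $\Gamma=\Gamma(G,S)$ the undirected Cayley graph (vertex set $G$; an edge between $g$ and $h$ iff $g^{-1}h\in S$) with edge set $E$, and $\partial G$ is the Gromov boundary. First passage percolation: $\rho$ is a probability measure such that (i) its support is contained in $[0,\infty)$; (ii) it has no atoms; (iii) $\int e^{ax^2}\,d\rho(x)<\infty$ for some $a>0$. $\Omega=[0,\infty)^E$ carries $\mathbb{P}=\rho^{\otimes E}$. For an edge path $\gamma$, $\ell_\omega(\gamma)=\sum_{e\in\gamma}\omega(e)$, and $d_\omega(x,y)=\inf_\gamma\ell_\omega(\gamma)$ over edge paths from $x$ to $y$. An $\omega$-geodesic between $x$ and $y$ is a path attaining $d_\omega(x,y)$ (for a.e. $\omega$ it exists and is unique for every pair). An $\omega$-geodesic ray is a semi-infinite path all of whose finite subpaths are $\omega$-geodesics; it has direction $\xi\in\partial G$ if $\xi$ is its only accumulation point in $\partial G$ (equivalently, its vertices converge to $\xi$ in the Gromov compactification). For fixed $\xi$ and $o$, $[o,\xi)_\omega$ denotes the $\omega$-geodesic ray starting at $o$ in direction $\xi$, which exists and is unique for a.e.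 $\omega$. Two rays coalesce if outside a sufficiently large ball centered at the identity the set of edges in their symmetric difference is empty. *)

theory Defs
  imports "HOL-Probability.Probability" "HOL-Algebra.Generated_Groups"
begin

section \<open>Cayley graphs and weighted paths\<close>

text \<open>An undirected edge between \<open>g\<close> and \<open>h\<close> is the set \<open>{g, h}\<close>; if \<open>S\<close> contains the identity,
  the resulting loops are singletons.\<close>

definition cayley_edges :: "('a, 'b) monoid_scheme \<Rightarrow> 'a set \<Rightarrow> 'a set set" where
  "cayley_edges G S =
     {{g, h} | g h. g \<in> carrier G \<and> h \<in> carrier G \<and> inv\<^bsub>G\<^esub> g \<otimes>\<^bsub>G\<^esub> h \<in> S}"

text \<open>An edge path is the nonempty list of the vertices it visits; this determines its edges.\<close>

definition edge_path :: "('a, 'b) monoid_scheme \<Rightarrow> 'a set \<Rightarrow> 'a list \<Rightarrow> bool" where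
  "edge_path G S p \<longleftrightarrow> p \<noteq> [] \<and> set p \<subseteq> carrier G \<and>
     (\<forall>i. Suc i < length p \<longrightarrow> {p ! i, p ! Suc i} \<in> cayley_edges G S)"

definition path_between :: "('a, 'b) monoid_scheme \<Rightarrow> 'a set \<Rightarrow> 'a \<Rightarrow> 'a \<Rightarrow> 'a list \<Rightarrow> bool" where
  "path_between G S x y p \<longleftrightarrow> edge_path G S p \<and> hd p = x \<and> last p = y"

definition path_length :: "('a set \<Rightarrow> real) \<Rightarrow> 'a list \<Rightarrow> real" where
  "path_length \<omega> p = (\<Sum>i<length p - 1. \<omega> {p ! i, p ! Suc i})"

definition fpp_dist ::
  "('a, 'b) monoid_scheme \<Rightarrow> 'a set \<Rightarrow> ('a set \<Rightarrow> real) \<Rightarrow> 'a \<Rightarrow> 'a \<Rightarrow> real" where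
  "fpp_dist G S \<omega> x y = (INF p \<in> {p. path_between G S x y p}. path_length \<omega> p)"

definition word_dist :: "('a, 'b) monoid_scheme \<Rightarrow> 'a set \<Rightarrow> 'a \<Rightarrow> 'a \<Rightarrow> real" where
  "word_dist G S = fpp_dist G S (\<lambda>e. 1)"


section \<open>Hyperbolicity and the Gromov boundary\<close>

definition gromov_product ::
  "('a, 'b) monoid_scheme \<Rightarrow> 'a set \<Rightarrow> 'a \<Rightarrow> 'a \<Rightarrow> 'a \<Rightarrow> real" where
  "gromov_product G S w x y = (word_dist G S x w + word_dist G S y w - word_dist G S x y) / 2"

text \<open>Gromov's four-point condition on the vertex set with the word metric.\<close>

definition gromov_hyperbolic :: "('a, 'b) monoid_scheme \<Rightarrow> 'a set \<Rightarrow> bool" where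
  "gromov_hyperbolic G S \<longleftrightarrow>
     (\<exists>\<delta>\<ge>0. \<forall>w\<in>carrier G. \<forall>x\<in>carrier G. \<forall>y\<in>carrier G. \<forall>z\<in>carrier G.
        gromov_product G S w x z \<ge> min (gromov_product G S w x y) (gromov_product G S w y z) - \<delta>)"

text \<open>For sequences \<open>x\<close>, \<open>y\<close> of vertices: \<open>(x\<^sub>i | y\<^sub>j)\<close>, based at the identity, tends to infinity as
  \<open>i, j\<close> tend to infinity.\<close>

definition product_diverges ::
  "('a, 'b) monoid_scheme \<Rightarrow> 'a set \<Rightarrow> (nat \<Rightarrow> 'a) \<Rightarrow> (nat \<Rightarrow> 'a) \<Rightarrow> bool" where
  "product_diverges G S x y \<longleftrightarrow>
     filterlim (\<lambda>(i, j). gromov_product G S \<one>\<^bsub>G\<^esub> (x i) (y j)) at_top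
       (sequentially \<times>\<^sub>F sequentially)"

definition sequences_to_infinity :: "('a, 'b) monoid_scheme \<Rightarrow> 'a set \<Rightarrow> (nat \<Rightarrow> 'a) set" where
  "sequences_to_infinity G S = {x. range x \<subseteq> carrier G \<and> product_diverges G S x x}"

text \<open>A boundary point is an equivalence class of sequences tending to infinity. A sequence of
  vertices converges to the boundary point \<open>\<xi>\<close> in the Gromov compactification iff it is a member
  of the class \<open>\<xi>\<close>.\<close>

definition gromov_boundary :: "('a, 'b) monoid_scheme \<Rightarrow> 'a set \<Rightarrow> (nat \<Rightarrow> 'a) set set" where
  "gromov_boundary G S =
     sequences_to_infinity G S //
       {(x, y). x \<in> sequences_to_infinity G S \<and> y \<in> sequences_to_infinity G S \<and>
                product_diverges G S x y}"


section \<open>First passage percolation\<close>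

definition measure_support :: "'c::topological_space measure \<Rightarrow> 'c set" where
  "measure_support M = {x. \<forall>U. open U \<and> x \<in> U \<longrightarrow> emeasure M U > 0}"

text \<open>Restricting \<open>\<rho>\<close> to \<open>{0..}\<close>, which has full measure when the support of \<open>\<rho>\<close> is contained in it,
  makes the sample space equal to the set of extensional functions from the edges to \<open>{0..}\<close>.\<close>

definition fpp_measure ::
  "('a, 'b) monoid_scheme \<Rightarrow> 'a set \<Rightarrow> real measure \<Rightarrow> ('a set \<Rightarrow> real) measure" where
  "fpp_measure G S \<rho> = PiM (cayley_edges G S) (\<lambda>e. restrict_space \<rho> {0..})"

definition fpp_geodesic ::
  "('a, 'b) monoid_scheme \<Rightarrow> 'a set \<Rightarrow> ('a set \<Rightarrow> real) \<Rightarrow> 'a \<Rightarrow> 'a \<Rightarrow> 'a list \<Rightarrow> bool" where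
  "fpp_geodesic G S \<omega> x y p \<longleftrightarrow>
     path_between G S x y p \<and> path_length \<omega> p = fpp_dist G S \<omega> x y"

text \<open>A semi-infinite path is the sequence of its vertices; the list below is its subpath
  from \<open>r m\<close> to \<open>r n\<close>.\<close>

definition fpp_geodesic_ray ::
  "('a, 'b) monoid_scheme \<Rightarrow> 'a set \<Rightarrow> ('a set \<Rightarrow> real) \<Rightarrow> (nat \<Rightarrow> 'a) \<Rightarrow> bool" where
  "fpp_geodesic_ray G S \<omega> r \<longleftrightarrow>
     (\<forall>m n. m \<le> n \<longrightarrow> fpp_geodesic G S \<omega> (r m) (r n) (map r [m..<Suc n]))"

definition boundary_accumulation_points ::
  "('a, 'b) monoid_scheme \<Rightarrow> 'a set \<Rightarrow> (nat \<Rightarrow> 'a) \<Rightarrow> (nat \<Rightarrow> 'a) set set" where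
  "boundary_accumulation_points G S r =
     {\<eta> \<in> gromov_boundary G S. \<exists>\<phi>. strict_mono \<phi> \<and> r \<circ> \<phi> \<in> \<eta>}"

definition geodesic_ray_towards ::
  "('a, 'b) monoid_scheme \<Rightarrow> 'a set \<Rightarrow> ('a set \<Rightarrow> real) \<Rightarrow> 'a \<Rightarrow> (nat \<Rightarrow> 'a) set \<Rightarrow>
     (nat \<Rightarrow> 'a) \<Rightarrow> bool" where
  "geodesic_ray_towards G S \<omega> x \<xi> r \<longleftrightarrow>
     fpp_geodesic_ray G S \<omega> r \<and> r 0 = x \<and> boundary_accumulation_points G S r = {\<xi>}"

text \<open>The ray \<open>[x, \<xi>)\<^sub>\<omega>\<close>; meaningful only where it exists and is unique.\<close>

definition the_ray ::
  "('a, 'b) monoid_scheme \<Rightarrow> 'a set \<Rightarrow> ('a set \<Rightarrow> real) \<Rightarrow> 'a \<Rightarrow> (nat \<Rightarrow> 'a) set \<Rightarrow>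
     (nat \<Rightarrow> 'a)" where
  "the_ray G S \<omega> x \<xi> = (THE r. geodesic_ray_towards G S \<omega> x \<xi> r)"

definition ray_edges :: "(nat \<Rightarrow> 'a) \<Rightarrow> 'a set set" where
  "ray_edges r = {{r n, r (Suc n)} | n. True}"

definition word_ball :: "('a, 'b) monoid_scheme \<Rightarrow> 'a set \<Rightarrow> real \<Rightarrow> 'a set" where
  "word_ball G S R = {g \<in> carrier G. word_dist G S \<one>\<^bsub>G\<^esub> g \<le> R}"

text \<open>An edge counts as outside the ball when neither endpoint is in it. Counting all edges not
  contained in the ball gives the same notion, with \<open>R + 1\<close> in place of \<open>R\<close>.\<close>

definition coalesce ::
  "('a, 'b) monoid_scheme \<Rightarrow> 'a set \<Rightarrow> (nat \<Rightarrow> 'a) \<Rightarrow> (nat \<Rightarrow> 'a) \<Rightarrow> bool" where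
  "coalesce G S r r' \<longleftrightarrow>
     (\<exists>R. {e \<in> sym_diff (ray_edges r) (ray_edges r'). e \<inter> word_ball G S R = {}} = {})"

end

theory Submission
  imports Defs "HOL-Real_Asymp.Real_Asymp"
begin

text \<open>
  Along a sequence converging to \<open>\<xi>\<close> one finds infinitely many vertices \<open>w\<close> through which every
  geodesic from the far side of \<open>w\<close> to a neighbourhood of \<open>\<xi>\<close> must pass; existence, uniqueness and
  coalescence of the rays follow from this and the uniqueness of finite geodesics.

  Let a path join \<open>y\<close> to \<open>z\<close>, where \<open>(y|z)\<^sub>w\<close> is bounded. Frink's lemma, applied to
  \<open>exp (- \<epsilon> (u|v)\<^sub>w)\<close>, shows that the sum of \<open>exp (- \<epsilon> d(w, v))\<close> over the vertices \<open>v\<close> of the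
  path is bounded below. A path avoiding a large ball around \<open>w\<close> therefore makes at least
  \<open>exp (\<epsilon> r / 2)\<close> visits to the sphere of some large radius \<open>r\<close>. A weighted geodesic does not: with
  overwhelming probability long simple paths have length at least linear in their number of edges,
  whereas the weights near \<open>w\<close> are at most linear in \<open>r\<close>.

  So, for a segment of a word geodesic, the geodesics pass within distance \<open>K\<close> of both endpoints.
  If the segment is long, and the weights in a much larger ball lie in a low interval on the segment
  and in a disjoint higher interval elsewhere, the geodesics must also pass through its midpoint.
  Such a configuration has positive probability, and conditioning on it makes the previous
  large deviation estimates no worse. Truncating the estimates to radii that grow with the index
  of the segment and spreading the segments out makes these events independent, and the two
  Borel--Cantelli lemmas finish the argument.
\<close>

section \<open>Weighted paths in Cayley graphs\<close>

text \<open>Weights may be arbitrarily close to 0 and arbitrarily large, so weighted geodesics are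
  not uniform quasi-geodesics and their stability cannot be quoted; counting visits to spheres
  replaces it. The order of choice avoids circularity. The weight levels \<open>a\<close>,
  \<open>a0\<close>, \<open>b0\<close>, \<open>b1\<close> come first, then the rate \<open>l\<close>
  with \<open>exp (- l * a)\<close> small and the tail scale \<Lambda>. The radius \<open>K\<close>
  depends on these and on \<delta> only, because the estimates around the ends of a segment are
  uniform over all configurations prescribed in \<open>[a, b1]\<close>: on a prescribed edge the
  Laplace factor obeys the same bound as on a free one, and the weight stays below
  \<open>\<Lambda> * r\<close> for \<open>r \<ge> K\<close>. Then \<open>L\<close> is large against
  \<open>K\<close>, and \<open>R\<close> against both. In one environment the cut property must hold
  for all pairs of end vertices at once. It is therefore stated through positions relative to the
  cut vertex, as seen from the identity, and not for two given starting points.\<close>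

lemma path_length_Nil [simp]: "path_length \<omega> [] = 0"
  by (simp add: path_length_def)

lemma path_length_singleton [simp]: "path_length \<omega> [x] = 0"
  by (simp add: path_length_def)

lemma path_length_Cons2 [simp]: "path_length \<omega> (x # y # p) = \<omega> {x, y} + path_length \<omega> (y # p)"
proof -
  have "path_length \<omega> (x # y # p) = (\<Sum>i<Suc (length p). \<omega> {(x # y # p) ! i, (x # y # p) ! Suc i})"
    by (simp add: path_length_def)
  also have "\<dots> = \<omega> {x, y} + (\<Sum>i<length p. \<omega> {(y # p) ! i, (y # p) ! Suc i})"
    by (subst sum.lessThan_Suc_shift) simp
  finally show ?thesis by (simp add: path_length_def)
qed

lemma path_length_glue:
  "path_length \<omega> (p @ x # q) = path_length \<omega> (p @ [x]) + path_length \<omega> (x # q)"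
proof (induction p)
  case (Cons a p)
  then show ?case by (cases p) auto
qed simp

lemma path_length_rev: "path_length \<omega> (rev p) = path_length \<omega> p"
proof (induction p)
  case (Cons a p)
  show ?case
  proof (cases p)
    case (Cons b q)
    have "path_length \<omega> (rev (a # p)) = path_length \<omega> (rev q @ b # [a])"
      by (simp add: Cons)
    also have "\<dots> = path_length \<omega> (rev p) + \<omega> {b, a}"
      by (subst path_length_glue) (simp add: Cons)
    finally show ?thesis using Cons.IH by (simp add: Cons insert_commute)
  qed simp
qed simp

lemma path_length_unit: "p \<noteq> [] \<Longrightarrow> path_length (\<lambda>e. 1) p = real (length p - 1)"
  by (simp add: path_length_def)

text \<open>Telescoping. A function that grows along each edge by at most its weight gives a lower
  bound for lengths; later \<open>f\<close> is a multiple of a word distance, possibly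
  truncated.\<close>

lemma path_length_potential:
  fixes f :: "'a \<Rightarrow> real"
  assumes "successively (\<lambda>x y. f y - f x \<le> \<omega> {x, y}) p" "p \<noteq> []"
  shows "f (last p) - f (hd p) \<le> path_length \<omega> p"
  using assms by (induction p rule: induct_list012) auto

lemma path_length_nonneg:
  assumes "successively (\<lambda>x y. 0 \<le> \<omega> {x, y}) p"
  shows "0 \<le> path_length \<omega> p"
  using path_length_potential[of "\<lambda>_. 0" \<omega> p] assms by (cases "p = []") (auto simp: path_length_def)

lemma edge_path_iff:
  "edge_path G S p \<longleftrightarrow> p \<noteq> [] \<and> set p \<subseteq> carrier G \<and> successively (\<lambda>x y. {x, y} \<in> cayley_edges G S) p"
  by (auto simp: edge_path_def successively_conv_nth)

lemma edge_path_glue: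
  "edge_path G S (p @ x # q) \<longleftrightarrow> edge_path G S (p @ [x]) \<and> edge_path G S (x # q)"
  by (auto simp: edge_path_iff successively_append_iff)

locale cayley_graph = group G for G (structure) +
  fixes S :: "'a set"
  assumes finite_S: "finite S" and S_carrier: "S \<subseteq> carrier G"
    and S_inv: "s \<in> S \<Longrightarrow> inv s \<in> S" and S_gen: "generate G S = carrier G"
begin

abbreviation "E \<equiv> cayley_edges G S"
abbreviation "D \<equiv> word_dist G S"

lemma edge_iff: "{x, y} \<in> E \<longleftrightarrow> x \<in> carrier G \<and> y \<in> carrier G \<and> inv x \<otimes> y \<in> S"
proof
  assume "{x, y} \<in> E"
  then obtain g h where gh: "{x, y} = {g, h}" "g \<in> carrier G" "h \<in> carrier G" "inv g \<otimes> h \<in> S"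
    by (auto simp: cayley_edges_def)
  have "inv (inv g \<otimes> h) = inv h \<otimes> g"
    using gh by (simp add: inv_mult_group)
  then have "inv h \<otimes> g \<in> S" using S_inv[OF gh(4)] by simp
  with gh show "x \<in> carrier G \<and> y \<in> carrier G \<and> inv x \<otimes> y \<in> S"
    by (auto simp: doubleton_eq_iff)
qed (auto simp: cayley_edges_def)

lemma edge_cases:
  assumes "e \<in> E"
  obtains x y where "e = {x, y}" "x \<in> carrier G" "y \<in> carrier G" "inv x \<otimes> y \<in> S"
  using assms by (auto simp: cayley_edges_def)

lemma neighbours_subset: "{y. {x, y} \<in> E} \<subseteq> (\<lambda>s. x \<otimes> s) ` S"
proof
  fix y assume "y \<in> {y. {x, y} \<in> E}"
  then have "x \<in> carrier G" "y \<in> carrier G" "inv x \<otimes> y \<in> S" by (auto simp: edge_iff)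
  moreover from this have "y = x \<otimes> (inv x \<otimes> y)" by (simp add: m_assoc[symmetric])
  ultimately show "y \<in> (\<lambda>s. x \<otimes> s) ` S" by blast
qed

lemma finite_neighbours: "finite {y. {x, y} \<in> E}" and card_neighbours: "card {y. {x, y} \<in> E} \<le> card S"
  using neighbours_subset finite_S
  by (meson finite_imageI finite_subset surj_card_le)+

lemma edge_path_Cons2: "edge_path G S (x # y # p) \<longleftrightarrow> {x, y} \<in> E \<and> edge_path G S (y # p)"
  by (auto simp: edge_path_iff edge_iff)

lemma edge_path_singleton: "edge_path G S [x] \<longleftrightarrow> x \<in> carrier G"
  by (auto simp: edge_path_iff)

lemma path_between_carrier: "path_between G S x y p \<Longrightarrow> x \<in> carrier G \<and> y \<in> carrier G"
  using hd_in_set last_in_set by (fastforce simp: path_between_def edge_path_iff)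

lemma path_between_trans:
  assumes "path_between G S x y p" "path_between G S y z q"
  shows "path_between G S x z (p @ tl q)"
    and "path_length \<omega> (p @ tl q) = path_length \<omega> p + path_length \<omega> q"
proof -
  from assms obtain p' q' where pq: "p = p' @ [y]" "q = y # q'"
    by (metis append_butlast_last_id edge_path_iff list.collapse path_between_def)
  show "path_between G S x z (p @ tl q)"
    using assms edge_path_glue[of G S p' y q'] by (auto simp: path_between_def pq hd_append split: if_splits)
  show "path_length \<omega> (p @ tl q) = path_length \<omega> p + path_length \<omega> q"
    using path_length_glue[of \<omega> p' y q'] by (simp add: pq)
qed

lemma path_between_rev: "path_between G S x y p \<Longrightarrow> path_between G S y x (rev p)"
  by (auto simp: path_between_def edge_path_iff hd_rev last_rev insert_commute)

lemma path_exists: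
  assumes "x \<in> carrier G" "y \<in> carrier G"
  shows "\<exists>p. path_between G S x y p"
proof -
  have edge: "\<exists>p. path_between G S x (x \<otimes> s) p" if "x \<in> carrier G" "s \<in> S" for x s
  proof -
    have "s \<in> carrier G" using that S_carrier by auto
    with that have "{x, x \<otimes> s} \<in> E" by (simp add: edge_iff m_assoc[symmetric])
    then have "path_between G S x (x \<otimes> s) [x, x \<otimes> s]"
      by (auto simp: path_between_def edge_path_iff edge_iff)
    then show ?thesis by blast
  qed
  \<comment> \<open>The starting vertex stays quantified in the induction, because the path that
    spells \<open>h2\<close> has to start at \<open>x \<otimes> h1\<close>.\<close>
  have *: "\<forall>x\<in>carrier G. \<exists>p. path_between G S x (x \<otimes> g) p" if "g \<in> generate G S" for g
    using that
  proof (induction rule: generate.induct)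
    case one
    have "path_between G S x x [x]" if "x \<in> carrier G" for x
      using that by (auto simp: path_between_def edge_path_singleton)
    then show ?case by auto
  next
    case (eng h1 h2)
    have c: "h1 \<in> carrier G" "h2 \<in> carrier G" using eng(1,2) S_gen by auto
    show ?case
    proof
      fix x assume x: "x \<in> carrier G"
      then obtain p where "path_between G S x (x \<otimes> h1) p" using eng by blast
      moreover obtain q where "path_between G S (x \<otimes> h1) (x \<otimes> h1 \<otimes> h2) q" using eng x c by blast
      ultimately have "path_between G S x (x \<otimes> h1 \<otimes> h2) (p @ tl q)" by (rule path_between_trans)
      then show "\<exists>p. path_between G S x (x \<otimes> (h1 \<otimes> h2)) p" using x c by (auto simp: m_assoc)
    qed
  qed (use edge S_inv in auto)
  have "\<exists>p. path_between G S x (x \<otimes> (inv x \<otimes> y)) p"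
    using *[of "inv x \<otimes> y"] S_gen assms by auto
  then show ?thesis using assms by (simp add: m_assoc[symmetric])
qed

definition nonneg_weight :: "('a set \<Rightarrow> real) \<Rightarrow> bool" where
  "nonneg_weight \<omega> \<longleftrightarrow> (\<forall>e\<in>E. 0 \<le> \<omega> e)"

definition pos_weight :: "('a set \<Rightarrow> real) \<Rightarrow> bool" where
  "pos_weight \<omega> \<longleftrightarrow> (\<forall>e\<in>E. 0 < \<omega> e)"

lemma pos_imp_nonneg: "pos_weight \<omega> \<Longrightarrow> nonneg_weight \<omega>"
  by (force simp: pos_weight_def nonneg_weight_def)

lemma nonneg_weight_unit: "nonneg_weight (\<lambda>e. 1)"
  by (simp add: nonneg_weight_def)

lemma edge_path_length_nonneg:
  assumes "nonneg_weight \<omega>" "edge_path G S p"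
  shows "0 \<le> path_length \<omega> p"
  using assms by (intro path_length_nonneg)
    (auto simp: edge_path_iff nonneg_weight_def elim: successively_mono)

lemma fpp_dist_le:
  assumes "nonneg_weight \<omega>" "path_between G S x y p"
  shows "fpp_dist G S \<omega> x y \<le> path_length \<omega> p"
  unfolding fpp_dist_def
proof (rule cINF_lower)
  show "bdd_below (path_length \<omega> ` {p. path_between G S x y p})"
    using edge_path_length_nonneg[OF assms(1)] by (intro bdd_belowI2[of _ 0]) (auto simp: path_between_def)
qed (use assms in auto)

lemma fpp_dist_greatest:
  assumes "x \<in> carrier G" "y \<in> carrier G" "\<And>p. path_between G S x y p \<Longrightarrow> c \<le> path_length \<omega> p"
  shows "c \<le> fpp_dist G S \<omega> x y"
  unfolding fpp_dist_def using assms path_exists by (intro cINF_greatest) auto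

lemma fpp_dist_nonneg:
  assumes "nonneg_weight \<omega>" "x \<in> carrier G" "y \<in> carrier G"
  shows "0 \<le> fpp_dist G S \<omega> x y"
  using assms edge_path_length_nonneg by (intro fpp_dist_greatest) (auto simp: path_between_def)

lemma fpp_dist_refl:
  assumes "nonneg_weight \<omega>" "x \<in> carrier G"
  shows "fpp_dist G S \<omega> x x = 0"
  using fpp_dist_le[OF assms(1), of x x "[x]"] fpp_dist_nonneg[OF assms(1), of x x] assms
  by (auto simp: path_between_def edge_path_singleton)

lemma fpp_dist_triangle:
  assumes \<omega>: "nonneg_weight \<omega>" and xyz: "x \<in> carrier G" "y \<in> carrier G" "z \<in> carrier G"
  shows "fpp_dist G S \<omega> x z \<le> fpp_dist G S \<omega> x y + fpp_dist G S \<omega> y z"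
proof -
  have "fpp_dist G S \<omega> x z - path_length \<omega> p \<le> fpp_dist G S \<omega> y z" if p: "path_between G S x y p" for p
  proof (rule fpp_dist_greatest[OF xyz(2,3)])
    fix q assume q: "path_between G S y z q"
    show "fpp_dist G S \<omega> x z - path_length \<omega> p \<le> path_length \<omega> q"
      using fpp_dist_le[OF \<omega> path_between_trans(1)[OF p q]] path_between_trans(2)[OF p q, of \<omega>] by linarith
  qed
  then have "fpp_dist G S \<omega> x z - fpp_dist G S \<omega> y z \<le> fpp_dist G S \<omega> x y"
    by (intro fpp_dist_greatest[OF xyz(1,2)]) (auto simp: algebra_simps)
  then show ?thesis by simp
qed

lemma fpp_dist_sym:
  assumes "nonneg_weight \<omega>" "x \<in> carrier G" "y \<in> carrier G"
  shows "fpp_dist G S \<omega> x y = fpp_dist G S \<omega> y x"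
proof -
  have "fpp_dist G S \<omega> x y \<le> fpp_dist G S \<omega> y x" if "x \<in> carrier G" "y \<in> carrier G" for x y
    using fpp_dist_le[OF assms(1) path_between_rev] that
    by (intro fpp_dist_greatest) (auto simp: path_length_rev)
  then show ?thesis using assms by (intro antisym) auto
qed

lemma fpp_geodesic_rev:
  assumes "nonneg_weight \<omega>" "fpp_geodesic G S \<omega> x y p"
  shows "fpp_geodesic G S \<omega> y x (rev p)"
  using assms path_between_rev[of x y p] path_between_carrier[of x y p] fpp_dist_sym[OF assms(1), of x y]
  by (simp add: fpp_geodesic_def path_length_rev)

text \<open>By the triangle inequality through the ends of \<beta>, a shortcut for the infix would
  shorten the whole path.\<close>

lemma fpp_geodesic_infix:
  assumes \<omega>: "nonneg_weight \<omega>" and g: "fpp_geodesic G S \<omega> x y (\<alpha> @ \<beta> @ \<gamma>)" and "\<beta> \<noteq> []"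
  shows "fpp_geodesic G S \<omega> (hd \<beta>) (last \<beta>) \<beta>"
proof -
  obtain s \<beta>' where s: "\<beta> = s # \<beta>'" using \<open>\<beta> \<noteq> []\<close> by (cases \<beta>) auto
  obtain t \<beta>'' where t: "\<beta> = \<beta>'' @ [t]" using \<open>\<beta> \<noteq> []\<close> by (cases \<beta> rule: rev_cases) auto
  have st: "hd \<beta> = s" "last \<beta> = t" using s by simp (simp add: t)
  have eq: "\<alpha> @ \<beta> @ \<gamma> = \<alpha> @ s # (\<beta>' @ \<gamma>)" "s # (\<beta>' @ \<gamma>) = \<beta>'' @ t # \<gamma>" using s t by auto
  have ep: "edge_path G S (\<alpha> @ [s])" "edge_path G S \<beta>" "edge_path G S (t # \<gamma>)"
    using g edge_path_glue[of G S \<alpha> s "\<beta>' @ \<gamma>"] edge_path_glue[of G S \<beta>'' t \<gamma>]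
    unfolding fpp_geodesic_def path_between_def eq t[symmetric] by auto
  have len: "path_length \<omega> (\<alpha> @ \<beta> @ \<gamma>) = path_length \<omega> (\<alpha> @ [s]) + path_length \<omega> \<beta> + path_length \<omega> (t # \<gamma>)"
    using path_length_glue[of \<omega> \<alpha> s "\<beta>' @ \<gamma>"] path_length_glue[of \<omega> \<beta>'' t \<gamma>]
    unfolding eq t[symmetric] by auto
  have x: "x = hd (\<alpha> @ [s])"
    using g unfolding fpp_geodesic_def path_between_def by (auto simp: hd_append s)
  have y: "y = last (t # \<gamma>)"
    using g st \<open>\<beta> \<noteq> []\<close> unfolding fpp_geodesic_def path_between_def by (auto simp: last_append)
  have p: "path_between G S x s (\<alpha> @ [s])" "path_between G S s t \<beta>" "path_between G S t y (t # \<gamma>)"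
    using ep x y st by (auto simp: path_between_def)
  have c: "x \<in> carrier G" "s \<in> carrier G" "t \<in> carrier G" "y \<in> carrier G"
    using path_between_carrier p by auto
  have "fpp_dist G S \<omega> x y \<le> path_length \<omega> (\<alpha> @ [s]) + fpp_dist G S \<omega> s t + path_length \<omega> (t # \<gamma>)"
    using fpp_dist_triangle[OF \<omega> c(1,2,4)] fpp_dist_triangle[OF \<omega> c(2,3,4)]
      fpp_dist_le[OF \<omega> p(1)] fpp_dist_le[OF \<omega> p(3)] by linarith
  with g len fpp_dist_le[OF \<omega> p(2)] have "path_length \<omega> \<beta> = fpp_dist G S \<omega> s t"
    by (simp add: fpp_geodesic_def)
  then show ?thesis using p(2) st by (simp add: fpp_geodesic_def)
qed

text \<open>Between two visits to a vertex there would be a closed geodesic, of length 0, whereas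
  its first edge has positive weight.\<close>

lemma fpp_geodesic_distinct:
  assumes \<omega>: "pos_weight \<omega>" and g: "fpp_geodesic G S \<omega> x y p"
  shows "distinct p"
proof (rule ccontr)
  assume "\<not> distinct p"
  then obtain \<alpha> \<beta> \<gamma> v where p: "p = \<alpha> @ [v] @ \<beta> @ [v] @ \<gamma>" using not_distinct_decomp by blast
  have "fpp_geodesic G S \<omega> v v (v # \<beta> @ [v])"
    using fpp_geodesic_infix[OF pos_imp_nonneg[OF \<omega>], of x y \<alpha> "v # \<beta> @ [v]" \<gamma>] g p by simp
  then have l: "path_length \<omega> (v # \<beta> @ [v]) = 0" and e: "edge_path G S (v # \<beta> @ [v])"
    using fpp_dist_refl[OF pos_imp_nonneg[OF \<omega>], of v] path_between_carrier
    by (auto simp: fpp_geodesic_def path_between_def edge_path_iff)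
  obtain u \<beta>' where u: "\<beta> @ [v] = u # \<beta>'" by (cases \<beta>) auto
  have "0 < \<omega> {v, u}" "0 \<le> path_length \<omega> (u # \<beta>')"
    using e \<omega> edge_path_length_nonneg[OF pos_imp_nonneg[OF \<omega>], of "u # \<beta>'"]
    by (auto simp: u edge_path_Cons2 pos_weight_def)
  with l show False by (simp add: u)
qed

subsection \<open>The word metric\<close>

text \<open>Lengths for unit weights are natural numbers, so the infimum is attained.\<close>

lemma word_geodesic_exists:
  assumes "x \<in> carrier G" "y \<in> carrier G"
  obtains p where "path_between G S x y p" "D x y = real (length p - 1)"
proof -
  obtain p where p: "path_between G S x y p" "\<And>q. path_between G S x y q \<Longrightarrow> length p \<le> length q"
    using path_exists[OF assms] ex_has_least_nat[of "path_between G S x y" _ length] by blast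
  have ne: "q \<noteq> []" if "path_between G S x y q" for q using that by (simp add: path_between_def edge_path_iff)
  have "D x y \<le> real (length p - 1)"
    using fpp_dist_le[OF nonneg_weight_unit p(1)] ne[OF p(1)] by (simp add: word_dist_def path_length_unit)
  moreover have "real (length p - 1) \<le> D x y"
    unfolding word_dist_def
  proof (rule fpp_dist_greatest[OF assms])
    fix q assume "path_between G S x y q"
    then show "real (length p - 1) \<le> path_length (\<lambda>e. 1) q"
      using p(2)[of q] ne[of q] by (simp add: path_length_unit)
  qed
  ultimately show thesis using that p(1) by force
qed

definition ndist :: "'a \<Rightarrow> 'a \<Rightarrow> nat" where "ndist x y = nat \<lfloor>D x y\<rfloor>"

lemma D_eq_ndist: "x \<in> carrier G \<Longrightarrow> y \<in> carrier G \<Longrightarrow> D x y = real (ndist x y)"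
  by (metis floor_of_nat nat_int ndist_def word_geodesic_exists)

lemma D_le_length: "path_between G S x y p \<Longrightarrow> D x y \<le> real (length p - 1)"
  using fpp_dist_le[OF nonneg_weight_unit, of x y p]
  by (simp add: path_between_def edge_path_iff word_dist_def path_length_unit)

lemma D_nonneg: "x \<in> carrier G \<Longrightarrow> y \<in> carrier G \<Longrightarrow> 0 \<le> D x y"
  by (simp add: word_dist_def fpp_dist_nonneg nonneg_weight_unit)

lemma D_refl: "x \<in> carrier G \<Longrightarrow> D x x = 0"
  by (simp add: word_dist_def fpp_dist_refl nonneg_weight_unit)

lemma D_sym: "x \<in> carrier G \<Longrightarrow> y \<in> carrier G \<Longrightarrow> D x y = D y x"
  by (simp add: word_dist_def fpp_dist_sym nonneg_weight_unit)

lemma D_triangle: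
  "x \<in> carrier G \<Longrightarrow> y \<in> carrier G \<Longrightarrow> z \<in> carrier G \<Longrightarrow> D x z \<le> D x y + D y z"
  by (simp add: word_dist_def fpp_dist_triangle nonneg_weight_unit)

lemma D_edge: "{x, y} \<in> E \<Longrightarrow> D x y \<le> 1"
  using D_le_length[of x y "[x, y]"] by (auto simp: path_between_def edge_path_iff edge_iff)

lemma D_eq_0:
  assumes "x \<in> carrier G" "y \<in> carrier G" "D x y = 0" shows "x = y"
proof -
  obtain p where "path_between G S x y p" "length p - 1 = 0"
    using word_geodesic_exists[OF assms(1,2)] assms(3) by (metis of_nat_eq_0_iff)
  then show ?thesis by (cases p) (auto simp: path_between_def edge_path_iff)
qed

lemma word_geodesic_nth:
  assumes "x \<in> carrier G" "y \<in> carrier G"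
  obtains g where "g 0 = x" "g (ndist x y) = y" "\<And>i. i \<le> ndist x y \<Longrightarrow> g i \<in> carrier G"
    "\<And>i j. i \<le> j \<Longrightarrow> j \<le> ndist x y \<Longrightarrow> D (g i) (g j) = real (j - i)"
    "\<And>i. i < ndist x y \<Longrightarrow> {g i, g (Suc i)} \<in> E"
proof -
  obtain p where p: "path_between G S x y p" "D x y = real (length p - 1)"
    using word_geodesic_exists[OF assms] by blast
  have len: "length p = Suc (ndist x y)" and ne: "p \<noteq> []"
    using p by (auto simp: D_eq_ndist[OF assms] path_between_def edge_path_iff Suc_pred)
  have ends: "p ! 0 = x" "p ! ndist x y = y"
    using p ne len by (auto simp: path_between_def hd_conv_nth last_conv_nth)
  have mem: "p ! i \<in> carrier G" if "i \<le> ndist x y" for i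
    using p that len nth_mem[of i p] by (auto simp: path_between_def edge_path_iff simp del: nth_mem)
  have edge: "{p ! i, p ! Suc i} \<in> E" if "i < ndist x y" for i
    using p that len by (auto simp: path_between_def edge_path_def)
  have le: "D (p ! i) (p ! j) \<le> real (j - i)" if "i \<le> j" "j \<le> ndist x y" for i j
    using that
  proof (induction j)
    case (Suc j)
    show ?case
    proof (cases "i = Suc j")
      case False
      then have "D (p ! i) (p ! Suc j) \<le> D (p ! i) (p ! j) + D (p ! j) (p ! Suc j)"
        using Suc by (intro D_triangle mem) auto
      also have "\<dots> \<le> real (j - i) + 1"
        using Suc False edge[of j] D_edge by (intro add_mono) auto
      finally show ?thesis using False Suc by (simp add: Suc_diff_le)
    qed (use D_refl mem Suc in auto)
  qed (use D_refl mem in auto)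
  have eq: "D (p ! i) (p ! j) = real (j - i)" if "i \<le> j" "j \<le> ndist x y" for i j
  proof -
    have "D x y \<le> D x (p ! i) + D (p ! i) (p ! j) + D (p ! j) y"
      using D_triangle[OF assms(1) mem[of i] assms(2)] D_triangle[OF mem[of i] mem[of j] assms(2)] that
      by linarith
    moreover have "D x (p ! i) \<le> real i" "D (p ! j) y \<le> real (ndist x y - j)"
      using le[of 0 i] le[of j "ndist x y"] that ends by auto
    ultimately show ?thesis using le[OF that] that by (simp add: D_eq_ndist[OF assms])
  qed
  show thesis using that[of "\<lambda>i. p ! i"] ends mem eq edge by blast
qed

lemma fpp_dist_le_chain:
  assumes \<omega>: "nonneg_weight \<omega>" and "i \<le> j"
    and "\<And>k. i \<le> k \<Longrightarrow> k < j \<Longrightarrow> {g k, g (Suc k)} \<in> E \<and> \<omega> {g k, g (Suc k)} \<le> c"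
    and "g i \<in> carrier G"
  shows "fpp_dist G S \<omega> (g i) (g j) \<le> c * real (j - i)"
  using assms(2,3)
proof (induction j)
  case 0
  then show ?case using fpp_dist_refl[OF \<omega>] assms(4) by simp
next
  case (Suc j)
  show ?case
  proof (cases "i = Suc j")
    case False
    then have e: "{g j, g (Suc j)} \<in> E" "\<omega> {g j, g (Suc j)} \<le> c" "i \<le> j" using Suc by auto
    have c: "g j \<in> carrier G" "g (Suc j) \<in> carrier G" using e by (auto simp: edge_iff)
    have "fpp_dist G S \<omega> (g j) (g (Suc j)) \<le> \<omega> {g j, g (Suc j)}"
      using fpp_dist_le[OF \<omega>, of "g j" "g (Suc j)" "[g j, g (Suc j)]"] e c
      by (auto simp: path_between_def edge_path_iff)
    moreover have "fpp_dist G S \<omega> (g i) (g j) \<le> c * real (j - i)" using Suc e by auto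
    ultimately show ?thesis
      using fpp_dist_triangle[OF \<omega> assms(4) c] e by (simp add: Suc_diff_le algebra_simps)
  qed (use fpp_dist_refl[OF \<omega>] assms(4) in simp)
qed

text \<open>The vertices of a word geodesic from \<open>x\<close> to \<open>y\<close> stay within
  \<open>D w x + D x y\<close> of \<open>w\<close>, where each edge costs at most
  \<open>b\<close>.\<close>

lemma fpp_dist_le_ball:
  assumes \<omega>: "nonneg_weight \<omega>" and c: "w \<in> carrier G" "x \<in> carrier G" "y \<in> carrier G"
    and le: "\<And>u v. {u, v} \<in> E \<Longrightarrow> D w u \<le> r \<Longrightarrow> D w v \<le> r \<Longrightarrow> \<omega> {u, v} \<le> b"
    and r: "D w x + D x y \<le> r"
  shows "fpp_dist G S \<omega> x y \<le> b * D x y"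
proof -
  obtain g where g: "g 0 = x" "g (ndist x y) = y" "\<And>i. i \<le> ndist x y \<Longrightarrow> g i \<in> carrier G"
    "\<And>i j. i \<le> j \<Longrightarrow> j \<le> ndist x y \<Longrightarrow> D (g i) (g j) = real (j - i)"
    "\<And>i. i < ndist x y \<Longrightarrow> {g i, g (Suc i)} \<in> E"
    using word_geodesic_nth[OF c(2,3)] by metis
  have "D w (g i) \<le> r" if "i \<le> ndist x y" for i
    using D_triangle[OF c(1,2) g(3)[OF that]] g(4)[of 0 i] g(1) that r D_eq_ndist[OF c(2,3)] by auto
  then have "fpp_dist G S \<omega> (g 0) (g (ndist x y)) \<le> b * real (ndist x y - 0)"
    using g c by (intro fpp_dist_le_chain[OF \<omega>]) (auto intro!: le)
  then show ?thesis using g D_eq_ndist[OF c(2,3)] by simp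
qed

subsection \<open>Counting\<close>

definition nball :: "'a \<Rightarrow> nat \<Rightarrow> 'a set" where "nball w r = {v \<in> carrier G. D w v \<le> real r}"

lemma nball_Suc_subset:
  assumes "w \<in> carrier G"
  shows "nball w (Suc r) \<subseteq> nball w r \<union> (\<Union>u\<in>nball w r. {v. {u, v} \<in> E})"
proof
  fix v assume v: "v \<in> nball w (Suc r)"
  show "v \<in> nball w r \<union> (\<Union>u\<in>nball w r. {v. {u, v} \<in> E})"
  proof (cases "D w v \<le> real r")
    case False
    then have n: "ndist w v = Suc r" using v D_eq_ndist[OF assms, of v] by (auto simp: nball_def)
    obtain g where g: "g 0 = w" "g (ndist w v) = v" "\<And>i. i \<le> ndist w v \<Longrightarrow> g i \<in> carrier G"
      "\<And>i j. i \<le> j \<Longrightarrow> j \<le> ndist w v \<Longrightarrow> D (g i) (g j) = real (j - i)"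
      "\<And>i. i < ndist w v \<Longrightarrow> {g i, g (Suc i)} \<in> E"
      using word_geodesic_nth[OF assms, of v] v unfolding nball_def by blast
    have "g r \<in> nball w r" "{g r, v} \<in> E" using g(3)[of r] g(4)[of 0 r] g(1,2) g(5)[of r] n by (auto simp: nball_def)
    then show ?thesis by blast
  qed (use v in \<open>auto simp: nball_def\<close>)
qed

lemma finite_nball: "w \<in> carrier G \<Longrightarrow> finite (nball w r)"
  and card_nball: "w \<in> carrier G \<Longrightarrow> card (nball w r) \<le> Suc (card S) ^ r"
proof -
  assume w: "w \<in> carrier G"
  have "finite (nball w r) \<and> card (nball w r) \<le> Suc (card S) ^ r"
  proof (induction r)
    case 0
    have "nball w 0 \<subseteq> {w}" using D_eq_0[OF w] D_nonneg[OF w] by (auto simp: nball_def) (metis antisym)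
    then have "finite (nball w 0)" "card (nball w 0) \<le> card {w}"
      by (blast intro: finite_subset, intro card_mono) auto
    then show ?case by simp
  next
    case (Suc r)
    let ?N = "\<Union>u\<in>nball w r. {v. {u, v} \<in> E}"
    have fin: "finite (nball w r \<union> ?N)" using Suc finite_neighbours by auto
    have "card (nball w (Suc r)) \<le> card (nball w r \<union> ?N)" by (rule card_mono[OF fin nball_Suc_subset[OF w]])
    also have "\<dots> \<le> card (nball w r) + card ?N" by (rule card_Un_le)
    also have "card ?N \<le> (\<Sum>u\<in>nball w r. card {v. {u, v} \<in> E})" using Suc by (intro card_UN_le) auto
    also have "\<dots> \<le> card (nball w r) * card S" using card_neighbours sum_bounded_above[of "nball w r" _ "card S"] by auto
    finally have "card (nball w (Suc r)) \<le> card (nball w r) * Suc (card S)" by simp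
    also have "\<dots> \<le> Suc (card S) ^ r * Suc (card S)" using Suc by (intro mult_right_mono) auto
    finally show ?case using finite_subset[OF nball_Suc_subset[OF w] fin] by (simp add: mult.commute)
  qed
  then show "finite (nball w r)" "card (nball w r) \<le> Suc (card S) ^ r" by auto
qed

definition paths_from :: "'a \<Rightarrow> nat \<Rightarrow> 'a list set" where
  "paths_from x n = {p. edge_path G S p \<and> hd p = x \<and> length p = Suc n}"

lemma paths_from_Suc: "paths_from x (Suc n) \<subseteq> (\<lambda>(y, p). x # p) ` (SIGMA y:{y. {x, y} \<in> E}. paths_from y n)"
proof
  fix p assume p: "p \<in> paths_from x (Suc n)"
  then obtain y q where "p = x # y # q"
    by (cases p; cases "tl p") (auto simp: paths_from_def)
  with p have "{x, y} \<in> E" "y # q \<in> paths_from y n" "p = (\<lambda>(y, p). x # p) (y, y # q)"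
    by (auto simp: paths_from_def edge_path_Cons2)
  then show "p \<in> (\<lambda>(y, p). x # p) ` (SIGMA y:{y. {x, y} \<in> E}. paths_from y n)" by blast
qed

lemma finite_paths_from: "finite (paths_from x n)" and card_paths_from: "card (paths_from x n) \<le> card S ^ n"
proof -
  have "finite (paths_from x n) \<and> card (paths_from x n) \<le> card S ^ n"
  proof (induction n arbitrary: x)
    case 0
    have "paths_from x 0 \<subseteq> {[x]}" by (auto simp: paths_from_def length_Suc_conv)
    then have "finite (paths_from x 0)" "card (paths_from x 0) \<le> card {[x]}"
      by (blast intro: finite_subset, intro card_mono) auto
    then show ?case by simp
  next
    case (Suc n)
    let ?A = "SIGMA y:{y. {x, y} \<in> E}. paths_from y n"
    have fin: "finite ?A" using Suc finite_neighbours by auto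
    have "card (paths_from x (Suc n)) \<le> card ((\<lambda>(y, p). x # p) ` ?A)"
      using fin by (intro card_mono paths_from_Suc) auto
    also have "\<dots> \<le> card ?A" using fin by (rule card_image_le)
    also have "\<dots> = (\<Sum>y | {x, y} \<in> E. card (paths_from y n))"
      using Suc finite_neighbours by (intro card_SigmaI) auto
    also have "\<dots> \<le> card {y. {x, y} \<in> E} * card S ^ n"
      using Suc sum_bounded_above[of "{y. {x, y} \<in> E}" "\<lambda>y. card (paths_from y n)" "card S ^ n"] by auto
    also have "\<dots> \<le> card S ^ Suc n" using card_neighbours[of x] by (simp add: mult_right_mono)
    finally show ?case using finite_subset[OF paths_from_Suc] fin by blast
  qed
  then show "finite (paths_from x n)" "card (paths_from x n) \<le> card S ^ n" by auto
qed

lemma countable_carrier: "countable (carrier G)"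
proof -
  have "carrier G \<subseteq> (\<Union>r. nball \<one> r)"
  proof
    fix g assume "g \<in> carrier G"
    then have "g \<in> nball \<one> (ndist \<one> g)" by (simp add: nball_def D_eq_ndist)
    then show "g \<in> (\<Union>r. nball \<one> r)" by blast
  qed
  moreover have "countable (\<Union>r. nball \<one> r)"
    by (rule countable_UN) (simp_all add: countable_finite finite_nball)
  ultimately show ?thesis by (rule countable_subset)
qed

lemma countable_edges: "countable E"
proof -
  have "E \<subseteq> (\<lambda>(x, y). {x, y}) ` (carrier G \<times> carrier G)"
  proof
    fix e assume "e \<in> E"
    then obtain x y where "e = {x, y}" "x \<in> carrier G" "y \<in> carrier G" by (rule edge_cases)
    then show "e \<in> (\<lambda>(x, y). {x, y}) ` (carrier G \<times> carrier G)" by force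
  qed
  moreover have "countable ((\<lambda>(x, y). {x, y}) ` (carrier G \<times> carrier G))"
    by (intro countable_image countable_SIGMA countable_carrier)
  ultimately show ?thesis by (rule countable_subset)
qed

end

section \<open>Hyperbolic geometry\<close>

text \<open>Frink's metrization lemma: the chain is cut where the partial sums pass half of the total.\<close>

lemma frink_chain:
  fixes \<rho> :: "'v \<Rightarrow> 'v \<Rightarrow> real" and u :: "nat \<Rightarrow> 'v"
  assumes nn: "\<And>x y. 0 \<le> \<rho> x y" and k: "1 \<le> k" "k\<^sup>2 \<le> 2"
    and q: "\<And>x y z. x \<in> V \<Longrightarrow> y \<in> V \<Longrightarrow> z \<in> V \<Longrightarrow> \<rho> x z \<le> k * max (\<rho> x y) (\<rho> y z)"
    and "\<And>i. l \<le> i \<Longrightarrow> i \<le> h \<Longrightarrow> u i \<in> V" "l < h"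
  shows "\<rho> (u l) (u h) \<le> k\<^sup>2 * (\<Sum>i=l..<h. \<rho> (u i) (u (Suc i)))"
  using assms(5,6)
proof (induction "h - l" arbitrary: l h rule: less_induct)
  case less
  define T where "T a b = (\<Sum>i=a..<b. \<rho> (u i) (u (Suc i)))" for a b
  define S where "S = T l h"
  have Tnn: "0 \<le> T a b" for a b unfolding T_def using nn by (intro sum_nonneg) auto
  have Snn: "0 \<le> S" using Tnn S_def by simp
  have split: "T a c = T a b + T b c" if "a \<le> b" "b \<le> c" for a b c
    using that unfolding T_def by (simp add: sum.atLeastLessThan_concat)
  define P where "P j \<longleftrightarrow> l \<le> j \<and> j < h \<and> T l j \<le> S / 2" for j
  have "P l" using less Snn by (simp add: P_def T_def)
  then obtain j where j: "P j" "\<And>j'. P j' \<Longrightarrow> j' \<le> j"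
    using ex_has_greatest_nat[of P l "\<lambda>j. j" h] by (auto simp: P_def)
  have jl: "l \<le> j" "j < h" "T l j \<le> S / 2" using j(1) by (auto simp: P_def)
  have right: "T (Suc j) h \<le> S / 2" if "Suc j < h"
  proof -
    have "\<not> P (Suc j)" using j(2)[of "Suc j"] by auto
    then have "T l (Suc j) > S / 2" using that jl by (auto simp: P_def)
    then show ?thesis using split[of l "Suc j" h] that jl S_def by simp
  qed
  have mid: "\<rho> (u j) (u (Suc j)) \<le> S"
    using split[of l j h] split[of j "Suc j" h] jl Tnn[of l j] Tnn[of "Suc j" h] by (simp add: S_def T_def)
  \<comment> \<open>Here \<open>k\<^sup>2 \<le> 2\<close> enters: halving the sum absorbs the factor
    of the induction hypothesis, so each outer piece costs at most \<open>S\<close> again, and two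
    uses of \<open>q\<close> produce the factor \<open>k\<^sup>2\<close>.\<close>
  have half: "k\<^sup>2 * (S / 2) \<le> S" using k(2) Snn mult_right_mono[of "k\<^sup>2" 2 "S / 2"] by simp
  have SkS: "S \<le> k * S" using k(1) Snn mult_right_mono[of 1 k S] by simp
  have left: "\<rho> (u l) (u (Suc j)) \<le> k * S"
  proof (cases "j = l")
    case False
    then have "\<rho> (u l) (u j) \<le> k\<^sup>2 * T l j" unfolding T_def using jl less by (intro less.hyps) auto
    also have "\<dots> \<le> k\<^sup>2 * (S / 2)" using jl by (intro mult_left_mono) auto
    finally have "max (\<rho> (u l) (u j)) (\<rho> (u j) (u (Suc j))) \<le> S" using half mid by simp
    then have "k * max (\<rho> (u l) (u j)) (\<rho> (u j) (u (Suc j))) \<le> k * S"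
      using k by (intro mult_left_mono) auto
    then show ?thesis using q[of "u l" "u j" "u (Suc j)"] less jl by force
  qed (use mid SkS in simp)
  have "\<rho> (u l) (u h) \<le> k\<^sup>2 * S"
  proof (cases "Suc j = h")
    case True
    have "k * S \<le> k * (k * S)" using SkS k by (intro mult_left_mono) auto
    then show ?thesis using True left by (simp add: power2_eq_square)
  next
    case False
    then have sj: "Suc j < h" using jl by simp
    then have "\<rho> (u (Suc j)) (u h) \<le> k\<^sup>2 * T (Suc j) h" unfolding T_def using jl less by (intro less.hyps) auto
    also have "\<dots> \<le> k\<^sup>2 * (S / 2)" using right[OF sj] by (intro mult_left_mono) auto
    finally have "max (\<rho> (u l) (u (Suc j))) (\<rho> (u (Suc j)) (u h)) \<le> k * S" using half left SkS by simp
    then have "k * max (\<rho> (u l) (u (Suc j))) (\<rho> (u (Suc j)) (u h)) \<le> k * (k * S)"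
      using k by (intro mult_left_mono) auto
    then show ?thesis using q[of "u l" "u (Suc j)" "u h"] less jl sj by (force simp: power2_eq_square)
  qed
  then show ?case by (simp add: S_def T_def)
qed

locale hyperbolic_cayley_graph = cayley_graph +
  fixes \<delta> :: real
  assumes delta_nonneg: "0 \<le> \<delta>"
    and hyperbolic: "w \<in> carrier G \<Longrightarrow> x \<in> carrier G \<Longrightarrow> y \<in> carrier G \<Longrightarrow> z \<in> carrier G \<Longrightarrow>
      min (gromov_product G S w x y) (gromov_product G S w y z) - \<delta> \<le> gromov_product G S w x z"
begin

abbreviation "gp \<equiv> gromov_product G S"

lemma gp_sym: "x \<in> carrier G \<Longrightarrow> y \<in> carrier G \<Longrightarrow> gp w x y = gp w y x"
  by (simp add: gromov_product_def D_sym)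

lemma gp_refl: "w \<in> carrier G \<Longrightarrow> x \<in> carrier G \<Longrightarrow> gp w x x = D w x"
  by (simp add: gromov_product_def D_refl D_sym)

lemma gp_le: "w \<in> carrier G \<Longrightarrow> x \<in> carrier G \<Longrightarrow> y \<in> carrier G \<Longrightarrow> gp w x y \<le> D w x"
  using D_triangle[of y x w] D_sym[of x w] D_sym[of x y] D_sym[of y w] by (simp add: gromov_product_def)

lemma gp_edge:
  assumes "{x, y} \<in> E" "w \<in> carrier G"
  shows "D w x - 1 \<le> gp w x y"
  using assms D_edge[OF assms(1)] D_triangle[of w y x] D_sym[of x y] D_sym[of x w] D_sym[of y w]
  by (auto simp: gromov_product_def edge_iff)

text \<open>If every sphere were visited at most \<open>exp (\<epsilon> * r / 2)\<close> times, the
  sum in Frink's lemma would be at most the geometric tail of ratio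
  \<open>exp (- \<epsilon> / 2)\<close> from \<open>K\<close> on. The second hypothesis on
  \<open>K\<close> makes this too small: its divisor 2 is the bound on \<open>k\<^sup>2\<close>, and
  the 1 added to \<open>c0\<close> is the loss in \<open>gp_edge\<close>.\<close>

lemma path_visits:
  assumes \<epsilon>: "0 < \<epsilon>" "exp (2 * \<epsilon> * \<delta>) \<le> 2" and w: "w \<in> carrier G"
    and p: "path_between G S x y p" and gp: "gp w x y \<le> c0"
    and K: "c0 < real K" "exp (- \<epsilon> / 2) ^ K / (1 - exp (- \<epsilon> / 2)) < exp (- \<epsilon> * (c0 + 1)) / 2"
    and far: "\<And>v. v \<in> set p \<Longrightarrow> real K \<le> D w v"
  shows "\<exists>r\<ge>K. exp (\<epsilon> * real r / 2) < real (card {i. i < length p - 1 \<and> ndist w (p ! i) = r})"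
proof (rule ccontr)
  assume neg: "\<not> ?thesis"
  define n where "n = length p - 1"
  define k where "k = exp (\<epsilon> * \<delta>)"
  have ne: "p \<noteq> []" and sub: "set p \<subseteq> carrier G" using p by (auto simp: path_between_def edge_path_def)
  have mem: "p ! i \<in> carrier G" if "i \<le> n" for i
    using that ne sub nth_mem[of i p] by (cases p) (auto simp: n_def simp del: nth_mem)
  have ends: "p ! 0 = x" "p ! n = y"
    using p ne by (auto simp: path_between_def n_def hd_conv_nth last_conv_nth)
  \<comment> \<open>Frink's lemma needs an edge. A path with one vertex has \<open>x = y\<close> and
    \<open>gp w x x = D w x\<close>, which is at least \<open>K > c0\<close>.\<close>
  have "0 < n"
  proof (rule ccontr)
    assume "\<not> 0 < n"
    then have "x = y" using ends by simp
    then have "D w x \<le> c0" using gp gp_refl[OF w] mem[of 0] ends by simp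
    then show False using K(1) far[of x] p ne by (auto simp: path_between_def)
  qed
  have k: "1 \<le> k" "k\<^sup>2 \<le> 2"
    using \<epsilon> delta_nonneg by (auto simp: k_def exp_double[symmetric] mult_ac)
  have "exp (- \<epsilon> * gp w (p ! 0) (p ! n))
      \<le> k\<^sup>2 * (\<Sum>i=0..<n. exp (- \<epsilon> * gp w (p ! i) (p ! Suc i)))"
  proof (rule frink_chain[where V = "carrier G"])
    fix a b c assume abc: "a \<in> carrier G" "b \<in> carrier G" "c \<in> carrier G"
    \<comment> \<open>The four-point inequality turns into the quasi-ultrametric inequality with
      constant \<open>exp (\<epsilon> * \<delta>)\<close>.\<close>
    have "- \<epsilon> * gp w a c \<le> \<epsilon> * \<delta> + max (- \<epsilon> * gp w a b) (- \<epsilon> * gp w b c)"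
    proof -
      have "\<epsilon> * (min (gp w a b) (gp w b c) - \<delta>) \<le> \<epsilon> * gp w a c"
        using hyperbolic[OF w abc] \<epsilon> by (intro mult_left_mono) auto
      moreover have "max (- \<epsilon> * gp w a b) (- \<epsilon> * gp w b c) = - \<epsilon> * min (gp w a b) (gp w b c)"
        using \<epsilon> by (auto simp: max_def min_def)
      ultimately show ?thesis by (simp add: algebra_simps)
    qed
    then have "exp (- \<epsilon> * gp w a c) \<le> exp (\<epsilon> * \<delta> + max (- \<epsilon> * gp w a b) (- \<epsilon> * gp w b c))" by simp
    also have "\<dots> = k * max (exp (- \<epsilon> * gp w a b)) (exp (- \<epsilon> * gp w b c))"
      unfolding k_def exp_add by (auto simp: max_def)
    finally show "exp (- \<epsilon> * gp w a c) \<le> k * max (exp (- \<epsilon> * gp w a b)) (exp (- \<epsilon> * gp w b c))" .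
  qed (use k mem \<open>0 < n\<close> in auto)
  also have "\<dots> \<le> 2 * (\<Sum>i=0..<n. exp (- \<epsilon> * (D w (p ! i) - 1)))"
  proof (intro mult_mono sum_mono)
    fix i assume "i \<in> {0..<n}"
    then have "{p ! i, p ! Suc i} \<in> E" using p by (auto simp: path_between_def edge_path_def n_def)
    then show "exp (- \<epsilon> * gp w (p ! i) (p ! Suc i)) \<le> exp (- \<epsilon> * (D w (p ! i) - 1))"
      using gp_edge[OF _ w] \<epsilon> by auto
  qed (use k in \<open>auto intro: sum_nonneg\<close>)
  also have "(\<Sum>i=0..<n. exp (- \<epsilon> * (D w (p ! i) - 1))) = exp \<epsilon> * (\<Sum>i<n. exp (- \<epsilon> * real (ndist w (p ! i))))"
  proof -
    have "(\<Sum>i=0..<n. exp (- \<epsilon> * (D w (p ! i) - 1))) = (\<Sum>i=0..<n. exp \<epsilon> * exp (- \<epsilon> * real (ndist w (p ! i))))"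
      by (intro sum.cong refl) (use mem w in \<open>auto simp: D_eq_ndist exp_add[symmetric] algebra_simps\<close>)
    then show ?thesis by (simp add: sum_distrib_left atLeast0LessThan)
  qed
  also have "(\<Sum>i<n. exp (- \<epsilon> * real (ndist w (p ! i)))) \<le> exp (- \<epsilon> / 2) ^ K / (1 - exp (- \<epsilon> / 2))"
  proof -
    define q where "q = exp (- \<epsilon> / 2)"
    have q: "0 < q" "q < 1" using \<epsilon> by (auto simp: q_def)
    define I where "I = (\<lambda>i. ndist w (p ! i)) ` {..<n}"
    have IK: "I \<subseteq> {K..Max I}"
    proof
      fix r assume r: "r \<in> I"
      then obtain i where i: "i < n" "r = ndist w (p ! i)" by (auto simp: I_def)
      have "p ! i \<in> set p" using i by (intro nth_mem) (auto simp: n_def)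
      then have "K \<le> r" using far[of "p ! i"] mem[of i] i w by (simp add: D_eq_ndist)
      then show "r \<in> {K..Max I}" using r by (auto simp: I_def)
    qed
    have "(\<Sum>i<n. exp (- \<epsilon> * real (ndist w (p ! i))))
        = (\<Sum>r\<in>I. \<Sum>i | i < n \<and> ndist w (p ! i) = r. exp (- \<epsilon> * real (ndist w (p ! i))))"
      unfolding I_def by (subst sum.image_gen[where g = "\<lambda>i. ndist w (p ! i)"]) auto
    also have "\<dots> = (\<Sum>r\<in>I. real (card {i. i < n \<and> ndist w (p ! i) = r}) * exp (- \<epsilon> * real r))"
      by (intro sum.cong refl) simp
    also have "\<dots> \<le> (\<Sum>r\<in>I. q ^ r)"
    proof (rule sum_mono)
      fix r assume "r \<in> I"
      then have "K \<le> r" using IK by auto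
      then have "real (card {i. i < n \<and> ndist w (p ! i) = r}) * exp (- \<epsilon> * real r)
          \<le> exp (\<epsilon> * real r / 2) * exp (- \<epsilon> * real r)"
        using neg by (intro mult_right_mono) (auto simp: n_def not_less)
      also have "\<dots> = q ^ r" by (simp add: q_def exp_of_nat_mult[symmetric] exp_add[symmetric] field_simps)
      finally show "real (card {i. i < n \<and> ndist w (p ! i) = r}) * exp (- \<epsilon> * real r) \<le> q ^ r" .
    qed
    also have "\<dots> \<le> (\<Sum>r=K..Max I. q ^ r)" using IK q by (intro sum_mono2) auto
    also have "\<dots> \<le> q ^ K / (1 - q)"
    proof (cases "K \<le> Max I")
      case True
      have "(\<Sum>r=K..Max I. q ^ r) = (q ^ K - q ^ Suc (Max I)) / (1 - q)"
        using sum_gp[of q K "Max I"] q True by simp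
      also have "\<dots> \<le> q ^ K / (1 - q)" using q by (intro divide_right_mono) auto
      finally show ?thesis .
    qed (use q in auto)
    finally show ?thesis by (simp add: q_def)
  qed
  also have "\<dots> < exp (- \<epsilon> * (c0 + 1)) / 2" by (rule K(2))
  finally have "exp (- \<epsilon> * gp w x y) < exp \<epsilon> * exp (- \<epsilon> * (c0 + 1))" by (simp add: ends)
  also have "\<dots> = exp (- \<epsilon> * c0)" by (simp add: exp_add[symmetric] algebra_simps)
  finally have "\<epsilon> * c0 < \<epsilon> * gp w x y" by simp
  then show False using gp \<epsilon> by simp
qed

text \<open>\<open>w\<close> lies at height \<open>t\<close> on a geodesic from the identity to
  \<open>x\<close>; \<open>o'\<close> branches off below \<open>t\<close>, and \<open>z\<close>
  follows it up to \<open>t\<close>. With products based at the identity, \<open>gp w o' z\<close>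
  equals \<open>t - (w|o') - (w|z) + (o'|z)\<close>, and each of the three products is estimated
  with one loss of \<delta>.\<close>

lemma gp_separation:
  assumes c: "x \<in> carrier G" "o' \<in> carrier G" "z \<in> carrier G" "w \<in> carrier G"
    and w: "D \<one> w = t" "D w x = D \<one> x - t"
    and o: "gp \<one> o' x + \<delta> < t" and z: "t \<le> gp \<one> z x"
  shows "gp w o' z \<le> 3 * \<delta>"
proof -
  have one: "\<one> \<in> carrier G" by simp
  note gd = gromov_product_def
  have s: "D o' w = D w o'" "D z w = D w z" "D w \<one> = D \<one> w" "D o' \<one> = D \<one> o'" "D z \<one> = D \<one> z"
    "D x \<one> = D \<one> x" "D x w = D w x" "D x o' = D o' x" "D x z = D z x" "D z o' = D o' z"
    using c by (auto simp: D_sym)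
  have wx: "gp \<one> w x = t" using w s by (simp add: gd)
  have 1: "gp \<one> o' z \<le> gp \<one> o' x + \<delta>"
    using hyperbolic[OF one c(2) c(3) c(1)] o z by linarith
  have 2: "t - \<delta> \<le> gp \<one> w z"
    using hyperbolic[OF one c(4) c(1) c(3)] wx z gp_sym[of x z "\<one>"] c by simp
  have 3: "gp \<one> o' x - \<delta> \<le> gp \<one> w o'"
    using hyperbolic[OF one c(4) c(1) c(2)] wx o gp_sym[of x o' "\<one>"] c delta_nonneg by simp
  show ?thesis using 1 2 3 w(1) s unfolding gd by (simp add: field_simps)
qed

end

section \<open>Environments that force geodesics through a vertex\<close>

text \<open>\<open>s\<close> is the last element with \<open>A\<close>, and \<open>t\<close> the
  first later one with \<open>B\<close>; so nothing between them has either property.\<close>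

lemma split_between:
  assumes "xs \<noteq> []" "A (hd xs)" "\<not> A (last xs)" "B (last xs)"
  obtains \<alpha> s \<beta> t \<gamma> where "xs = \<alpha> @ (s # \<beta> @ [t]) @ \<gamma>" "A s" "B t" "\<not> A t"
    "\<And>z. z \<in> set \<beta> \<Longrightarrow> \<not> A z \<and> \<not> B z"
proof -
  obtain \<alpha> s ys where 1: "xs = \<alpha> @ s # ys" "A s" "\<forall>z\<in>set ys. \<not> A z"
    using split_list_last_prop[of xs A] assms(1,2) hd_in_set by metis
  have "ys \<noteq> []" using 1 assms(3) by auto
  then have "B (last ys)" "last ys \<in> set ys" using 1 assms(4) by auto
  then obtain \<beta> t \<gamma> where 2: "ys = \<beta> @ t # \<gamma>" "B t" "\<forall>z\<in>set \<beta>. \<not> B z"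
    using split_list_first_prop[of ys B] by metis
  show thesis using that[of \<alpha> s \<beta> t \<gamma>] 1 2 by auto
qed

context cayley_graph
begin

text \<open>\<open>N r\<close> will grow exponentially in \<open>r\<close>: then a geodesic cannot spend \<open>N r\<close> steps between
  two vertices of the ball of radius \<open>r\<close>, since a word geodesic between them costs at most
  \<open>2 \<Lambda> r\<^sup>2\<close>.\<close>

definition good :: "(nat \<Rightarrow> nat) \<Rightarrow> real \<Rightarrow> real \<Rightarrow> ('a set \<Rightarrow> real) \<Rightarrow> 'a \<Rightarrow> nat \<Rightarrow> bool" where
  "good N c \<Lambda> \<omega> w r \<longleftrightarrow>
     (\<forall>u\<in>nball w (3 * r). \<forall>v\<in>nball w (3 * r). {u, v} \<in> E \<longrightarrow> \<omega> {u, v} \<le> \<Lambda> * real r) \<and>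
     (\<forall>x\<in>nball w r. \<forall>p\<in>paths_from x (N r). distinct p \<longrightarrow> c * real (N r) \<le> path_length \<omega> p)"

text \<open>One interval per edge, so that the event is a product over the coordinates: cheap edges
  on the segment, dear ones off it. The intended cut vertex \<open>\<sigma> L\<close> is the
  midpoint.\<close>

definition segment_config :: "(nat \<Rightarrow> 'a) \<Rightarrow> nat \<Rightarrow> real \<Rightarrow> real \<Rightarrow> real \<Rightarrow> real \<Rightarrow> 'a set \<Rightarrow> real set" where
  "segment_config \<sigma> L a a0 b0 b1 e =
     (if e \<in> {{\<sigma> i, \<sigma> (Suc i)} | i. i < 2 * L} then {a..a0} else {b0..b1})"

definition edges_in :: "'a set \<Rightarrow> 'a set set" where
  "edges_in V = {e \<in> E. e \<subseteq> V}"

definition word_segment :: "(nat \<Rightarrow> 'a) \<Rightarrow> nat \<Rightarrow> bool" where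
  "word_segment \<sigma> n \<longleftrightarrow> (\<forall>i\<le>n. \<sigma> i \<in> carrier G) \<and> (\<forall>i<n. {\<sigma> i, \<sigma> (Suc i)} \<in> E) \<and>
     (\<forall>i j. i \<le> j \<longrightarrow> j \<le> n \<longrightarrow> D (\<sigma> i) (\<sigma> j) = real (j - i))"

text \<open>Suppose that the midpoint is avoided. Comparison with the detour along the segment
  confines the geodesic to the ball of radius \<open>R\<close>. The stretch from its last visit to
  the first half to the next visit to the second half uses no cheap edge and pays at least
  \<open>b0\<close> per unit of distance, while following the segment costs at most
  \<open>a0\<close> per step. Either visit may have to be replaced by \<open>u\<close> or
  \<open>v\<close>, at an extra cost of order \<open>K\<close>, against which \<open>L\<close> is
  large.\<close>

lemma geodesic_between_cut:
  assumes \<omega>: "pos_weight \<omega>" and g: "fpp_geodesic G S \<omega> u v p"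
    and \<sigma>: "word_segment \<sigma> (2 * L)"
    and abc: "0 < a" "a \<le> a0" "a0 < b0" "b0 \<le> b1"
    and conforms: "\<And>e. e \<in> edges_in (nball (\<sigma> L) R) \<Longrightarrow> \<omega> e \<in> segment_config \<sigma> L a a0 b0 b1 e"
    and uv: "D (\<sigma> 0) u < real K" "D (\<sigma> (2 * L)) v < real K"
    and KL: "K < L" "2 * real K * (b1 + b0) < (b0 - a0) * real L"
    and R: "2 * K + L \<le> R" "2 * b1 * real K + 2 * a0 * real L < a * (real R - real L - real K)"
  shows "\<sigma> L \<in> set p"
proof (rule ccontr)
  assume avoid: "\<sigma> L \<notin> set p"
  define w where "w = \<sigma> L"
  note nn = pos_imp_nonneg[OF \<omega>]
  have \<sigma>c: "\<sigma> i \<in> carrier G" if "i \<le> 2 * L" for i using \<sigma> that by (auto simp: word_segment_def)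
  have \<sigma>E: "{\<sigma> i, \<sigma> (Suc i)} \<in> E" if "i < 2 * L" for i using \<sigma> that by (auto simp: word_segment_def)
  have \<sigma>D: "D (\<sigma> i) (\<sigma> j) = real (j - i)" if "i \<le> j" "j \<le> 2 * L" for i j
    using \<sigma> that by (auto simp: word_segment_def)
  have \<sigma>D': "D (\<sigma> i) (\<sigma> j) = real (i - j)" if "j \<le> i" "i \<le> 2 * L" for i j
  proof -
    have "D (\<sigma> i) (\<sigma> j) = D (\<sigma> j) (\<sigma> i)" using that by (intro D_sym \<sigma>c) auto
    then show ?thesis using \<sigma>D[OF that] by simp
  qed
  have \<sigma>inj: "i = j" if "\<sigma> i = \<sigma> j" "i \<le> 2 * L" "j \<le> 2 * L" for i j
  proof -
    have z: "D (\<sigma> i) (\<sigma> j) = 0" using that(1) D_refl[OF \<sigma>c[OF that(3)]] by simp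
    show ?thesis
    proof (cases "i \<le> j")
      case True
      then show ?thesis using z \<sigma>D[OF True that(3)] by linarith
    next
      case False
      then have "j \<le> i" by simp
      from \<sigma>D'[OF this that(2)] z False show ?thesis by linarith
    qed
  qed
  have wc: "w \<in> carrier G" using \<sigma>c[of L] w_def by simp
  have uvc: "u \<in> carrier G" "v \<in> carrier G"
    using g path_between_carrier by (auto simp: fpp_geodesic_def)
  have pb: "p \<noteq> []" "hd p = u" "last p = v" "set p \<subseteq> carrier G"
      "successively (\<lambda>x y. {x, y} \<in> E) p" and pe: "path_between G S u v p"
    using g by (auto simp: fpp_geodesic_def path_between_def edge_path_iff)
  have Ein: "{x, y} \<in> edges_in (nball w R)" if "{x, y} \<in> E" "D w x \<le> real R" "D w y \<le> real R" for x y
    using that by (auto simp: edges_in_def nball_def edge_iff)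
  have ge_a: "a \<le> \<omega> e" and le_b1: "\<omega> e \<le> b1" if "e \<in> edges_in (nball w R)" for e
    using conforms[of e] that abc by (auto simp: segment_config_def w_def split: if_splits)
  have \<sigma>R: "D w (\<sigma> i) \<le> real L" if "i \<le> 2 * L" for i
    using \<sigma>D[of L i] \<sigma>D'[of i L] that by (cases "i \<le> L") (auto simp: w_def)
  have le_a0: "\<omega> {\<sigma> i, \<sigma> (Suc i)} \<le> a0" if "i < 2 * L" for i
  proof -
    have "{\<sigma> i, \<sigma> (Suc i)} \<in> edges_in (nball w R)"
      using that \<sigma>R[of i] \<sigma>R[of "Suc i"] R by (intro Ein \<sigma>E) auto
    then show ?thesis using conforms[of "{\<sigma> i, \<sigma> (Suc i)}"] that by (auto simp: segment_config_def w_def split: if_splits)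
  qed
  have along: "fpp_dist G S \<omega> (\<sigma> i) (\<sigma> j) \<le> a0 * real (j - i)" if "i \<le> j" "j \<le> 2 * L" for i j
    using that by (intro fpp_dist_le_chain[OF nn]) (auto intro: \<sigma>E le_a0 \<sigma>c)
  have near: "fpp_dist G S \<omega> x (\<sigma> i) \<le> b1 * D x (\<sigma> i)"
    if "x \<in> carrier G" "i \<le> 2 * L" "D (\<sigma> i) x \<le> real K" for x i
  proof (rule fpp_dist_le_ball[OF nn wc that(1) \<sigma>c[OF that(2)]])
    show "\<omega> {u', v'} \<le> b1" if "{u', v'} \<in> E" "D w u' \<le> real R" "D w v' \<le> real R" for u' v'
      using le_b1 Ein that by auto
    show "D w x + D x (\<sigma> i) \<le> real R"
      using D_triangle[OF wc \<sigma>c[OF that(2)] that(1)] \<sigma>R[OF that(2)] that R D_sym[OF that(1) \<sigma>c[OF that(2)]]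
      by simp
  qed
  have near': "fpp_dist G S \<omega> (\<sigma> i) x \<le> b1 * D (\<sigma> i) x"
    if "x \<in> carrier G" "i \<le> 2 * L" "D (\<sigma> i) x \<le> real K" for x i
    using near[OF that] fpp_dist_sym[OF nn that(1) \<sigma>c[OF that(2)]] D_sym[OF that(1) \<sigma>c[OF that(2)]] by simp
  \<comment> \<open>The competitor goes from \<open>u\<close> to \<open>\<sigma> 0\<close>, along
    the segment, and on to \<open>v\<close>.\<close>
  have total: "path_length \<omega> p \<le> 2 * b1 * real K + 2 * a0 * real L"
  proof -
    have 1: "fpp_dist G S \<omega> u (\<sigma> 0) \<le> b1 * real K"
    proof -
      have "b1 * D (\<sigma> 0) u \<le> b1 * real K" using uv(1) abc by (intro mult_left_mono) auto
      then show ?thesis using near[OF uvc(1), of 0] uv(1) D_sym[OF uvc(1) \<sigma>c[of 0]] by simp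
    qed
    have 2: "fpp_dist G S \<omega> (\<sigma> (2 * L)) v \<le> b1 * real K"
    proof -
      have "b1 * D (\<sigma> (2 * L)) v \<le> b1 * real K" using uv(2) abc by (intro mult_left_mono) auto
      then show ?thesis using near'[OF uvc(2), of "2 * L"] uv(2) by simp
    qed
    have "fpp_dist G S \<omega> u v \<le> fpp_dist G S \<omega> u (\<sigma> 0) + (fpp_dist G S \<omega> (\<sigma> 0) (\<sigma> (2 * L)) + fpp_dist G S \<omega> (\<sigma> (2 * L)) v)"
      using fpp_dist_triangle[OF nn uvc(1) \<sigma>c[of 0] uvc(2)]
        fpp_dist_triangle[OF nn \<sigma>c[of 0] \<sigma>c[of "2 * L"] uvc(2)] by auto
    then show ?thesis using 1 2 along[of 0 "2 * L"] g by (auto simp: fpp_geodesic_def)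
  qed
  have stay: "D w y \<le> real R" if "y \<in> set p" for y
  proof (rule ccontr)
    assume far: "\<not> D w y \<le> real R"
    obtain \<alpha> \<beta> where p: "p = \<alpha> @ y # \<beta>" using split_list[OF \<open>y \<in> set p\<close>] by blast
    \<comment> \<open>Truncation at \<open>R\<close> makes \<open>f\<close> constant outside the
      ball, where only positivity of the weights is known.\<close>
    define f where "f z = a * min (D w z) (real R)" for z
    have suc: "successively (\<lambda>x y. {x, y} \<in> E) (\<alpha> @ [y])" and ep: "edge_path G S (y # \<beta>)"
      using edge_path_glue[of G S \<alpha> y \<beta>] pe p by (auto simp: path_between_def edge_path_iff)
    have "f (last (\<alpha> @ [y])) - f (hd (\<alpha> @ [y])) \<le> path_length \<omega> (\<alpha> @ [y])"
    proof (rule path_length_potential)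
      show "successively (\<lambda>x y. f y - f x \<le> \<omega> {x, y}) (\<alpha> @ [y])"
      proof (rule successively_mono[OF suc])
        fix x y assume e: "{x, y} \<in> E"
        have c: "x \<in> carrier G" "y \<in> carrier G" using e by (auto simp: edge_iff)
        have pos: "0 < \<omega> {x, y}" using e \<omega> by (auto simp: pos_weight_def)
        have l: "D w y \<le> D w x + 1" "D w x \<le> D w y + 1"
          using D_edge[OF e] D_triangle[OF wc c] D_triangle[OF wc c(2,1)] D_sym[OF c] by auto
        show "f y - f x \<le> \<omega> {x, y}"
        proof (cases "D w x \<le> real R \<and> D w y \<le> real R")
          case True
          then have "f y - f x \<le> a * 1"
            unfolding f_def right_diff_distrib[symmetric] using l abc by (intro mult_left_mono) auto
          then show ?thesis using ge_a[OF Ein[OF e]] True by simp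
        next
          case False
          \<comment> \<open>Word distances are integers: if one end of the edge is outside the ball,
            the other is at distance at least \<open>R\<close>.\<close>
          then have "min (D w y) (real R) \<le> min (D w x) (real R)"
            using l D_eq_ndist[OF wc c(1)] D_eq_ndist[OF wc c(2)] by auto
          then have "f y \<le> f x" unfolding f_def using abc by (intro mult_left_mono) auto
          then show ?thesis using pos by simp
        qed
      qed
    qed simp
    moreover have "hd (\<alpha> @ [y]) = u" using pb p by (cases \<alpha>) auto
    moreover have "path_length \<omega> (\<alpha> @ [y]) \<le> path_length \<omega> p"
      using path_length_glue[of \<omega> \<alpha> y \<beta>] p edge_path_length_nonneg[OF nn ep] by simp
    moreover have "f u \<le> a * (real L + real K)"
      unfolding f_def using abc D_triangle[OF wc \<sigma>c[of 0] uvc(1)] \<sigma>R[of 0] uv(1)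
      by (intro mult_left_mono) auto
    moreover have "f y = a * real R" using far by (simp add: f_def)
    ultimately show False using total R(2) by (simp add: algebra_simps)
  qed
  define Neg where "Neg = {\<sigma> i | i. i < L}"
  define Pos where "Pos = {\<sigma> i | i. L < i \<and> i \<le> 2 * L}"
  have disj: "Neg \<inter> Pos = {}"
  proof -
    have "\<sigma> i \<noteq> \<sigma> j" if "i < L" "L < j" "j \<le> 2 * L" for i j using \<sigma>inj[of i j] that by auto
    then show ?thesis unfolding Neg_def Pos_def by blast
  qed
  have uPos: "u \<notin> Pos" using uv(1) KL(1) \<sigma>D[of 0] by (auto simp: Pos_def)
  have vNeg: "v \<notin> Neg" using uv(2) KL(1) \<sigma>D'[of _ "2 * L"] by (auto simp: Neg_def)
  have "u \<noteq> v"
    using D_triangle[OF \<sigma>c[of 0] uvc(1) \<sigma>c[of "2 * L"]] D_sym[OF \<sigma>c[of "2 * L"] uvc(1)] \<sigma>D[of 0 "2 * L"] uv KL(1)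
    by auto
  obtain \<alpha> s \<beta> t \<gamma> where p: "p = \<alpha> @ (s # \<beta> @ [t]) @ \<gamma>" and s: "s \<in> Neg \<or> s = u" and t: "t \<in> Pos \<or> t = v"
      and nt: "\<not> (t \<in> Neg \<or> t = u)" and \<beta>: "\<And>z. z \<in> set \<beta> \<Longrightarrow> \<not> (z \<in> Neg \<or> z = u) \<and> \<not> (z \<in> Pos \<or> z = v)"
    using split_between[of p "\<lambda>z. z \<in> Neg \<or> z = u" "\<lambda>z. z \<in> Pos \<or> z = v"] pb vNeg \<open>u \<noteq> v\<close> by metis
  have stg: "fpp_geodesic G S \<omega> s t (s # \<beta> @ [t])"
    using fpp_geodesic_infix[OF nn g[unfolded p]] by simp
  have stc: "s \<in> carrier G" "t \<in> carrier G" using p pb(4) by auto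
  have cost: "b0 * D s t \<le> fpp_dist G S \<omega> s t"
  proof -
    have "b0 * D s (last (s # \<beta> @ [t])) - b0 * D s (hd (s # \<beta> @ [t])) \<le> path_length \<omega> (s # \<beta> @ [t])"
    proof (rule path_length_potential)
      have "successively (\<lambda>x y. {x, y} \<in> E) (s # \<beta> @ [t])"
        using stg by (auto simp: fpp_geodesic_def path_between_def edge_path_iff)
      then show "successively (\<lambda>x y. b0 * D s y - b0 * D s x \<le> \<omega> {x, y}) (s # \<beta> @ [t])"
      proof (rule successively_mono)
        fix x y assume xy: "x \<in> set (s # \<beta> @ [t])" "y \<in> set (s # \<beta> @ [t])" and e: "{x, y} \<in> E"
        have c: "x \<in> carrier G" "y \<in> carrier G" using e by (auto simp: edge_iff)
        have xyp: "x \<in> set p" "y \<in> set p" using xy p by auto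
        have side: "z \<in> Neg \<or> z \<in> Pos" if "z = \<sigma> i" "i \<le> 2 * L" "z \<in> set p" for z i
          using that avoid unfolding Neg_def Pos_def by (metis (mono_tags, lifting) linorder_neqE_nat mem_Collect_eq)
        \<comment> \<open>Such an edge would have both ends on the segment but not at its midpoint,
          hence in \<open>{s, t}\<close> by the choice of the stretch. It would then join the two
          halves, but consecutive indices cannot skip \<open>L\<close>.\<close>
        have "{x, y} \<notin> {{\<sigma> i, \<sigma> (Suc i)} | i. i < 2 * L}"
        proof
          assume "{x, y} \<in> {{\<sigma> i, \<sigma> (Suc i)} | i. i < 2 * L}"
          then obtain i where i: "{x, y} = {\<sigma> i, \<sigma> (Suc i)}" "i < 2 * L" by blast
          have mem: "\<sigma> i \<in> {x, y}" "\<sigma> (Suc i) \<in> {x, y}" using i by auto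
          have sub: "{x, y} \<subseteq> set (s # \<beta> @ [t])" "{x, y} \<subseteq> set p" using xy xyp by simp_all
          note seg = subsetD[OF sub(1) mem(1)] subsetD[OF sub(1) mem(2)]
            and inp = subsetD[OF sub(2) mem(1)] subsetD[OF sub(2) mem(2)]
          have sd: "\<sigma> i \<in> Neg \<or> \<sigma> i \<in> Pos" "\<sigma> (Suc i) \<in> Neg \<or> \<sigma> (Suc i) \<in> Pos"
            using inp side[of "\<sigma> i" i] side[of "\<sigma> (Suc i)" "Suc i"] i(2) by auto
          have only: "z \<in> {s, t}" if "z \<in> set (s # \<beta> @ [t])" "z \<in> Neg \<or> z \<in> Pos" for z
            using that \<beta> by auto
          have st: "\<sigma> i \<in> {s, t}" "\<sigma> (Suc i) \<in> {s, t}"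
            using only[OF seg(1) sd(1)] only[OF seg(2) sd(2)] by auto
          have ne: "\<sigma> i \<noteq> \<sigma> (Suc i)" using \<sigma>inj[of i "Suc i"] i by auto
          have "\<sigma> i \<in> Neg \<and> \<sigma> (Suc i) \<in> Pos \<or> \<sigma> (Suc i) \<in> Neg \<and> \<sigma> i \<in> Pos"
            using st ne sd s uPos nt by auto
          then obtain j k where jk: "j < L" "L < k" "k \<le> 2 * L"
              "\<sigma> i = \<sigma> j \<and> \<sigma> (Suc i) = \<sigma> k \<or> \<sigma> (Suc i) = \<sigma> j \<and> \<sigma> i = \<sigma> k"
            unfolding Neg_def Pos_def by auto
          then have "i = j \<and> Suc i = k \<or> Suc i = j \<and> i = k"
            using \<sigma>inj[of i j] \<sigma>inj[of "Suc i" k] \<sigma>inj[of "Suc i" j] \<sigma>inj[of i k] i by auto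
          then show False using jk by auto
        qed
        then have off: "segment_config \<sigma> L a a0 b0 b1 {x, y} = {b0..b1}" unfolding segment_config_def by (rule if_not_P)
        have "{x, y} \<in> edges_in (nball w R)" using Ein[OF e] stay xyp by auto
        then have "b0 \<le> \<omega> {x, y}" using conforms[of "{x, y}"] off by (simp add: w_def)
        moreover have "b0 * D s y - b0 * D s x \<le> b0 * 1"
          unfolding right_diff_distrib[symmetric] using D_triangle[OF stc(1) c] D_edge[OF e] abc
          by (intro mult_left_mono) auto
        ultimately show "b0 * D s y - b0 * D s x \<le> \<omega> {x, y}" by simp
      qed
    qed simp
    then show ?thesis using stg D_refl[OF stc(1)] by (simp add: fpp_geodesic_def)
  qed
  \<comment> \<open>The anchor of \<open>s\<close> on the segment: \<open>s\<close> itself, or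
    \<open>\<sigma> 0\<close> if \<open>s\<close> is merely the vertex \<open>u\<close> near it. The
    final disjunction remembers that an inexact anchor sits at the end of the segment.\<close>
  obtain i where i: "i < L" "D s (\<sigma> i) \<le> real K" "fpp_dist G S \<omega> s (\<sigma> i) \<le> b1 * D s (\<sigma> i)"
    "D s (\<sigma> i) = 0 \<or> i = 0"
  proof (cases "s \<in> Neg")
    case True
    then obtain i where "i < L" "s = \<sigma> i" by (auto simp: Neg_def)
    then show thesis using that[of i] D_refl[OF stc(1)] fpp_dist_refl[OF nn stc(1)] by auto
  next
    case False
    then have "s = u" using s by simp
    then show thesis
      using that[of 0] near[OF uvc(1), of 0] uv(1) D_sym[OF uvc(1) \<sigma>c[of 0]] KL by auto
  qed
  obtain j where j: "L < j" "j \<le> 2 * L" "D (\<sigma> j) t \<le> real K" "fpp_dist G S \<omega> (\<sigma> j) t \<le> b1 * D (\<sigma> j) t"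
    "D (\<sigma> j) t = 0 \<or> j = 2 * L"
  proof (cases "t \<in> Pos")
    case True
    then obtain j where "L < j" "j \<le> 2 * L" "t = \<sigma> j" by (auto simp: Pos_def)
    then show thesis using that[of j] D_refl[OF stc(2)] fpp_dist_refl[OF nn stc(2)] by auto
  next
    case False
    then have "t = v" using t by simp
    then show thesis using that[of "2 * L"] near'[OF uvc(2), of "2 * L"] uv(2) KL by auto
  qed
  have ijc: "\<sigma> i \<in> carrier G" "\<sigma> j \<in> carrier G" using \<sigma>c i j by auto
  have ij: "i \<le> j" using i j by simp
  have "fpp_dist G S \<omega> s t \<le> b1 * D s (\<sigma> i) + a0 * real (j - i) + b1 * D (\<sigma> j) t"
    using fpp_dist_triangle[OF nn stc(1) ijc(1) stc(2)] fpp_dist_triangle[OF nn ijc stc(2)] along[OF ij j(2)] i j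
    by linarith
  moreover have "real (j - i) - D s (\<sigma> i) - D (\<sigma> j) t \<le> D s t"
    using D_triangle[OF ijc(1) stc(1) ijc(2)] D_triangle[OF stc ijc(2)] \<sigma>D[OF ij j(2)]
      D_sym[OF ijc(1) stc(1)] D_sym[OF ijc(2) stc(2)] by linarith
  then have "b0 * (real (j - i) - D s (\<sigma> i) - D (\<sigma> j) t) \<le> b0 * D s t"
    using abc by (intro mult_left_mono) auto
  ultimately have key: "(b0 - a0) * real (j - i) \<le> (b1 + b0) * (D s (\<sigma> i) + D (\<sigma> j) t)"
    using cost by (simp add: algebra_simps)
  \<comment> \<open>With two exact anchors \<open>a0 < b0\<close> suffices. Otherwise one anchor is
    an end of the segment, so the two are at least \<open>L\<close> apart, and \<open>KL\<close>
    absorbs the error terms.\<close>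
  show False
  proof (cases "D s (\<sigma> i) = 0 \<and> D (\<sigma> j) t = 0")
    case True
    have "0 < (b0 - a0) * real (j - i)" using i j abc by (intro mult_pos_pos) auto
    then show ?thesis using leD[OF key] unfolding conjunct1[OF True] conjunct2[OF True] by (simp only: add_0_left mult_zero_right not_True_eq_False)
  next
    case False
    then have "L \<le> j - i" using i j by auto
    then have "(b0 - a0) * real L \<le> (b0 - a0) * real (j - i)" using abc by (intro mult_left_mono) auto
    also note key
    also have "(b1 + b0) * (D s (\<sigma> i) + D (\<sigma> j) t) \<le> (b1 + b0) * (2 * real K)"
      using i(2) j(3) abc by (intro mult_left_mono) auto
    finally show False using KL(2) by (simp add: algebra_simps)
  qed
qed

text \<open>The order in which the geodesic comes near the two ends is unknown; if the far end comes
  first, the subpath is reversed.\<close>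

lemma geodesic_cut:
  assumes \<omega>: "pos_weight \<omega>" and g: "fpp_geodesic G S \<omega> x y p"
    and \<sigma>: "word_segment \<sigma> (2 * L)"
    and abc: "0 < a" "a \<le> a0" "a0 < b0" "b0 \<le> b1"
    and conforms: "\<And>e. e \<in> edges_in (nball (\<sigma> L) R) \<Longrightarrow> \<omega> e \<in> segment_config \<sigma> L a a0 b0 b1 e"
    and hit: "\<exists>u\<in>set p. D (\<sigma> 0) u < real K" "\<exists>v\<in>set p. D (\<sigma> (2 * L)) v < real K"
    and KL: "K < L" "2 * real K * (b1 + b0) < (b0 - a0) * real L"
    and R: "2 * K + L \<le> R" "2 * b1 * real K + 2 * a0 * real L < a * (real R - real L - real K)"
  shows "\<sigma> L \<in> set p"
proof -
  note nn = pos_imp_nonneg[OF \<omega>]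
  obtain u v where uv: "u \<in> set p" "D (\<sigma> 0) u < real K" "v \<in> set p" "D (\<sigma> (2 * L)) v < real K"
    using hit by blast
  note cut = geodesic_between_cut[OF \<omega> _ \<sigma> abc conforms uv(2,4) KL R]
  have c: "u \<in> carrier G" "\<sigma> 0 \<in> carrier G" "\<sigma> (2 * L) \<in> carrier G"
    using g uv \<sigma> by (auto simp: fpp_geodesic_def path_between_def edge_path_iff word_segment_def)
  have "D (\<sigma> 0) (\<sigma> (2 * L)) = real (2 * L)" using \<sigma> by (auto simp: word_segment_def)
  then have "u \<noteq> v"
    using D_triangle[OF c(2,1,3)] D_sym[OF c(3,1)] uv KL(1) by auto
  obtain \<alpha> \<beta> where p: "p = \<alpha> @ u # \<beta>" using split_list[OF uv(1)] by blast
  then consider "v \<in> set \<alpha>" | "v \<in> set \<beta>" using uv \<open>u \<noteq> v\<close> by auto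
  then show ?thesis
  proof cases
    case 1
    then obtain \<alpha>1 \<alpha>2 where "\<alpha> = \<alpha>1 @ v # \<alpha>2" using split_list[of v \<alpha>] by blast
    then have p': "p = \<alpha>1 @ (v # \<alpha>2 @ [u]) @ \<beta>" using p by simp
    have "fpp_geodesic G S \<omega> v u (v # \<alpha>2 @ [u])"
      using fpp_geodesic_infix[OF nn g[unfolded p']] by simp
    then have "\<sigma> L \<in> set (rev (v # \<alpha>2 @ [u]))" by (intro cut fpp_geodesic_rev[OF nn])
    then show ?thesis using p' by auto
  next
    case 2
    then obtain \<beta>1 \<beta>2 where "\<beta> = \<beta>1 @ v # \<beta>2" using split_list[of v \<beta>] by blast
    then have p': "p = \<alpha> @ (u # \<beta>1 @ [v]) @ \<beta>2" using p by simp
    have "fpp_geodesic G S \<omega> u v (u # \<beta>1 @ [v])"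
      using fpp_geodesic_infix[OF nn g[unfolded p']] by simp
    then have "\<sigma> L \<in> set (u # \<beta>1 @ [v])" by (intro cut)
    then show ?thesis using p' by auto
  qed
qed

end

context hyperbolic_cayley_graph
begin

text \<open>Otherwise \<open>path_visits\<close> gives a sphere of some radius \<open>r\<close>
  visited more than \<open>N r\<close> times. The stretch from the first to the last visit has at
  least \<open>N r\<close> edges and hence length at least \<open>c * N r\<close>. But its ends are
  at most \<open>2 * r\<close> apart, and a word geodesic between them stays in the ball of radius
  \<open>3 * r\<close>, where it costs at most \<open>\<Lambda> * r * (2 * r)\<close>.\<close>

lemma good_hit:
  assumes \<epsilon>: "0 < \<epsilon>" "exp (2 * \<epsilon> * \<delta>) \<le> 2" and w: "w \<in> carrier G"
    and \<omega>: "pos_weight \<omega>" and g: "fpp_geodesic G S \<omega> x y p" and gp: "gp w x y \<le> c0"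
    and K: "c0 < real K" "exp (- \<epsilon> / 2) ^ K / (1 - exp (- \<epsilon> / 2)) < exp (- \<epsilon> * (c0 + 1)) / 2"
    and N: "\<And>r. K \<le> r \<Longrightarrow> real (N r) \<le> exp (\<epsilon> * real r / 2)"
      "\<And>r. K \<le> r \<Longrightarrow> \<Lambda> * real r * (2 * real r) < c * real (N r)"
    and \<Lambda>: "0 \<le> \<Lambda>"
    and good: "\<And>r. K \<le> r \<Longrightarrow> good N c \<Lambda> \<omega> w r"
  shows "\<exists>v\<in>set p. D w v < real K"
proof (rule ccontr)
  assume "\<not> ?thesis"
  then have far: "real K \<le> D w v" if "v \<in> set p" for v using that by force
  note nn = pos_imp_nonneg[OF \<omega>]
  have p: "path_between G S x y p" "p \<noteq> []" "set p \<subseteq> carrier G"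
    using g by (auto simp: fpp_geodesic_def path_between_def edge_path_iff)
  define I where "I r = {i. i < length p - 1 \<and> ndist w (p ! i) = r}" for r
  obtain r where r: "K \<le> r" "exp (\<epsilon> * real r / 2) < real (card (I r))"
    using path_visits[OF \<epsilon> w p(1) gp K far] unfolding I_def by blast
  have fin: "finite (I r)" by (auto simp: I_def)
  have card: "N r < card (I r)" using r N(1)[OF r(1)] by linarith
  then have ne: "I r \<noteq> {}" by auto
  define i where "i = Min (I r)" define j where "j = Max (I r)"
  have ij: "i \<in> I r" "j \<in> I r" using fin ne by (auto simp: i_def j_def)
  have "I r \<subseteq> {i..j}" using fin by (auto simp: i_def j_def)
  then have "card (I r) \<le> Suc j - i" using card_mono[of "{i..j}" "I r"] by simp
  then have long: "i + N r < Suc j" using card by simp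
  have jl: "Suc j < length p" using ij by (auto simp: I_def)
  define \<beta> where "\<beta> = take (Suc j - i) (drop i p)"
  \<comment> \<open>\<open>good\<close> speaks of paths with exactly \<open>N r\<close> edges, so
    the stretch is cut to its first \<open>Suc (N r)\<close> vertices.\<close>
  define q where "q = take (Suc (N r)) \<beta>"
  have dec: "p = take i p @ \<beta> @ drop (Suc j) p"
    using long by (simp add: \<beta>_def) (metis add.commute append_take_drop_id drop_drop le_add_diff_inverse2 less_imp_le_nat
        not_less_eq_eq trans_le_add1 nat_le_linear)
  have \<beta>: "\<beta> \<noteq> []" "length \<beta> = Suc j - i" "hd \<beta> = p ! i" "last \<beta> = p ! j"
    using long jl by (auto simp: \<beta>_def hd_drop_conv_nth last_conv_nth)
  have g\<beta>: "fpp_geodesic G S \<omega> (p ! i) (p ! j) \<beta>"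
    using fpp_geodesic_infix[OF nn _ \<beta>(1)] g dec \<beta> by metis
  have q: "q \<noteq> []" "length q = Suc (N r)" "hd q = p ! i"
    using \<beta> long by (auto simp: q_def)
  obtain \<gamma> where \<beta>q: "\<beta> = [] @ q @ \<gamma>" unfolding q_def by (metis append_Nil append_take_drop_id)
  have gq: "fpp_geodesic G S \<omega> (p ! i) (last q) q"
    using fpp_geodesic_infix[OF nn _ q(1)] g\<beta> \<beta>q q(3) by metis
  have mem: "p ! i \<in> carrier G" "p ! j \<in> carrier G" using ij p(3) jl by (auto simp: I_def subset_iff)
  have Dr: "D w (p ! i) = real r" "D w (p ! j) = real r"
    using ij mem D_eq_ndist[OF w] by (auto simp: I_def)
  have "q \<in> paths_from (p ! i) (N r)" "distinct q"
    using gq q fpp_geodesic_distinct[OF \<omega> gq] by (auto simp: paths_from_def fpp_geodesic_def path_between_def)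
  moreover have "p ! i \<in> nball w r" using mem Dr by (simp add: nball_def)
  ultimately have "c * real (N r) \<le> path_length \<omega> q" using good[OF r(1)] by (auto simp: good_def)
  also have "\<dots> \<le> path_length \<omega> \<beta>"
  proof -
    obtain q' t where q': "q = q' @ [t]" using q by (metis append_butlast_last_id)
    have "edge_path G S (q' @ t # \<gamma>)"
      using g\<beta> \<beta>q unfolding q' by (simp add: fpp_geodesic_def path_between_def)
    then have "0 \<le> path_length \<omega> (t # \<gamma>)"
      using edge_path_glue[of G S q' t \<gamma>] by (intro edge_path_length_nonneg[OF nn]) simp
    moreover have "path_length \<omega> \<beta> = path_length \<omega> q + path_length \<omega> (t # \<gamma>)"
      using \<beta>q path_length_glue[of \<omega> q' t \<gamma>] unfolding q' by simp
    ultimately show ?thesis by simp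
  qed
  also have "\<dots> = fpp_dist G S \<omega> (p ! i) (p ! j)" using g\<beta> by (simp add: fpp_geodesic_def)
  also have "\<dots> \<le> \<Lambda> * real r * D (p ! i) (p ! j)"
  proof (rule fpp_dist_le_ball[OF nn w mem, where r = "real (3 * r)"])
    show "\<omega> {u, v} \<le> \<Lambda> * real r" if "{u, v} \<in> E" "D w u \<le> real (3 * r)" "D w v \<le> real (3 * r)" for u v
      using good[OF r(1)] that by (auto simp: good_def nball_def edge_iff)
    show "D w (p ! i) + D (p ! i) (p ! j) \<le> real (3 * r)"
      using D_triangle[OF mem(1) w mem(2)] D_sym[OF mem(1) w] Dr by simp
  qed
  also have "\<dots> \<le> \<Lambda> * real r * (2 * real r)"
    using D_triangle[OF mem(1) w mem(2)] D_sym[OF mem(1) w] Dr \<Lambda> by (intro mult_left_mono) auto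
  finally show False using N(2)[OF r(1)] by simp
qed

end

section \<open>Rays through infinitely many cut vertices\<close>

context hyperbolic_cayley_graph
begin

section \<open>The Gromov boundary as a quotient\<close>

lemma product_diverges_iff:
  "product_diverges G S x y \<longleftrightarrow> (\<forall>C. \<exists>M. \<forall>i\<ge>M. \<forall>j\<ge>M. C \<le> gp \<one> (x i) (y j))"
  unfolding product_diverges_def filterlim_at_top eventually_prod_sequentially by (simp add: case_prod_unfold) blast

lemma product_diverges_sym:
  assumes "range x \<subseteq> carrier G" "range y \<subseteq> carrier G" "product_diverges G S x y"
  shows "product_diverges G S y x"
proof -
  have "gp \<one> (y i) (x j) = gp \<one> (x j) (y i)" for i j using assms(1,2) by (intro gp_sym) auto
  then show ?thesis using assms(3) unfolding product_diverges_iff by metis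
qed

text \<open>One use of the four-point inequality through a common member of
  \<open>y\<close>.\<close>

lemma product_diverges_trans:
  assumes c: "range x \<subseteq> carrier G" "range y \<subseteq> carrier G" "range z \<subseteq> carrier G"
    and xy: "product_diverges G S x y" and yz: "product_diverges G S y z"
  shows "product_diverges G S x z"
  unfolding product_diverges_iff
proof
  fix C
  obtain M1 where M1: "\<forall>i\<ge>M1. \<forall>j\<ge>M1. C + \<delta> \<le> gp \<one> (x i) (y j)" using xy unfolding product_diverges_iff by blast
  obtain M2 where M2: "\<forall>i\<ge>M2. \<forall>j\<ge>M2. C + \<delta> \<le> gp \<one> (y i) (z j)" using yz unfolding product_diverges_iff by blast
  have "C \<le> gp \<one> (x i) (z j)" if "i \<ge> max M1 M2" "j \<ge> max M1 M2" for i j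
  proof -
    have "C + \<delta> \<le> gp \<one> (x i) (y (max M1 M2))" "C + \<delta> \<le> gp \<one> (y (max M1 M2)) (z j)"
      using M1 M2 that by auto
    moreover have "min (gp \<one> (x i) (y (max M1 M2))) (gp \<one> (y (max M1 M2)) (z j)) - \<delta> \<le> gp \<one> (x i) (z j)"
      using c by (intro hyperbolic) auto
    ultimately show ?thesis by linarith
  qed
  then show "\<exists>M. \<forall>i\<ge>M. \<forall>j\<ge>M. C \<le> gp \<one> (x i) (z j)" by blast
qed

lemma boundary_equiv:
  "equiv (sequences_to_infinity G S)
     {(x, y). x \<in> sequences_to_infinity G S \<and> y \<in> sequences_to_infinity G S \<and> product_diverges G S x y}"
proof (rule equivI)
  show "sym {(x, y). x \<in> sequences_to_infinity G S \<and> y \<in> sequences_to_infinity G S \<and> product_diverges G S x y}"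
    by (rule symI) (auto simp: sequences_to_infinity_def intro: product_diverges_sym)
  show "trans {(x, y). x \<in> sequences_to_infinity G S \<and> y \<in> sequences_to_infinity G S \<and> product_diverges G S x y}"
    by (rule transI) (auto simp: sequences_to_infinity_def intro: product_diverges_trans)
qed (auto simp: refl_on_def sequences_to_infinity_def)

lemma boundary_nonempty:
  assumes "\<xi> \<in> gromov_boundary G S"
  obtains x where "x \<in> \<xi>"
  using assms in_quotient_imp_non_empty[OF boundary_equiv] unfolding gromov_boundary_def by blast

text \<open>Transitivity through \<open>x\<close> also shows that \<open>s\<close> tends to
  infinity, so comparison with one representative decides membership.\<close>

lemma boundary_mem_iff:
  assumes "\<xi> \<in> gromov_boundary G S" "x \<in> \<xi>"
  shows "s \<in> \<xi> \<longleftrightarrow> range s \<subseteq> carrier G \<and> product_diverges G S x s" (is "?l \<longleftrightarrow> ?r")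
proof -
  have xs: "x \<in> sequences_to_infinity G S"
    using in_quotient_imp_subset[OF boundary_equiv] assms unfolding gromov_boundary_def by blast
  note q = assms(1)[unfolded gromov_boundary_def]
  have mem: "s \<in> \<xi> \<longleftrightarrow> s \<in> sequences_to_infinity G S \<and> product_diverges G S x s"
  proof
    assume "s \<in> \<xi>"
    then show "s \<in> sequences_to_infinity G S \<and> product_diverges G S x s"
      using in_quotient_imp_in_rel[OF boundary_equiv q, of x s] assms(2) by simp
  next
    assume "s \<in> sequences_to_infinity G S \<and> product_diverges G S x s"
    then show "s \<in> \<xi>"
      using in_quotient_imp_closed[OF boundary_equiv q assms(2), of s] xs by simp
  qed
  have "product_diverges G S s s" if "range s \<subseteq> carrier G" "product_diverges G S x s"
  proof -
    have "range x \<subseteq> carrier G" using xs by (simp add: sequences_to_infinity_def)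
    then show ?thesis
      using product_diverges_trans[OF that(1) _ that(1) product_diverges_sym[OF _ that] that(2)] by simp
  qed
  then show ?thesis unfolding mem by (auto simp: sequences_to_infinity_def)
qed

lemma boundary_eqI:
  assumes "\<xi> \<in> gromov_boundary G S" "\<eta> \<in> gromov_boundary G S" "s \<in> \<xi>" "s \<in> \<eta>"
  shows "\<xi> = \<eta>"
  using quotient_disj[OF boundary_equiv] assms unfolding gromov_boundary_def by blast

end

text \<open>All that the deterministic part takes from one environment. \<open>D_w\<close> and
  \<open>gp_w\<close> together place \<open>w n\<close> on a word geodesic from the identity to
  \<open>x (\<iota> n)\<close>, at height \<open>t n\<close>; \<open>close\<close> says that from
  index \<open>\<iota> n\<close> on the sequence has settled beyond this height. Only the indices in
  \<open>I\<close> give cut vertices, and \<open>cut\<close> is uniform in the ends \<open>a\<close>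
  and \<open>b\<close>.\<close>

locale cut_points = hyperbolic_cayley_graph +
  fixes \<omega> :: "'a set \<Rightarrow> real" and \<xi> :: "(nat \<Rightarrow> 'a) set" and x w :: "nat \<Rightarrow> 'a"
    and t \<iota> :: "nat \<Rightarrow> nat" and L :: nat and I :: "nat set"
  assumes pos: "pos_weight \<omega>"
    and unique: "a \<in> carrier G \<Longrightarrow> b \<in> carrier G \<Longrightarrow> \<exists>!p. fpp_geodesic G S \<omega> a b p"
    and xi: "\<xi> \<in> gromov_boundary G S" "x \<in> \<xi>"
    and w_carrier: "w n \<in> carrier G" and D_w: "D \<one> (w n) = real (t n)"
    and gp_w: "gp \<one> (w n) (x (\<iota> n)) = real (t n)"
    and t_mono: "strict_mono t" and t_gap: "n < m \<Longrightarrow> real (t n) + real L + \<delta> \<le> real (t m)"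
    and \<iota>: "mono \<iota>" "n \<le> \<iota> n"
    and close: "\<iota> n \<le> i \<Longrightarrow> \<iota> n \<le> j \<Longrightarrow> real (t n) + real L + \<delta> \<le> gp \<one> (x i) (x j)"
    and infinite_I: "infinite I"
    and cut: "n \<in> I \<Longrightarrow> a \<in> carrier G \<Longrightarrow> b \<in> carrier G \<Longrightarrow>
      gp \<one> a (x (\<iota> n)) + \<delta> + real L < real (t n) \<Longrightarrow>
      real (t n) + real L \<le> gp \<one> b (x (\<iota> n)) \<Longrightarrow> fpp_geodesic G S \<omega> a b p \<Longrightarrow> w n \<in> set p"
begin

text \<open>The product with \<open>x (\<iota> n)\<close> is roughly the height at which geodesics
  from the identity to the two points part. The margin \<open>L\<close> lets one condition serve at
  both ends of the segment around \<open>w n\<close>.\<close>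

definition behind :: "nat \<Rightarrow> 'a \<Rightarrow> bool" where
  "behind n a \<longleftrightarrow> gp \<one> a (x (\<iota> n)) + \<delta> + real L < real (t n)"

definition ahead :: "nat \<Rightarrow> 'a \<Rightarrow> bool" where
  "ahead n b \<longleftrightarrow> real (t n) + real L \<le> gp \<one> b (x (\<iota> n))"

text \<open>Implied by having direction \<xi>, inherited by tails, and strong enough for
  uniqueness.\<close>

definition heads_to_xi :: "(nat \<Rightarrow> 'a) \<Rightarrow> bool" where
  "heads_to_xi r \<longleftrightarrow> fpp_geodesic_ray G S \<omega> r \<and> (\<forall>n m. \<exists>b\<ge>m. ahead n (r b))"

lemma x_carrier: "x i \<in> carrier G"
  using boundary_mem_iff[OF xi] xi(2) by blast

lemma n_le_t: "n \<le> t n"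
  using t_mono by (rule strict_mono_imp_increasing)

lemma large_I: "\<exists>n\<in>I. m \<le> n"
  using infinite_I infinite_nat_iff_unbounded_le by blast

text \<open>Products with \<open>a\<close> are bounded by its distance from the identity, while
  \<open>t\<close> is unbounded.\<close>

lemma behind_eventually:
  assumes "a \<in> carrier G"
  obtains n0 where "\<And>n. n0 \<le> n \<Longrightarrow> behind n a"
proof
  fix n assume "Suc (nat \<lceil>D \<one> a + \<delta> + real L\<rceil>) \<le> n"
  then have "D \<one> a + \<delta> + real L < real (t n)" using n_le_t[of n] by linarith
  then show "behind n a" using gp_le[of \<one> a "x (\<iota> n)"] assms x_carrier unfolding behind_def
    by (metis add_le_cancel_right le_less_trans one_closed)
qed

text \<open>\<open>w m\<close> follows \<open>x (\<iota> m)\<close> up to height \<open>t m\<close>,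
  and \<open>x (\<iota> m)\<close> follows \<open>x (\<iota> n)\<close> beyond \<open>t n\<close>;
  combining the two loses \<delta>, which the margins in \<open>t_gap\<close> and
  \<open>close\<close> cover.\<close>

lemma ahead_w:
  assumes "n < m" shows "ahead n (w m)"
proof -
  have "min (gp \<one> (w m) (x (\<iota> m))) (gp \<one> (x (\<iota> m)) (x (\<iota> n))) - \<delta> \<le> gp \<one> (w m) (x (\<iota> n))"
    by (intro hyperbolic one_closed w_carrier x_carrier)
  moreover have "real (t n) + real L + \<delta> \<le> gp \<one> (x (\<iota> m)) (x (\<iota> n))"
    using assms monoD[OF \<iota>(1), of n m] by (intro close) auto
  ultimately show ?thesis using t_gap[OF assms] by (simp add: ahead_def gp_w)
qed

lemma ahead_subsequence:
  fixes r :: "nat \<Rightarrow> 'a"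
  assumes "strict_mono \<phi>" "r \<circ> \<phi> \<in> \<xi>"
  shows "\<exists>b\<ge>m. ahead n (r b)"
proof -
  have s: "range (r \<circ> \<phi>) \<subseteq> carrier G" "product_diverges G S x (r \<circ> \<phi>)"
    using boundary_mem_iff[OF xi] assms(2) by auto
  obtain M where M: "\<forall>i\<ge>M. \<forall>j\<ge>M. real (t n) + real L + \<delta> \<le> gp \<one> (x i) ((r \<circ> \<phi>) j)"
    using s(2) unfolding product_diverges_iff by blast
  define j where "j = max M m" define i where "i = max M (\<iota> n)"
  have c: "r (\<phi> j) \<in> carrier G" using s(1) by auto
  have "real (t n) + real L + \<delta> \<le> gp \<one> (r (\<phi> j)) (x i)"
    using M[rule_format, of i j] gp_sym[OF c x_carrier, of "\<one>" i] by (simp add: i_def j_def)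
  moreover have "real (t n) + real L + \<delta> \<le> gp \<one> (x i) (x (\<iota> n))"
    by (intro close) (auto simp: i_def)
  moreover have "min (gp \<one> (r (\<phi> j)) (x i)) (gp \<one> (x i) (x (\<iota> n))) - \<delta> \<le> gp \<one> (r (\<phi> j)) (x (\<iota> n))"
    by (intro hyperbolic one_closed x_carrier c)
  ultimately have "ahead n (r (\<phi> j))" by (simp add: ahead_def)
  moreover have "m \<le> \<phi> j" using strict_mono_imp_increasing[OF assms(1), of j] by (simp add: j_def)
  ultimately show ?thesis by blast
qed

text \<open>The product of \<open>w (\<psi> j)\<close> with \<open>x (\<iota> (\<psi> j))\<close> is
  its height, which tends to infinity, and late members of \<open>x\<close> have large products with
  one another.\<close>

lemma w_in_xi:
  assumes "strict_mono \<psi>"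
  shows "w \<circ> \<psi> \<in> \<xi>"
proof -
  have "product_diverges G S x (w \<circ> \<psi>)"
    unfolding product_diverges_iff
  proof
    fix C
    define m where "m = nat \<lceil>C + \<delta>\<rceil>"
    have "C \<le> gp \<one> (x i) ((w \<circ> \<psi>) j)" if i: "max m (\<iota> m) \<le> i" and j: "max m (\<iota> m) \<le> j" for i j
    proof -
      have mj: "m \<le> \<psi> j" using strict_mono_imp_increasing[OF assms, of j] j by simp
      have t: "t m \<le> t (\<psi> j)" using t_mono mj by (simp add: strict_mono_less_eq)
      have "real (t m) + real L + \<delta> \<le> gp \<one> (x (\<iota> (\<psi> j))) (x i)"
        using i monoD[OF \<iota>(1) mj] by (intro close) auto
      moreover have "min (gp \<one> (w (\<psi> j)) (x (\<iota> (\<psi> j)))) (gp \<one> (x (\<iota> (\<psi> j))) (x i)) - \<delta> \<le> gp \<one> (w (\<psi> j)) (x i)"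
        by (intro hyperbolic one_closed x_carrier w_carrier)
      moreover have "C + \<delta> \<le> real m" unfolding m_def by linarith
      ultimately have "C \<le> gp \<one> (w (\<psi> j)) (x i)" using t n_le_t[of m] delta_nonneg unfolding gp_w by linarith
      then show ?thesis using gp_sym[OF w_carrier x_carrier] by simp
    qed
    then show "\<exists>M. \<forall>i\<ge>M. \<forall>j\<ge>M. C \<le> gp \<one> (x i) ((w \<circ> \<psi>) j)" by blast
  qed
  then show ?thesis using boundary_mem_iff[OF xi] w_carrier by auto
qed

text \<open>The products of \<open>x\<close> and \<open>s\<close> stay bounded along arbitrarily
  late indices, so \<open>s\<close> keeps returning behind each late \<open>w n\<close>. This will
  exclude a second accumulation point of a ray that has passed \<open>w n\<close>.\<close>

lemma behind_other_boundary_point: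
  assumes \<eta>: "\<eta> \<in> gromov_boundary G S" "\<eta> \<noteq> \<xi>" "s \<in> \<eta>"
  obtains n0 where "\<And>n m. n0 \<le> n \<Longrightarrow> \<exists>k\<ge>m. behind n (s k)"
proof -
  have s: "range s \<subseteq> carrier G" using boundary_mem_iff[OF \<eta>(1,3), of s] \<eta> by simp
  have "\<not> product_diverges G S x s" using boundary_eqI[OF \<eta>(1) xi(1) \<eta>(3)] \<eta>(2) boundary_mem_iff[OF xi] s by blast
  then obtain C where C: "\<And>M. \<exists>i\<ge>M. \<exists>j\<ge>M. gp \<one> (x i) (s j) < C"
    unfolding product_diverges_iff by (auto simp: not_le)
  define n0 where "n0 = Suc (nat \<lceil>C + 2 * \<delta> + real L\<rceil>)"
  show thesis
  proof
    fix n m assume n: "n0 \<le> n"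
    obtain i j where ij: "i \<ge> max m (\<iota> n)" "j \<ge> max m (\<iota> n)" "gp \<one> (x i) (s j) < C" using C by blast
    have sc: "s j \<in> carrier G" using s by auto
    have tn: "C + 2 * \<delta> + real L < real (t n)" using n n_le_t[of n] unfolding n0_def by linarith
    have "min (gp \<one> (s j) (x (\<iota> n))) (gp \<one> (x (\<iota> n)) (x i)) - \<delta> \<le> gp \<one> (s j) (x i)"
      by (intro hyperbolic one_closed x_carrier sc)
    moreover have "gp \<one> (s j) (x i) < C" using ij(3) gp_sym[OF sc x_carrier, of \<one> i] by simp
    moreover have "real (t n) + real L + \<delta> \<le> gp \<one> (x (\<iota> n)) (x i)" using ij by (intro close) auto
    ultimately have "gp \<one> (s j) (x (\<iota> n)) < C + \<delta>" using tn delta_nonneg by linarith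
    then have "behind n (s j)" using tn by (simp add: behind_def)
    then show "\<exists>k\<ge>m. behind n (s k)" using ij(2) by auto
  qed
qed

section \<open>Geodesic rays and their passage through cut vertices\<close>

lemma ray_geodesic:
  assumes "fpp_geodesic_ray G S \<omega> r" "m \<le> n"
  shows "fpp_geodesic G S \<omega> (r m) (r n) (map r [m..<Suc n])"
  using assms by (auto simp: fpp_geodesic_ray_def)

lemma ray_carrier:
  assumes "fpp_geodesic_ray G S \<omega> r" shows "r m \<in> carrier G"
  using ray_geodesic[OF assms order_refl] path_between_carrier by (auto simp: fpp_geodesic_def)

lemma ray_inj:
  assumes "fpp_geodesic_ray G S \<omega> r" "r m = r n" shows "m = n"
proof -
  have "m = n" if "r m = r n" "m \<le> n" for m n
  proof (rule ccontr)
    assume "m \<noteq> n"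
    have "distinct (map r [m..<Suc n])"
      using fpp_geodesic_distinct[OF pos ray_geodesic[OF assms(1) that(2)]] .
    then have "inj_on r {m..<Suc n}" by (simp add: distinct_map del: upt_Suc)
    then show False using that \<open>m \<noteq> n\<close> by (auto dest!: inj_onD)
  qed
  then show ?thesis using assms(2) by (metis nle_le)
qed

lemma ray_cut:
  assumes r: "fpp_geodesic_ray G S \<omega> r" and n: "n \<in> I" and ab: "behind n (r a)" "ahead n (r b)" "a \<le> b"
  shows "\<exists>k\<in>{a..b}. r k = w n"
proof -
  have "w n \<in> set (map r [a..<Suc b])"
    using ab by (intro cut[OF n ray_carrier[OF r] ray_carrier[OF r] _ _ ray_geodesic[OF r]])
      (auto simp: behind_def ahead_def)
  then show ?thesis by force
qed

lemma heads_to_xi_cut: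
  assumes "heads_to_xi r" "n \<in> I" "behind n (r 0)"
  shows "\<exists>k. r k = w n"
  using assms ray_cut[of r n 0] unfolding heads_to_xi_def by blast

text \<open>Both rays meet a common \<open>w n\<close>, and up to there each of them is the unique
  geodesic from the starting vertex.\<close>

lemma heads_to_xi_unique:
  assumes r: "heads_to_xi r" and r': "heads_to_xi r'" and eq: "r 0 = r' 0"
  shows "r = r'"
proof
  fix j
  have ray: "fpp_geodesic_ray G S \<omega> r" "fpp_geodesic_ray G S \<omega> r'" using r r' by (auto simp: heads_to_xi_def)
  define a where "a = r 0"
  have a: "a \<in> carrier G" using ray_carrier[OF ray(1)] by (simp add: a_def)
  obtain n0 where n0: "\<And>n. n0 \<le> n \<Longrightarrow> behind n a" using behind_eventually[OF a] by blast
  \<comment> \<open>The bound on \<open>n\<close> puts \<open>w n\<close> at word distance at least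
    \<open>j\<close> from \<open>a\<close>, so the common piece includes index
    \<open>j\<close>.\<close>
  obtain n where n: "n \<in> I" "max n0 (nat \<lceil>D \<one> a + real j\<rceil>) \<le> n" using large_I by blast
  obtain k k' where k: "r k = w n" "r' k' = w n"
    using heads_to_xi_cut[OF r n(1)] heads_to_xi_cut[OF r' n(1)] n0[of n] n(2) eq a_def by auto
  have "fpp_geodesic G S \<omega> a (w n) (map r [0..<Suc k])" "fpp_geodesic G S \<omega> a (w n) (map r' [0..<Suc k'])"
    using ray_geodesic[OF ray(1), of 0 k] ray_geodesic[OF ray(2), of 0 k'] k eq by (simp_all add: a_def)
  then have m: "map r [0..<Suc k] = map r' [0..<Suc k']" and pb: "path_between G S a (w n) (map r [0..<Suc k])"
    using unique[OF a w_carrier[of n]] by (auto simp: fpp_geodesic_def)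
  have kk: "k = k'" using arg_cong[OF m, of length] by simp
  have "D a (w n) \<le> real k" using D_le_length[OF pb] by simp
  moreover have "real (t n) \<le> D \<one> a + D a (w n)" using D_triangle[OF one_closed a w_carrier] D_w by metis
  moreover have "D \<one> a + real j \<le> real n" using n(2) by linarith
  ultimately have "j \<le> k" using n_le_t[of n] by linarith
  then have "map r [0..<Suc k] ! j = r j" "map r' [0..<Suc k'] ! j = r' j"
    using kk by (simp_all add: nth_append del: upt_Suc)
  then show "r j = r' j" using m by simp
qed

lemma heads_to_xi_tail:
  assumes "heads_to_xi r" shows "heads_to_xi (\<lambda>j. r (k + j))"
  unfolding heads_to_xi_def
proof (intro conjI allI)
  show "fpp_geodesic_ray G S \<omega> (\<lambda>j. r (k + j))"
    unfolding fpp_geodesic_ray_def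
  proof (intro allI impI)
    fix m n :: nat assume "m \<le> n"
    have "map (\<lambda>j. r (k + j)) [m..<Suc n] = map r [k + m..<Suc (k + n)]"
      by (rule nth_equalityI) (auto simp del: upt_Suc simp: add.assoc)
    then show "fpp_geodesic G S \<omega> (r (k + m)) (r (k + n)) (map (\<lambda>j. r (k + j)) [m..<Suc n])"
      using assms \<open>m \<le> n\<close> ray_geodesic[of r "k + m" "k + n"] by (simp add: heads_to_xi_def del: upt_Suc)
  qed
  fix n m
  obtain b where b: "b \<ge> k + m" "ahead n (r b)" using assms unfolding heads_to_xi_def by blast
  then have "b - k \<ge> m" "ahead n (r (k + (b - k)))" by auto
  then show "\<exists>b\<ge>m. ahead n (r (k + b))" by blast
qed

lemma towards_heads_to_xi:
  assumes "geodesic_ray_towards G S \<omega> a \<xi> r"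
  shows "heads_to_xi r" "r 0 = a"
proof -
  have "\<xi> \<in> boundary_accumulation_points G S r" using assms by (simp add: geodesic_ray_towards_def)
  then obtain \<phi> where "strict_mono \<phi>" "r \<circ> \<phi> \<in> \<xi>" by (auto simp: boundary_accumulation_points_def)
  then show "heads_to_xi r" "r 0 = a"
    using assms ahead_subsequence by (auto simp: heads_to_xi_def geodesic_ray_towards_def)
qed

text \<open>By the cut property and uniqueness, the geodesics from \<open>a\<close> to late cut
  vertices extend one another, so their union is a ray and no compactness argument is involved. If
  it accumulated at another boundary point, it would get behind some \<open>w n\<close> after
  passing it, and the cut property would force a second visit.\<close>

lemma ray_towards_exists:
  assumes a: "a \<in> carrier G"
  shows "\<exists>r. geodesic_ray_towards G S \<omega> a \<xi> r"
proof -
  obtain n0 where n0: "\<And>n. n0 \<le> n \<Longrightarrow> behind n a" using behind_eventually[OF a] by blast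
  define J where "J = {n \<in> I. n0 \<le> n}"
  have J: "\<exists>n\<in>J. m \<le> n" for m using large_I[of "max m n0"] by (auto simp: J_def)
  have infJ: "infinite J" using J infinite_nat_iff_unbounded_le by blast
  define \<Gamma> where "\<Gamma> n = (THE p. fpp_geodesic G S \<omega> a (w n) p)" for n
  have \<Gamma>: "fpp_geodesic G S \<omega> a (w n) (\<Gamma> n)" for n
    unfolding \<Gamma>_def using theI'[OF unique[OF a w_carrier]] .
  have \<Gamma>_eq: "p = \<Gamma> n" if "fpp_geodesic G S \<omega> a (w n) p" for n p
    using unique[OF a w_carrier] \<Gamma> that by blast
  have \<Gamma>_ne: "\<Gamma> n \<noteq> []" and \<Gamma>_hd: "hd (\<Gamma> n) = a" and \<Gamma>_last: "last (\<Gamma> n) = w n" for n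
    using \<Gamma>[of n] by (auto simp: fpp_geodesic_def path_between_def edge_path_iff)
  have prefix: "\<exists>\<beta>. \<beta> \<noteq> [] \<and> \<Gamma> m = \<Gamma> n @ \<beta>" if nm: "n \<in> J" "m \<in> J" "n < m" for n m
  proof -
    have "w n \<in> set (\<Gamma> m)"
      using nm n0[of n] ahead_w[OF nm(3)] \<Gamma>[of m] a w_carrier
      by (intro cut[of n a "w m"]) (auto simp: J_def behind_def ahead_def)
    then obtain \<alpha> \<beta> where d: "\<Gamma> m = \<alpha> @ w n # \<beta>" using split_list by metis
    have d': "\<Gamma> m = [] @ (\<alpha> @ [w n]) @ \<beta>" using d by simp
    have h: "hd (\<alpha> @ [w n]) = a" using \<Gamma>_hd[of m] d by (cases \<alpha>) auto
    have "fpp_geodesic G S \<omega> a (w n) (\<alpha> @ [w n])"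
      using fpp_geodesic_infix[OF pos_imp_nonneg[OF pos] \<Gamma>[of m, unfolded d']] h by simp
    then have e: "\<alpha> @ [w n] = \<Gamma> n" by (rule \<Gamma>_eq)
    have "w n \<noteq> w m" using D_w[of n] D_w[of m] t_mono nm(3) by (metis of_nat_eq_iff strict_mono_eq less_irrefl)
    then have "\<beta> \<noteq> []" using \<Gamma>_last[of m] d by auto
    moreover have "\<Gamma> m = \<Gamma> n @ \<beta>" using d e by simp
    ultimately show ?thesis by blast
  qed
  have len: "length (\<Gamma> n) < length (\<Gamma> m)" if "n \<in> J" "m \<in> J" "n < m" for n m
    using prefix[OF that] by auto
  have nth: "\<Gamma> m ! j = \<Gamma> n ! j" if "n \<in> J" "m \<in> J" "j < length (\<Gamma> n)" "j < length (\<Gamma> m)" for n m j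
    using prefix[of n m] prefix[of m n] that by (cases n m rule: linorder_cases) (auto simp: nth_append)
  have unb: "\<exists>n\<in>J. j < length (\<Gamma> n)" for j
  proof -
    obtain n where n: "n \<in> J" "nat \<lceil>D \<one> a + real j\<rceil> \<le> n" using J by blast
    have "D a (w n) \<le> real (length (\<Gamma> n) - 1)" using \<Gamma>[of n] D_le_length by (auto simp: fpp_geodesic_def)
    moreover have "real (t n) \<le> D \<one> a + D a (w n)" using D_triangle[OF one_closed a w_carrier] D_w by metis
    moreover have "D \<one> a + real j \<le> real n" using n(2) by linarith
    moreover have "0 < length (\<Gamma> n)" using \<Gamma>_ne by simp
    ultimately have "j < length (\<Gamma> n)" using n_le_t[of n] by linarith
    then show ?thesis using n by blast
  qed
  then obtain f where f: "\<And>j. f j \<in> J" "\<And>j. j < length (\<Gamma> (f j))" by metis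
  \<comment> \<open>Since the geodesics are nested, the value does not depend on which long enough
    one \<open>f\<close> selects.\<close>
  define r where "r j = \<Gamma> (f j) ! j" for j
  have r: "r j = \<Gamma> n ! j" if "n \<in> J" "j < length (\<Gamma> n)" for n j
    unfolding r_def using nth[OF that(1) f(1) that(2) f(2)] .
  have ray: "fpp_geodesic_ray G S \<omega> r"
    unfolding fpp_geodesic_ray_def
  proof (intro allI impI)
    fix m n :: nat assume mn: "m \<le> n"
    obtain k where k: "k \<in> J" "n < length (\<Gamma> k)" using unb by blast
    define \<beta> where "\<beta> = map r [m..<Suc n]"
    have \<beta>: "\<beta> = take (Suc n - m) (drop m (\<Gamma> k))"
      unfolding \<beta>_def by (rule nth_equalityI) (use k mn r[OF k(1)] in \<open>auto simp del: upt_Suc\<close>)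
    have dec: "\<Gamma> k = take m (\<Gamma> k) @ \<beta> @ drop (Suc n - m) (drop m (\<Gamma> k))"
      unfolding \<beta> append_take_drop_id ..
    have ne: "\<beta> \<noteq> []" using mn by (auto simp: \<beta>_def)
    have "hd \<beta> = r m" "last \<beta> = r n" using mn ne by (auto simp: \<beta>_def hd_map last_map simp del: upt_Suc)
    moreover have "fpp_geodesic G S \<omega> a (w k) (take m (\<Gamma> k) @ \<beta> @ drop (Suc n - m) (drop m (\<Gamma> k)))"
      using \<Gamma>[of k] dec by simp
    ultimately show "fpp_geodesic G S \<omega> (r m) (r n) (map r [m..<Suc n])"
      using fpp_geodesic_infix[OF pos_imp_nonneg[OF pos] _ ne] unfolding \<beta>_def[symmetric] by metis
  qed
  have rw: "r (length (\<Gamma> n) - 1) = w n" if "n \<in> J" for n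
    using r[OF that, of "length (\<Gamma> n) - 1"] \<Gamma>_ne[of n] \<Gamma>_last[of n] by (simp add: last_conv_nth)
  have r0: "r 0 = a"
  proof -
    obtain n where "n \<in> J" using J by blast
    then show ?thesis using r[of n 0] \<Gamma>_ne[of n] \<Gamma>_hd[of n] by (simp add: hd_conv_nth)
  qed
  define \<psi> where "\<psi> = enumerate J"
  have \<psi>: "strict_mono \<psi>" "\<And>k. \<psi> k \<in> J"
    unfolding \<psi>_def using infJ by (auto simp: strict_mono_enumerate enumerate_in_set)
  have "\<xi> \<in> boundary_accumulation_points G S r"
  proof -
    define \<phi> where "\<phi> k = length (\<Gamma> (\<psi> k)) - 1" for k
    have "strict_mono \<phi>"
      unfolding strict_mono_def
    proof (intro allI impI)
      fix k l :: nat assume "k < l"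
      then have "length (\<Gamma> (\<psi> k)) < length (\<Gamma> (\<psi> l))" using len \<psi> by (auto simp: strict_mono_def)
      moreover have "0 < length (\<Gamma> (\<psi> k))" using \<Gamma>_ne by simp
      ultimately show "\<phi> k < \<phi> l" unfolding \<phi>_def by linarith
    qed
    moreover have "r \<circ> \<phi> = w \<circ> \<psi>" using rw[OF \<psi>(2)] by (auto simp: \<phi>_def)
    ultimately show ?thesis using w_in_xi[OF \<psi>(1)] xi(1) by (auto simp: boundary_accumulation_points_def)
  qed
  moreover have "\<eta> = \<xi>" if "\<eta> \<in> boundary_accumulation_points G S r" for \<eta>
  proof (rule ccontr)
    assume ne: "\<eta> \<noteq> \<xi>"
    obtain \<phi> where \<phi>: "\<eta> \<in> gromov_boundary G S" "strict_mono \<phi>" "r \<circ> \<phi> \<in> \<eta>"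
      using \<open>\<eta> \<in> boundary_accumulation_points G S r\<close> by (auto simp: boundary_accumulation_points_def)
    obtain n1 where n1: "\<And>n m. n1 \<le> n \<Longrightarrow> \<exists>k\<ge>m. behind n ((r \<circ> \<phi>) k)"
      using behind_other_boundary_point[OF \<phi>(1) ne \<phi>(3)] by blast
    obtain n where n: "n \<in> J" "n1 \<le> n" using J by blast
    define l where "l = length (\<Gamma> n) - 1"
    obtain k where k: "k \<ge> Suc l" "behind n (r (\<phi> k))" using n1[OF n(2), of "Suc l"] by auto
    have lk: "l < \<phi> k" using k strict_mono_imp_increasing[OF \<phi>(2), of k] by simp
    obtain m where m: "m \<in> J" "\<phi> k < length (\<Gamma> m)" using unb by blast
    have "n < m"
    proof (rule ccontr)
      assume "\<not> n < m"
      then have "length (\<Gamma> m) \<le> length (\<Gamma> n)" using len[OF m(1) n(1)] by (cases "m = n") auto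
      then show False using lk m(2) by (simp add: l_def)
    qed
    \<comment> \<open>From index \<open>\<phi> k\<close>, behind \<open>w n\<close>, to the end of
      \<open>\<Gamma> m\<close>, ahead of it, the ray must meet \<open>w n\<close>, although it
      already did so at the smaller index \<open>l\<close>.\<close>
    have "ahead n (r (length (\<Gamma> m) - 1))" using ahead_w[OF \<open>n < m\<close>] rw[OF m(1)] by simp
    moreover have "\<phi> k \<le> length (\<Gamma> m) - 1" "n \<in> I" using m(2) n(1) by (simp_all add: J_def)
    ultimately have "\<exists>j\<in>{\<phi> k..length (\<Gamma> m) - 1}. r j = w n" using ray_cut[OF ray _ k(2)] by blast
    then obtain j where "j \<in> {\<phi> k..length (\<Gamma> m) - 1}" "r j = w n" by blast
    moreover have "r l = w n" using rw[OF n(1)] by (simp add: l_def)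
    ultimately have "j = l" "\<phi> k \<le> j" using ray_inj[OF ray, of j l] by auto
    then show False using lk by simp
  qed
  ultimately have "boundary_accumulation_points G S r = {\<xi>}" by blast
  then show ?thesis using ray r0 by (auto simp: geodesic_ray_towards_def)
qed

lemma ray_towards_unique:
  assumes "a \<in> carrier G"
  shows "\<exists>!r. geodesic_ray_towards G S \<omega> a \<xi> r"
proof (rule ex_ex1I)
  show "\<exists>r. geodesic_ray_towards G S \<omega> a \<xi> r" by (rule ray_towards_exists[OF assms])
  show "r = r'" if "geodesic_ray_towards G S \<omega> a \<xi> r" "geodesic_ray_towards G S \<omega> a \<xi> r'" for r r'
    using towards_heads_to_xi[OF that(1)] towards_heads_to_xi[OF that(2)] by (intro heads_to_xi_unique) auto
qed

text \<open>From a common cut vertex on, the tails are rays with the same start, hence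
  equal.\<close>

lemma rays_coalesce:
  assumes r: "geodesic_ray_towards G S \<omega> a \<xi> r" and r': "geodesic_ray_towards G S \<omega> b \<xi> r'"
  shows "coalesce G S r r'"
proof -
  note h = towards_heads_to_xi(1)[OF r] towards_heads_to_xi(1)[OF r']
  have ray: "fpp_geodesic_ray G S \<omega> r" "fpp_geodesic_ray G S \<omega> r'" using h by (auto simp: heads_to_xi_def)
  obtain n0 where n0: "\<And>n. n0 \<le> n \<Longrightarrow> behind n (r 0)" using behind_eventually[OF ray_carrier[OF ray(1)]] by blast
  obtain n0' where n0': "\<And>n. n0' \<le> n \<Longrightarrow> behind n (r' 0)" using behind_eventually[OF ray_carrier[OF ray(2)]] by blast
  obtain n where n: "n \<in> I" "max n0 n0' \<le> n" using large_I by blast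
  obtain k k' where k: "r k = w n" "r' k' = w n"
    using heads_to_xi_cut[OF h(1) n(1)] heads_to_xi_cut[OF h(2) n(1)] n0 n0' n(2) by auto
  have tails: "(\<lambda>j. r (k + j)) = (\<lambda>j. r' (k' + j))"
    using k by (intro heads_to_xi_unique heads_to_xi_tail h) simp
  \<comment> \<open>\<open>R\<close> only has to bound the distances of the finitely many vertices
    before the tails.\<close>
  define R where "R = (\<Sum>i<k. D \<one> (r i)) + (\<Sum>i<k'. D \<one> (r' i))"
  have nn: "0 \<le> D \<one> (r i)" "0 \<le> D \<one> (r' i)" for i
    using ray_carrier[OF ray(1)] ray_carrier[OF ray(2)] by (auto intro: D_nonneg)
  have in1: "r i \<in> word_ball G S R" if "i < k" for i
  proof -
    have "D \<one> (r i) \<le> (\<Sum>i<k. D \<one> (r i))" using that nn by (intro member_le_sum) auto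
    moreover have "0 \<le> (\<Sum>i<k'. D \<one> (r' i))" using nn by (intro sum_nonneg) auto
    ultimately show ?thesis using ray_carrier[OF ray(1)] by (simp add: word_ball_def R_def)
  qed
  have in2: "r' i \<in> word_ball G S R" if "i < k'" for i
  proof -
    have "D \<one> (r' i) \<le> (\<Sum>i<k'. D \<one> (r' i))" using that nn by (intro member_le_sum) auto
    moreover have "0 \<le> (\<Sum>i<k. D \<one> (r i))" using nn by (intro sum_nonneg) auto
    ultimately show ?thesis using ray_carrier[OF ray(2)] by (simp add: word_ball_def R_def)
  qed
  have "e \<inter> word_ball G S R \<noteq> {}" if e: "e \<in> ray_edges r" "e \<notin> ray_edges r'" for e
  proof -
    obtain i where i: "e = {r i, r (Suc i)}" using e(1) by (auto simp: ray_edges_def)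
    have "i < k"
    proof (rule ccontr)
      assume "\<not> i < k"
      then have "e = {r' (k' + (i - k)), r' (Suc (k' + (i - k)))}"
        using i fun_cong[OF tails, of "i - k"] fun_cong[OF tails, of "Suc i - k"] by (simp add: Suc_diff_le)
      then show False using e(2) by (auto simp: ray_edges_def)
    qed
    then show ?thesis using in1 i by auto
  qed
  moreover have "e \<inter> word_ball G S R \<noteq> {}" if e: "e \<in> ray_edges r'" "e \<notin> ray_edges r" for e
  proof -
    obtain i where i: "e = {r' i, r' (Suc i)}" using e(1) by (auto simp: ray_edges_def)
    have "i < k'"
    proof (rule ccontr)
      assume "\<not> i < k'"
      then have "e = {r (k + (i - k')), r (Suc (k + (i - k')))}"
        using i fun_cong[OF tails, of "i - k'"] fun_cong[OF tails, of "Suc i - k'"] by (simp add: Suc_diff_le)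
      then show False using e(2) by (auto simp: ray_edges_def)
    qed
    then show ?thesis using in2 i by auto
  qed
  ultimately show ?thesis unfolding coalesce_def by blast
qed

lemma rays_exist_and_coalesce:
  assumes "a \<in> carrier G" "b \<in> carrier G"
  shows "(\<exists>!r. geodesic_ray_towards G S \<omega> a \<xi> r) \<and> (\<exists>!r. geodesic_ray_towards G S \<omega> b \<xi> r) \<and>
    coalesce G S (the_ray G S \<omega> a \<xi>) (the_ray G S \<omega> b \<xi>)"
  unfolding the_ray_def
  by (intro conjI ray_towards_unique assms
      rays_coalesce[OF theI'[OF ray_towards_unique[OF assms(1)]] theI'[OF ray_towards_unique[OF assms(2)]]])

end

section \<open>Existence and uniqueness of finite geodesics\<close>

definition path_edges :: "'a list \<Rightarrow> 'a set set" where
  "path_edges p = (\<lambda>i. {p ! i, p ! Suc i}) ` {..<length p - 1}"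

lemma finite_path_edges: "finite (path_edges p)"
  by (simp add: path_edges_def)

lemma path_edges_inj:
  assumes "distinct p"
  shows "inj_on (\<lambda>i. {p ! i, p ! Suc i}) {..<length p - 1}"
proof (rule inj_onI)
  fix i j assume ij: "i \<in> {..<length p - 1}" "j \<in> {..<length p - 1}" "{p ! i, p ! Suc i} = {p ! j, p ! Suc j}"
  have eq: "p ! k = p ! l \<longleftrightarrow> k = l" if "k < length p" "l < length p" for k l
    using assms that by (simp add: nth_eq_iff_index_eq)
  have "p ! i = p ! j \<and> p ! Suc i = p ! Suc j \<or> p ! i = p ! Suc j \<and> p ! Suc i = p ! j"
    using ij(3) by (simp add: doubleton_eq_iff)
  then show "i = j" using ij(1,2) eq[of i j] eq[of i "Suc j"] eq[of "Suc i" j] by auto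
qed

lemma card_path_edges: "distinct p \<Longrightarrow> card (path_edges p) = length p - 1"
  using card_image[OF path_edges_inj] by (simp add: path_edges_def)

lemma path_length_eq_sum: "distinct p \<Longrightarrow> path_length \<omega> p = (\<Sum>e\<in>path_edges p. \<omega> e)"
  unfolding path_edges_def path_length_def by (subst sum.reindex[OF path_edges_inj]) auto

text \<open>Take the first edge along which \<open>p\<close> leaves \<open>q\<close>. In
  \<open>q\<close> the vertex before it has a different successor, and its predecessor, if any, lies
  in the common prefix, which the simple path \<open>p\<close> does not revisit. So this edge is not
  in \<open>q\<close>.\<close>

lemma path_edges_differ:
  assumes p: "distinct p" and q: "distinct q" and ne: "p \<noteq> []" "q \<noteq> []" "p \<noteq> q"
    and ends: "hd p = hd q" "last p = last q"
  shows "path_edges p \<noteq> path_edges q"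
proof -
  \<comment> \<open>A proper extension with the same last vertex repeats it; so neither path is a
    prefix of the other.\<close>
  have aux: "\<not> (\<exists>z. q = p @ z \<and> z \<noteq> [])" if "distinct q" "p \<noteq> []" "last p = last q" for p q :: "'a list"
    using that by (metis Un_iff disjoint_iff distinct_append last_appendR last_in_set)
  obtain s ps qs where s: "p = s @ ps" "q = s @ qs" "ps = [] \<or> qs = [] \<or> hd ps \<noteq> hd qs"
    using longest_common_prefix[of p q] by blast
  have "ps \<noteq> []"
  proof
    assume "ps = []"
    then have "q = p @ qs" "qs \<noteq> []" using s ne(3) by auto
    then show False using aux[OF q ne(1) ends(2)] by blast
  qed
  moreover have "qs \<noteq> []"
  proof
    assume "qs = []"
    then have "p = q @ ps" "ps \<noteq> []" using s ne(3) by auto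
    then show False using aux[OF p ne(2) ends(2)[symmetric]] by blast
  qed
  ultimately have "\<exists>s a b p' q'. a \<noteq> b \<and> p = s @ a # p' \<and> q = s @ b # q'"
    using s by (metis list.collapse)
  then obtain s a b p' q' where d: "a \<noteq> b" "p = s @ a # p'" "q = s @ b # q'" by blast
  have "s \<noteq> []" using d ends(1) by auto
  define i where "i = length s - 1"
  have i: "Suc i = length s" using \<open>s \<noteq> []\<close> by (simp add: i_def)
  have nth: "p ! i = s ! i" "p ! Suc i = a" "q ! i = s ! i" "q ! Suc i = b"
    using i d by (auto simp: nth_append)
  have "{p ! i, p ! Suc i} \<in> path_edges p" using i d by (auto simp: path_edges_def)
  moreover have "{p ! i, p ! Suc i} \<notin> path_edges q"
  proof
    assume "{p ! i, p ! Suc i} \<in> path_edges q"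
    then obtain j where j: "j < length q - 1" "{s ! i, a} = {q ! j, q ! Suc j}" by (auto simp: path_edges_def nth)
    have eq: "q ! k = q ! l \<longleftrightarrow> k = l" if "k < length q" "l < length q" for k l
      using q that by (simp add: nth_eq_iff_index_eq)
    have il: "i < length q" using i d by simp
    consider "q ! i = q ! j" "a = q ! Suc j" | "q ! i = q ! Suc j" "a = q ! j"
      using j(2) nth by (auto simp: doubleton_eq_iff)
    then show False
    proof cases
      case 1
      then have "i = j" using eq[of i j] j(1) il by simp
      then show False using 1 nth d by simp
    next
      case 2
      then have "i = Suc j" using eq[of i "Suc j"] j(1) il by simp
      then have "a = s ! j" using 2 d i by (simp add: nth_append)
      then have "a \<in> set s" using \<open>i = Suc j\<close> i by simp
      then show False using p d by simp
    qed
  qed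
  ultimately show ?thesis by blast
qed

context cayley_graph
begin

lemma path_edges_subset: "edge_path G S p \<Longrightarrow> path_edges p \<subseteq> E"
  by (auto simp: edge_path_def path_edges_def)

lemma loop_erasure:
  assumes "nonneg_weight \<omega>" "path_between G S x y p"
  shows "\<exists>q. path_between G S x y q \<and> distinct q \<and> path_length \<omega> q \<le> path_length \<omega> p"
  using assms(2)
proof (induction "length p" arbitrary: p rule: less_induct)
  case less
  show ?case
  proof (cases "distinct p")
    case False
    then obtain \<alpha> \<beta> \<gamma> v where p: "p = \<alpha> @ [v] @ \<beta> @ [v] @ \<gamma>" using not_distinct_decomp by blast
    have p1: "p = \<alpha> @ v # (\<beta> @ v # \<gamma>)" and p2: "v # (\<beta> @ v # \<gamma>) = (v # \<beta>) @ v # \<gamma>" using p by auto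
    have e: "edge_path G S (\<alpha> @ [v])" "edge_path G S (v # \<gamma>)" "edge_path G S ((v # \<beta>) @ [v])"
      using less.prems edge_path_glue[of G S \<alpha> v "\<beta> @ v # \<gamma>"] edge_path_glue[of G S "v # \<beta>" v \<gamma>]
      by (auto simp: path_between_def p1)
    have "path_between G S x y (\<alpha> @ v # \<gamma>)"
      using less.prems e edge_path_glue[of G S \<alpha> v \<gamma>] by (auto simp: path_between_def p1 hd_append)
    moreover have "path_length \<omega> p = path_length \<omega> (\<alpha> @ [v]) + (path_length \<omega> ((v # \<beta>) @ [v]) + path_length \<omega> (v # \<gamma>))"
      using path_length_glue[of \<omega> \<alpha> v "\<beta> @ v # \<gamma>"] path_length_glue[of \<omega> "v # \<beta>" v \<gamma>] unfolding p1 p2 by simp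
    then have "path_length \<omega> (\<alpha> @ v # \<gamma>) \<le> path_length \<omega> p"
      using path_length_glue[of \<omega> \<alpha> v \<gamma>] edge_path_length_nonneg[OF assms(1) e(3)] by simp
    moreover have "length (\<alpha> @ v # \<gamma>) < length p" using p by simp
    ultimately show ?thesis using less.hyps[of "\<alpha> @ v # \<gamma>"] by force
  qed (use less in blast)
qed

text \<open>By \<open>grow\<close>, all simple paths with enough edges are longer than a fixed path
  \<open>p0\<close>; by local finiteness only finitely many competitors remain.\<close>

lemma geodesic_exists:
  assumes \<omega>: "nonneg_weight \<omega>" and xy: "x \<in> carrier G" "y \<in> carrier G"
    and grow: "\<And>B. \<exists>n. \<forall>p\<in>paths_from x n. distinct p \<longrightarrow> B \<le> path_length \<omega> p"
  shows "\<exists>p. fpp_geodesic G S \<omega> x y p"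
proof -
  obtain p0 where p0: "path_between G S x y p0" "distinct p0" using path_exists[OF xy] loop_erasure[OF \<omega>] by blast
  obtain n where n: "\<And>p. p \<in> paths_from x n \<Longrightarrow> distinct p \<Longrightarrow> path_length \<omega> p0 + 1 \<le> path_length \<omega> p"
    using grow by blast
  define F where "F = {p. path_between G S x y p \<and> distinct p \<and> length p \<le> n}"
  have long: "path_length \<omega> p0 < path_length \<omega> p" if p: "path_between G S x y p" "distinct p" "n < length p" for p
  proof -
    define q where "q = take (Suc n) p"
    have q: "length q = Suc n" "distinct q" using p by (auto simp: q_def)
    obtain q' v where q': "q = q' @ [v]" using q(1) by (metis append_butlast_last_id list.size(3) nat.distinct(1))
    define z where "z = drop (Suc n) p"
    have pz: "p = q' @ v # z" using q' append_take_drop_id[of "Suc n" p] by (simp add: q_def z_def)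
    have e: "edge_path G S q" "edge_path G S (v # z)"
      using p(1) edge_path_glue[of G S q' v z] pz q' by (auto simp: path_between_def)
    have "hd q = x" using p(1) pz q' by (cases q') (auto simp: path_between_def)
    then have "path_length \<omega> p0 + 1 \<le> path_length \<omega> q" using n q e by (auto simp: paths_from_def)
    then show ?thesis
      using path_length_glue[of \<omega> q' v z] edge_path_length_nonneg[OF \<omega> e(2)] pz q' by simp
  qed
  have "F \<subseteq> (\<Union>k\<le>n. paths_from x k)"
  proof
    fix p assume p: "p \<in> F"
    then have "p \<in> paths_from x (length p - 1)"
      by (auto simp: F_def paths_from_def path_between_def edge_path_def Suc_pred)
    moreover have "length p - 1 \<le> n" using p unfolding F_def by auto
    ultimately show "p \<in> (\<Union>k\<le>n. paths_from x k)" by blast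
  qed
  then have fin: "finite F" by (rule finite_subset) (simp add: finite_paths_from)
  have p0F: "p0 \<in> F" using p0 long[of p0] by (force simp: F_def)
  obtain m where m: "m \<in> F" "\<And>p. p \<in> F \<Longrightarrow> path_length \<omega> m \<le> path_length \<omega> p"
    using arg_min_if_finite[OF fin, of "path_length \<omega>"] p0F by (metis empty_iff not_le)
  have "path_length \<omega> m \<le> path_length \<omega> p" if p: "path_between G S x y p" for p
  proof -
    obtain q where q: "path_between G S x y q" "distinct q" "path_length \<omega> q \<le> path_length \<omega> p"
      using loop_erasure[OF \<omega> p] by blast
    have "path_length \<omega> m \<le> path_length \<omega> q"
    proof (cases "length q \<le> n")
      case False
      then show ?thesis using long[of q] q m(2)[OF p0F] by simp
    qed (use m q in \<open>auto simp: F_def\<close>)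
    then show ?thesis using q by simp
  qed
  then have "path_length \<omega> m \<le> fpp_dist G S \<omega> x y" by (rule fpp_dist_greatest[OF xy])
  moreover have "path_between G S x y m" using m by (simp add: F_def)
  ultimately have "fpp_geodesic G S \<omega> x y m"
    using fpp_dist_le[OF \<omega>, of x y m] by (simp add: fpp_geodesic_def)
  then show ?thesis by blast
qed

text \<open>Stated through edge sets, since simple paths with the same edges have the same length.
  Only countably many finite edge sets occur, so for atomless weights this holds almost
  surely.\<close>

definition generic :: "('a set \<Rightarrow> real) \<Rightarrow> bool" where
  "generic \<omega> \<longleftrightarrow> (\<forall>p q. edge_path G S p \<and> distinct p \<and> edge_path G S q \<and> distinct q \<and>
     path_edges p \<noteq> path_edges q \<longrightarrow> path_length \<omega> p \<noteq> path_length \<omega> q)"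

lemma geodesic_unique:
  assumes "pos_weight \<omega>" "generic \<omega>" "fpp_geodesic G S \<omega> x y p" "fpp_geodesic G S \<omega> x y q"
  shows "p = q"
proof (rule ccontr)
  assume "p \<noteq> q"
  have d: "distinct p" "distinct q" using fpp_geodesic_distinct assms by blast+
  have e: "edge_path G S p" "edge_path G S q" "hd p = hd q" "last p = last q" "path_length \<omega> p = path_length \<omega> q"
    using assms by (auto simp: fpp_geodesic_def path_between_def)
  have "path_edges p \<noteq> path_edges q"
    using path_edges_differ[OF d _ _ \<open>p \<noteq> q\<close> e(3,4)] e(1,2) by (simp add: edge_path_def)
  then show False using assms(2) d e by (auto simp: generic_def)
qed

lemma good_geodesic_exists:
  assumes \<omega>: "nonneg_weight \<omega>" and xy: "x \<in> carrier G" "y \<in> carrier G" and w: "w \<in> carrier G"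
    and good: "\<And>r. r0 \<le> r \<Longrightarrow> good N c \<Lambda> \<omega> w r" and N: "\<And>r. r0 \<le> r \<Longrightarrow> r \<le> N r" and c: "0 < c"
  shows "\<exists>p. fpp_geodesic G S \<omega> x y p"
proof (rule geodesic_exists[OF \<omega> xy])
  fix B
  define r where "r = r0 + nat \<lceil>D w x\<rceil> + nat \<lceil>B / c\<rceil>"
  have r: "r0 \<le> r" "D w x \<le> real r" "B / c \<le> real r" unfolding r_def by linarith+
  have "B \<le> c * real r" using r(3) c by (simp add: field_simps)
  also have "\<dots> \<le> c * real (N r)" using N[OF r(1)] c by (intro mult_left_mono) auto
  finally have "B \<le> c * real (N r)" .
  moreover have "x \<in> nball w r" using r xy by (simp add: nball_def)
  ultimately show "\<exists>n. \<forall>p\<in>paths_from x n. distinct p \<longrightarrow> B \<le> path_length \<omega> p"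
    using good[OF r(1)] unfolding good_def by force
qed

section \<open>Locality of the good events\<close>

lemma path_stays_in_ball:
  assumes w: "w \<in> carrier G" and p: "p \<in> paths_from x n" and x: "x \<in> nball w r"
  shows "path_edges p \<subseteq> edges_in (nball w (r + n))"
proof -
  have "D w (p ! i) \<le> real (r + i) \<and> p ! i \<in> carrier G" if "i \<le> n" for i
    using that
  proof (induction i)
    case 0
    then show ?case using p x by (cases p) (auto simp: paths_from_def nball_def)
  next
    case (Suc i)
    have e: "{p ! i, p ! Suc i} \<in> E" using Suc p by (auto simp: paths_from_def edge_path_def)
    then have c: "p ! Suc i \<in> carrier G" "p ! i \<in> carrier G" by (auto simp: edge_iff)
    show ?case using Suc D_edge[OF e] D_triangle[OF w c(2,1)] c by auto
  qed
  then have "p ! i \<in> nball w (r + n)" if "i \<le> n" for i using that by (force simp: nball_def)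
  then show ?thesis
    using p path_edges_subset[of p] unfolding edges_in_def path_edges_def paths_from_def by auto
qed

text \<open>A path of \<open>N r\<close> edges that starts in the ball of radius \<open>r\<close>
  stays in the ball of radius \<open>r + N r\<close>, so the weights in a bounded region decide
  goodness. The independence of events far apart rests on this.\<close>

lemma good_cong:
  assumes w: "w \<in> carrier G" and F: "edges_in (nball w (3 * r)) \<subseteq> F" "edges_in (nball w (r + N r)) \<subseteq> F"
    and eq: "\<And>e. e \<in> F \<Longrightarrow> \<omega> e = \<omega>' e"
  shows "good N c \<Lambda> \<omega> w r \<longleftrightarrow> good N c \<Lambda> \<omega>' w r"
proof -
  have 1: "\<omega> {u, v} = \<omega>' {u, v}" if "u \<in> nball w (3 * r)" "v \<in> nball w (3 * r)" "{u, v} \<in> E" for u v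
    using that F(1) by (intro eq) (auto simp: edges_in_def)
  have 2: "path_length \<omega> p = path_length \<omega>' p" if "x \<in> nball w r" "p \<in> paths_from x (N r)" "distinct p" for x p
    unfolding path_length_eq_sum[OF that(3)]
    using path_stays_in_ball[OF w that(2,1)] F(2) by (intro sum.cong refl eq) auto
  show ?thesis unfolding good_def using 1 2 by auto
qed

lemma edges_in_nball_mono:
  assumes "w \<in> carrier G" "v \<in> carrier G" "D w v + real r \<le> real s"
  shows "edges_in (nball v r) \<subseteq> edges_in (nball w s)"
proof -
  have "nball v r \<subseteq> nball w s"
  proof
    fix u assume "u \<in> nball v r"
    then show "u \<in> nball w s" using D_triangle[OF assms(1,2), of u] assms(3) by (auto simp: nball_def)
  qed
  then show ?thesis by (auto simp: edges_in_def)
qed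

text \<open>An edge is a subset of \<open>V\<close>. The bound is crude, but with
  \<open>card_nball\<close> it does not depend on the centre of a ball, so the probability of a
  configuration is bounded below uniformly along the sequence.\<close>

lemma finite_edges_in: "finite V \<Longrightarrow> finite (edges_in V)" and card_edges_in: "finite V \<Longrightarrow> card (edges_in V) \<le> 2 ^ card V"
proof -
  assume V: "finite V"
  have "edges_in V \<subseteq> Pow V" by (auto simp: edges_in_def)
  then show "finite (edges_in V)" "card (edges_in V) \<le> 2 ^ card V"
    using V card_mono[of "Pow V" "edges_in V"] by (auto simp: card_Pow intro: finite_subset)
qed

lemma edges_in_disjoint:
  assumes w: "w \<in> carrier G" "v \<in> carrier G" and far: "real r + real s < D w v"
  shows "edges_in (nball w r) \<inter> edges_in (nball v s) = {}"
proof -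
  have "nball w r \<inter> nball v s = {}"
    using far D_triangle[OF w(1) _ w(2)] D_sym[OF w(2)] by (fastforce simp: nball_def)
  moreover have "e \<noteq> {}" if "e \<in> E" for e using that by (rule edge_cases) auto
  ultimately show ?thesis by (auto simp: edges_in_def) blast
qed

end

section \<open>Well separated segments along a sequence converging to the boundary point\<close>

context hyperbolic_cayley_graph
begin

text \<open>Each \<open>\<sigma> n\<close> is a window of length \<open>2 * L\<close>, centred at
  height \<open>t n\<close>, on a word geodesic from the identity to \<open>x (\<iota> n)\<close>;
  these geodesics may differ for different \<open>n\<close>. The heights are spread out first,
  according to \<rho>, and \<iota> is then taken so late that the sequence has settled beyond
  them.\<close>

lemma segments_exist:
  assumes xi: "\<xi> \<in> gromov_boundary G S" and \<rho>: "mono (\<rho> :: nat \<Rightarrow> nat)"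
  obtains x t \<iota> \<sigma> where "x \<in> \<xi>" "strict_mono t"
    "\<And>n m. n < m \<Longrightarrow> real (t n) + real L + \<delta> \<le> real (t m)"
    "mono \<iota>" "\<And>n. n \<le> \<iota> n"
    "\<And>n i j. \<iota> n \<le> i \<Longrightarrow> \<iota> n \<le> j \<Longrightarrow> real (t n) + real L + \<delta> \<le> gp \<one> (x i) (x j)"
    "\<And>n. word_segment (\<sigma> n) (2 * L)"
    "\<And>n. L \<le> t n"
    "\<And>n i. i \<le> 2 * L \<Longrightarrow> D \<one> (\<sigma> n i) = real (t n - L + i) \<and>
       D (\<sigma> n i) (x (\<iota> n)) = D \<one> (x (\<iota> n)) - real (t n - L + i)"
    "\<And>n m. n \<noteq> m \<Longrightarrow> real (\<rho> n) + real (\<rho> m) < D (\<sigma> n L) (\<sigma> m L)"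
proof -
  obtain x where x: "x \<in> \<xi>" using boundary_nonempty[OF xi] by blast
  then have xc: "x i \<in> carrier G" and xx: "product_diverges G S x x" for i
    using boundary_mem_iff[OF xi x, of x] by auto
  \<comment> \<open>\<open>2 * \<rho> k\<close> separates the balls around the midpoints, since
    \<rho> is monotone; \<open>L + nat \<lceil>\<delta>\<rceil>\<close> provides the gap, and 1
    makes the separation strict.\<close>
  define s where "s k = 2 * \<rho> k + L + nat \<lceil>\<delta>\<rceil> + 1" for k
  define t where "t n = (\<Sum>k\<le>n. s k)" for n
  have t_Suc: "t (Suc n) = t n + s (Suc n)" for n by (simp add: t_def)
  have t_step: "t n + s m \<le> t m" if "n < m" for n m
  proof -
    have "t n + s m \<le> t (m - 1) + s m"
      unfolding t_def using that by (intro add_right_mono sum_mono2) auto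
    also have "\<dots> = t m" using t_Suc[of "m - 1"] that by simp
    finally show ?thesis .
  qed
  have t_mono: "strict_mono t" unfolding strict_mono_Suc_iff t_Suc by (simp add: s_def)
  have t_L: "L \<le> t n" for n
    using member_le_sum[of 0 "{..n}" s] by (simp add: t_def s_def)
  have gap: "real (t n) + real L + \<delta> \<le> real (t m)" if "n < m" for n m
  proof -
    have "real (t n) + real (s m) \<le> real (t m)" using t_step[OF that] by linarith
    then show ?thesis unfolding s_def using delta_nonneg by linarith
  qed
  obtain f where f: "\<And>C i j. f C \<le> i \<Longrightarrow> f C \<le> j \<Longrightarrow> C \<le> gp \<one> (x i) (x j)"
    using xx unfolding product_diverges_iff by metis
  \<comment> \<open>Summing these makes \<iota> dominate each required threshold; the successor
    makes it strictly increasing.\<close>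
  define h where "h k = Suc (f (real (t k) + real L + \<delta>))" for k
  define \<iota> where "\<iota> n = (\<Sum>k\<le>n. h k)" for n
  have \<iota>_strict: "strict_mono \<iota>" unfolding strict_mono_Suc_iff \<iota>_def by (simp add: h_def)
  have \<iota>_f: "f (real (t n) + real L + \<delta>) \<le> \<iota> n" for n
    using member_le_sum[of n "{..n}" h] by (simp add: \<iota>_def h_def)
  have close: "real (t n) + real L + \<delta> \<le> gp \<one> (x i) (x j)" if "\<iota> n \<le> i" "\<iota> n \<le> j" for n i j
    using that \<iota>_f[of n] by (intro f) auto
  define m where "m n = ndist \<one> (x (\<iota> n))" for n
  have Dm: "D \<one> (x (\<iota> n)) = real (m n)" for n unfolding m_def by (intro D_eq_ndist one_closed xc)
  have m: "t n + L \<le> m n" for n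
    using close[of n "\<iota> n" "\<iota> n"] gp_refl[OF one_closed xc] Dm[of n] delta_nonneg by simp
  have "\<exists>g. g 0 = \<one> \<and> g (m n) = x (\<iota> n) \<and> (\<forall>i\<le>m n. g i \<in> carrier G) \<and>
      (\<forall>i j. i \<le> j \<longrightarrow> j \<le> m n \<longrightarrow> D (g i) (g j) = real (j - i)) \<and> (\<forall>i<m n. {g i, g (Suc i)} \<in> E)" for n
    using word_geodesic_nth[OF one_closed xc[of "\<iota> n"]] unfolding m_def by metis
  then obtain g where g: "\<And>n. g n 0 = \<one>" "\<And>n. g n (m n) = x (\<iota> n)" "\<And>n i. i \<le> m n \<Longrightarrow> g n i \<in> carrier G"
    "\<And>n i j. i \<le> j \<Longrightarrow> j \<le> m n \<Longrightarrow> D (g n i) (g n j) = real (j - i)" "\<And>n i. i < m n \<Longrightarrow> {g n i, g n (Suc i)} \<in> E"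
    by metis
  define \<sigma> where "\<sigma> n i = g n (t n - L + i)" for n i
  have bound: "t n - L + i \<le> m n" if "i \<le> 2 * L" for n i using m[of n] t_L[of n] that by linarith
  have seg: "word_segment (\<sigma> n) (2 * L)" for n
    unfolding word_segment_def \<sigma>_def
  proof (intro conjI allI impI)
    fix i assume "i \<le> 2 * L" then show "g n (t n - L + i) \<in> carrier G" using g(3) bound by blast
  next
    fix i assume "i < 2 * L"
    then show "{g n (t n - L + i), g n (t n - L + Suc i)} \<in> E" using g(5)[of "t n - L + i" n] bound[of "Suc i" n] by simp
  next
    fix i j assume "i \<le> j" "j \<le> 2 * L"
    then show "D (g n (t n - L + i)) (g n (t n - L + j)) = real (j - i)"
      using g(4)[of "t n - L + i" "t n - L + j" n] bound[of j n] by simp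
  qed
  have pos: "D \<one> (\<sigma> n i) = real (t n - L + i) \<and> D (\<sigma> n i) (x (\<iota> n)) = D \<one> (x (\<iota> n)) - real (t n - L + i)"
    if "i \<le> 2 * L" for n i
    using g(4)[of 0 "t n - L + i" n] g(4)[of "t n - L + i" "m n" n] g(1,2)[of n] bound[OF that, of n]
    by (simp add: \<sigma>_def Dm)
  have sep: "real (\<rho> n) + real (\<rho> m) < D (\<sigma> n L) (\<sigma> m L)" if "n < m" for n m
  proof -
    have c: "\<sigma> n L \<in> carrier G" "\<sigma> m L \<in> carrier G" using seg[of n] seg[of m] by (auto simp: word_segment_def)
    have "D \<one> (\<sigma> n L) = real (t n)" "D \<one> (\<sigma> m L) = real (t m)" using pos[of L n] pos[of L m] t_L by auto
    then have "real (t m) - real (t n) \<le> D (\<sigma> n L) (\<sigma> m L)" using D_triangle[OF one_closed c] by simp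
    moreover have "real (t n) + real (s m) \<le> real (t m)" using t_step[OF that] by linarith
    moreover have "\<rho> n \<le> \<rho> m" using \<rho> that by (simp add: monoD)
    ultimately show ?thesis unfolding s_def by linarith
  qed
  have sep': "real (\<rho> n) + real (\<rho> m) < D (\<sigma> n L) (\<sigma> m L)" if "n \<noteq> m" for n m
  proof -
    have "\<sigma> n L \<in> carrier G" "\<sigma> m L \<in> carrier G" using seg[of n] seg[of m] by (auto simp: word_segment_def)
    then show ?thesis using sep[of n m] sep[of m n] that D_sym[of "\<sigma> n L" "\<sigma> m L"] by (cases "n < m") auto
  qed
  show thesis
    using that[of x t \<iota> \<sigma>] x t_mono gap strict_mono_mono[OF \<iota>_strict] strict_mono_imp_increasing[OF \<iota>_strict]
      close seg t_L pos sep' by blast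
qed

text \<open>The ends of the segment have heights \<open>t - L\<close> and \<open>t + L\<close>. At
  both, \<open>gp_separation\<close> bounds the product of \<open>y\<close> and \<open>z\<close> by
  \<open>3 * \<delta>\<close>, so by \<open>good_hit\<close> the geodesic passes within
  \<open>K\<close>, and \<open>geodesic_cut\<close> applies. The margins \<open>L\<close> in the
  assumptions on \<open>y\<close> and \<open>z\<close> serve this purpose.\<close>

lemma cut_vertex:
  assumes \<epsilon>: "0 < \<epsilon>" "exp (2 * \<epsilon> * \<delta>) \<le> 2"
    and \<omega>: "pos_weight \<omega>" and \<sigma>: "word_segment \<sigma> (2 * L)"
    and abc: "0 < a" "a \<le> a0" "a0 < b0" "b0 \<le> b1"
    and conforms: "\<And>e. e \<in> edges_in (nball (\<sigma> L) R) \<Longrightarrow> \<omega> e \<in> segment_config \<sigma> L a a0 b0 b1 e"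
    and K: "3 * \<delta> < real K" "exp (- \<epsilon> / 2) ^ K / (1 - exp (- \<epsilon> / 2)) < exp (- \<epsilon> * (3 * \<delta> + 1)) / 2"
    and N: "\<And>r. K \<le> r \<Longrightarrow> real (N r) \<le> exp (\<epsilon> * real r / 2)"
      "\<And>r. K \<le> r \<Longrightarrow> \<Lambda> * real r * (2 * real r) < c * real (N r)"
    and \<Lambda>: "0 \<le> \<Lambda>"
    and good: "\<And>r. K \<le> r \<Longrightarrow> good N c \<Lambda> \<omega> (\<sigma> 0) r" "\<And>r. K \<le> r \<Longrightarrow> good N c \<Lambda> \<omega> (\<sigma> (2 * L)) r"
    and KL: "K < L" "2 * real K * (b1 + b0) < (b0 - a0) * real L"
    and R: "2 * K + L \<le> R" "2 * b1 * real K + 2 * a0 * real L < a * (real R - real L - real K)"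
    and x: "x \<in> carrier G" and tL: "L \<le> t"
    and D\<sigma>: "\<And>i. i \<le> 2 * L \<Longrightarrow> D \<one> (\<sigma> i) = real (t - L + i) \<and> D (\<sigma> i) x = D \<one> x - real (t - L + i)"
    and yz: "y \<in> carrier G" "z \<in> carrier G" "gp \<one> y x + \<delta> + real L < real t" "real t + real L \<le> gp \<one> z x"
    and g: "fpp_geodesic G S \<omega> y z p"
  shows "\<sigma> L \<in> set p"
proof (rule geodesic_cut[OF \<omega> g \<sigma> abc conforms _ _ KL R])
  have c: "\<sigma> 0 \<in> carrier G" "\<sigma> (2 * L) \<in> carrier G" using \<sigma> by (auto simp: word_segment_def)
  have "gp (\<sigma> 0) y z \<le> 3 * \<delta>"
    by (rule gp_separation[OF x yz(1,2) c(1), where t = "real (t - L)"]) (use D\<sigma>[of 0] yz tL in auto)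
  then show "\<exists>u\<in>set p. D (\<sigma> 0) u < real K"
    using good_hit[OF \<epsilon> c(1) \<omega> g _ K N \<Lambda> good(1)] by blast
  have "gp (\<sigma> (2 * L)) y z \<le> 3 * \<delta>"
    by (rule gp_separation[OF x yz(1,2) c(2), where t = "real (t + L)"]) (use D\<sigma>[of "2 * L"] yz tL in auto)
  then show "\<exists>u\<in>set p. D (\<sigma> (2 * L)) u < real K"
    using good_hit[OF \<epsilon> c(2) \<omega> g _ K N \<Lambda> good(2)] by blast
qed

end

section \<open>Independent weights\<close>

locale iid_weights = prob_space \<mu> for \<mu> :: "real measure" +
  fixes E :: "'e set"
  assumes sets_mu: "sets \<mu> = sets (restrict_space borel {0..})"
    and atomless: "emeasure \<mu> {x} = 0"
    and E_ne: "E \<noteq> {}"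
begin

abbreviation "PM J \<equiv> PiM J (\<lambda>_. \<mu>)"

sublocale PP: product_prob_space "\<lambda>_. \<mu>" E
  by unfold_locales

lemma space_mu: "space \<mu> = {0..}"
  using sets_eq_imp_space_eq[OF sets_mu] by (simp add: space_restrict_space)

lemma borel_measurable_mu: "f \<in> borel_measurable borel \<Longrightarrow> f \<in> borel_measurable \<mu>"
  by (subst measurable_cong_sets[OF sets_mu refl]) (rule measurable_restrict_space1)

lemma coordinate_compose:
  assumes "e \<in> J" "f \<in> measurable \<mu> N"
  shows "(\<lambda>\<omega>. f (\<omega> e)) \<in> measurable (PM J) N"
proof -
  have "(\<lambda>\<omega>. \<omega> e) \<in> measurable (PM J) \<mu>" using assms(1) by (rule measurable_component_singleton)
  from measurable_compose[OF this assms(2)] show ?thesis .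
qed

lemma coordinate_measurable: "e \<in> J \<Longrightarrow> (\<lambda>\<omega>. \<omega> e) \<in> borel_measurable (PM J)"
  by (rule coordinate_compose[where f = "\<lambda>x. x"]) (auto intro: borel_measurable_mu)

lemma coordinate_sets:
  assumes "e \<in> J" "A \<in> sets borel"
  shows "{\<omega> \<in> space (PM J). \<omega> e \<in> A} \<in> sets (PM J)"
  using measurable_sets[OF coordinate_measurable[OF assms(1)] assms(2)]
  by (simp add: vimage_def Int_def conj_commute)

lemma mu_sets:
  assumes "A \<in> sets borel" shows "{x \<in> space \<mu>. x \<in> A} \<in> sets \<mu>"
  using measurable_sets[OF borel_measurable_mu[OF measurable_ident] assms]
  by (simp add: vimage_def Int_def conj_commute)

text \<open>The integrand depends on finitely many coordinates only, so the integral descends to a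
  finite product.\<close>

lemma nn_integral_prod_coordinates:
  assumes J: "finite J" "J \<subseteq> E" and f: "\<And>e. e \<in> J \<Longrightarrow> f e \<in> borel_measurable \<mu>"
  shows "(\<integral>\<^sup>+\<omega>. (\<Prod>e\<in>J. f e (\<omega> e)) \<partial>PM E) = (\<Prod>e\<in>J. \<integral>\<^sup>+x. f e x \<partial>\<mu>)"
proof -
  have m: "(\<lambda>\<omega>. \<Prod>e\<in>J. f e (\<omega> e)) \<in> borel_measurable (PM J)"
    by (intro borel_measurable_prod_ennreal coordinate_compose f)
  have "(\<integral>\<^sup>+\<omega>. (\<Prod>e\<in>J. f e (\<omega> e)) \<partial>PM E) = (\<integral>\<^sup>+\<omega>. (\<Prod>e\<in>J. f e (restrict \<omega> J e)) \<partial>PM E)"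
    by (intro nn_integral_cong prod.cong) auto
  also have "\<dots> = (\<integral>\<^sup>+\<omega>. (\<Prod>e\<in>J. f e (\<omega> e)) \<partial>distr (PM E) (PM J) (\<lambda>\<omega>. restrict \<omega> J))"
    by (subst nn_integral_distr[OF measurable_restrict_subset[OF J(2)]]) (use m in auto)
  also have "\<dots> = (\<integral>\<^sup>+\<omega>. (\<Prod>e\<in>J. f e (\<omega> e)) \<partial>PM J)"
    by (subst PP.distr_PiM_restrict_finite[OF J]) simp
  also have "\<dots> = (\<Prod>e\<in>J. \<integral>\<^sup>+x. f e x \<partial>\<mu>)"
    by (rule PP.product_nn_integral_prod) (use J f in auto)
  finally show ?thesis .
qed

definition conforms :: "'e set \<Rightarrow> ('e \<Rightarrow> real set) \<Rightarrow> ('e \<Rightarrow> real) \<Rightarrow> bool" where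
  "conforms F A \<omega> \<longleftrightarrow> (\<forall>e\<in>F. \<omega> e \<in> A e)"

lemma conforms_sets:
  assumes "finite F" "F \<subseteq> J" "\<And>e. A e \<in> sets borel"
  shows "{\<omega> \<in> space (PM J). conforms F A \<omega>} \<in> sets (PM J)"
  unfolding conforms_def by (intro sets.sets_Collect_finite_All coordinate_sets) (use assms in auto)

lemma emeasure_conforms:
  assumes F: "finite F" "F \<subseteq> E" and A: "\<And>e. A e \<in> sets borel"
  shows "emeasure (PM E) {\<omega> \<in> space (PM E). conforms F A \<omega>} = (\<Prod>e\<in>F. emeasure \<mu> {x \<in> space \<mu>. x \<in> A e})"
proof -
  have ind: "(\<lambda>x. indicator (A e) x :: ennreal) \<in> borel_measurable \<mu>" for e
    using A by (intro borel_measurable_mu) auto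
  have "emeasure (PM E) {\<omega> \<in> space (PM E). conforms F A \<omega>} = (\<integral>\<^sup>+\<omega>. indicator {\<omega> \<in> space (PM E). conforms F A \<omega>} \<omega> \<partial>PM E)"
    using conforms_sets[OF F A] by simp
  also have "\<dots> = (\<integral>\<^sup>+\<omega>. (\<Prod>e\<in>F. indicator (A e) (\<omega> e)) \<partial>PM E)"
    using F(1) by (intro nn_integral_cong) (auto simp: conforms_def indicator_def prod.neutral intro!: prod_zero)
  also have "\<dots> = (\<Prod>e\<in>F. \<integral>\<^sup>+x. indicator (A e) x \<partial>\<mu>)"
    by (rule nn_integral_prod_coordinates[OF F ind])
  also have "\<dots> = (\<Prod>e\<in>F. emeasure \<mu> {x \<in> space \<mu>. x \<in> A e})"
  proof (rule prod.cong[OF refl])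
    fix e
    have "(\<integral>\<^sup>+x. indicator (A e) x \<partial>\<mu>) = (\<integral>\<^sup>+x. indicator {x \<in> space \<mu>. x \<in> A e} x \<partial>\<mu>)"
      by (intro nn_integral_cong) (auto simp: indicator_def)
    then show "(\<integral>\<^sup>+x. indicator (A e) x \<partial>\<mu>) = emeasure \<mu> {x \<in> space \<mu>. x \<in> A e}"
      using mu_sets[OF A] by simp
  qed
  finally show ?thesis .
qed

lemma sum_measurable:
  assumes "finite F" "F \<subseteq> J"
  shows "(\<lambda>\<omega>. \<Sum>e\<in>F. \<omega> e) \<in> borel_measurable (PM J)"
  by (intro borel_measurable_sum coordinate_measurable) (use assms in auto)

text \<open>By the exponential Markov inequality; the constant 3 bounds \<open>exp 1\<close>.\<close>

lemma small_sum_bound: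
  assumes F: "finite F" "F \<subseteq> E" and A: "\<And>e. A e \<in> sets borel" and B: "finite B" "B \<subseteq> E"
    and l: "0 < l" and \<theta>: "0 \<le> \<theta>" "(\<integral>\<^sup>+x. ennreal (exp (- l * x)) \<partial>\<mu>) \<le> ennreal \<theta>"
    and FB: "\<And>e x. e \<in> F \<Longrightarrow> e \<in> B \<Longrightarrow> x \<in> A e \<Longrightarrow> exp (- l * x) \<le> \<theta>"
  shows "emeasure (PM E) {\<omega> \<in> space (PM E). conforms F A \<omega> \<and> (\<Sum>e\<in>B. \<omega> e) < 1 / l * real (card B)}
    \<le> emeasure (PM E) {\<omega> \<in> space (PM E). conforms F A \<omega>} * ennreal ((3 * \<theta>) ^ card B)"
proof -
  define X where "X = {\<omega> \<in> space (PM E). conforms F A \<omega> \<and> (\<Sum>e\<in>B. \<omega> e) < 1 / l * real (card B)}"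
  have X: "X \<in> sets (PM E)"
    unfolding X_def using conforms_sets[OF F A] sum_measurable[OF B]
    by (intro sets.sets_Collect_conj) (auto intro!: borel_measurable_less)
  \<comment> \<open>The integrand factors over the edges: an indicator for each prescribed edge, a
    Laplace factor for each edge of the sum.\<close>
  define f where "f e x = (if e \<in> F then indicator (A e) x else 1) * (if e \<in> B then ennreal (exp (- l * x)) else 1)"
    for e x
  define pr where "pr e = emeasure \<mu> {x \<in> space \<mu>. x \<in> A e}" for e
  define g where "g e = (if e \<in> F then pr e else 1) * (if e \<in> B then ennreal \<theta> else 1)" for e
  have fm: "f e \<in> borel_measurable \<mu>" for e unfolding f_def using A by (intro borel_measurable_mu) auto
  have fin: "finite (F \<union> B)" "F \<union> B \<subseteq> E" using F B by auto
  \<comment> \<open>On an edge that is both prescribed and summed, the Laplace factor is at most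
    \<theta> pointwise on \<open>A e\<close>; this is why conditioning does not weaken the
    bound.\<close>
  have fg: "(\<integral>\<^sup>+x. f e x \<partial>\<mu>) \<le> g e" for e
  proof (cases "e \<in> F")
    case True
    have "(\<integral>\<^sup>+x. f e x \<partial>\<mu>) \<le> (\<integral>\<^sup>+x. (if e \<in> B then ennreal \<theta> else 1) * indicator {x \<in> space \<mu>. x \<in> A e} x \<partial>\<mu>)"
    proof (rule nn_integral_mono)
      fix x assume "x \<in> space \<mu>"
      then show "f e x \<le> (if e \<in> B then ennreal \<theta> else 1) * indicator {x \<in> space \<mu>. x \<in> A e} x"
        using True FB[of e x] by (auto simp: f_def indicator_def intro!: ennreal_leI)
    qed
    also have "\<dots> = g e"
      using True mu_sets[OF A, of e] by (simp add: g_def pr_def nn_integral_cmult mult.commute)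
    finally show ?thesis .
  next
    case False
    then show ?thesis using \<theta> by (auto simp: f_def g_def emeasure_space_1)
  qed
  have "emeasure (PM E) X = (\<integral>\<^sup>+\<omega>. indicator X \<omega> \<partial>PM E)" using X by simp
  also have "\<dots> \<le> (\<integral>\<^sup>+\<omega>. ennreal (3 ^ card B) * (\<Prod>e\<in>F \<union> B. f e (\<omega> e)) \<partial>PM E)"
  proof (rule nn_integral_mono)
    fix \<omega> assume "\<omega> \<in> space (PM E)"
    show "indicator X \<omega> \<le> ennreal (3 ^ card B) * (\<Prod>e\<in>F \<union> B. f e (\<omega> e))"
    proof (cases "\<omega> \<in> X")
      case True
      have "(\<Prod>e\<in>F \<union> B. f e (\<omega> e)) = (\<Prod>e\<in>F \<union> B. if e \<in> B then ennreal (exp (- l * \<omega> e)) else 1)"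
        using True by (intro prod.cong) (auto simp: f_def X_def conforms_def)
      also have "\<dots> = (\<Prod>e\<in>B. ennreal (exp (- l * \<omega> e)))"
        using fin by (subst prod.inter_restrict[symmetric]) (auto intro!: arg_cong2[where f=prod])
      also have "\<dots> = ennreal (exp (- l * (\<Sum>e\<in>B. \<omega> e)))"
        using B by (simp add: prod_ennreal exp_sum sum_distrib_left)
      finally have eq: "(\<Prod>e\<in>F \<union> B. f e (\<omega> e)) = ennreal (exp (- l * (\<Sum>e\<in>B. \<omega> e)))" .
      have "l * (\<Sum>e\<in>B. \<omega> e) \<le> real (card B)" using True l by (simp add: X_def field_simps)
      then have "exp (- real (card B)) \<le> exp (- l * (\<Sum>e\<in>B. \<omega> e))" by simp
      then have "3 ^ card B * exp (- real (card B)) \<le> 3 ^ card B * exp (- l * (\<Sum>e\<in>B. \<omega> e))"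
        by (intro mult_left_mono) auto
      moreover have "1 \<le> 3 ^ card B * exp (- real (card B))"
      proof -
        have "exp (real (card B)) = exp 1 ^ card B" by (simp add: exp_of_nat_mult[symmetric])
        also have "\<dots> \<le> 3 ^ card B" using exp_le by (intro power_mono) auto
        finally show ?thesis by (simp add: exp_minus field_simps)
      qed
      ultimately have "1 \<le> 3 ^ card B * exp (- l * (\<Sum>e\<in>B. \<omega> e))" by linarith
      then have "1 \<le> ennreal (3 ^ card B * exp (- l * (\<Sum>e\<in>B. \<omega> e)))" by (simp add: ennreal_ge_1)
      then show ?thesis using True unfolding eq by (simp add: ennreal_mult)
    qed simp
  qed
  also have "\<dots> = ennreal (3 ^ card B) * (\<Prod>e\<in>F \<union> B. \<integral>\<^sup>+x. f e x \<partial>\<mu>)"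
    using fin fm
    by (subst nn_integral_cmult)
      (auto intro!: borel_measurable_prod_ennreal coordinate_compose
        simp: nn_integral_prod_coordinates)
  also have "\<dots> \<le> ennreal (3 ^ card B) * (\<Prod>e\<in>F \<union> B. g e)"
    using fg by (intro mult_left_mono prod_mono_ennreal) auto
  also have "(\<Prod>e\<in>F \<union> B. g e) = (\<Prod>e\<in>F. pr e) * ennreal \<theta> ^ card B"
  proof -
    have "(\<Prod>e\<in>F \<union> B. if e \<in> F then pr e else 1) = (\<Prod>e\<in>F. pr e)"
      using fin by (subst prod.inter_restrict[symmetric]) (auto intro!: arg_cong2[where f=prod])
    moreover have "(\<Prod>e\<in>F \<union> B. if e \<in> B then ennreal \<theta> else 1) = (\<Prod>e\<in>B. ennreal \<theta>)"
      using fin by (subst prod.inter_restrict[symmetric]) (auto intro!: arg_cong2[where f=prod])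
    ultimately show ?thesis unfolding g_def by (simp add: prod.distrib)
  qed
  also have "ennreal (3 ^ card B) * ((\<Prod>e\<in>F. pr e) * ennreal \<theta> ^ card B)
      = (\<Prod>e\<in>F. pr e) * ennreal ((3 * \<theta>) ^ card B)"
    using \<theta>(1) by (simp add: ennreal_power power_mult_distrib ennreal_mult mult_ac)
  also have "(\<Prod>e\<in>F. pr e) = emeasure (PM E) {\<omega> \<in> space (PM E). conforms F A \<omega>}"
    unfolding pr_def by (rule emeasure_conforms[OF F A, symmetric])
  finally show ?thesis unfolding X_def .
qed

text \<open>An edge that is not prescribed is independent of the configuration; for a prescribed one
  the event is impossible.\<close>

lemma large_coordinate_bound:
  assumes F: "finite F" "F \<subseteq> E" and A: "\<And>e. A e \<in> sets borel" and f: "f \<in> E"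
    and \<tau>: "emeasure \<mu> {x \<in> space \<mu>. X < x} \<le> \<tau>"
    and FX: "f \<in> F \<Longrightarrow> A f \<subseteq> {..X}"
  shows "emeasure (PM E) {\<omega> \<in> space (PM E). conforms F A \<omega> \<and> X < \<omega> f}
    \<le> emeasure (PM E) {\<omega> \<in> space (PM E). conforms F A \<omega>} * \<tau>"
proof (cases "f \<in> F")
  case True
  then have "{\<omega> \<in> space (PM E). conforms F A \<omega> \<and> X < \<omega> f} = {}"
    using FX by (force simp: conforms_def)
  then show ?thesis by (simp only: emeasure_empty) simp
next
  case False
  define A' where "A' = A(f := {X<..})"
  have A': "A' e \<in> sets borel" for e using A by (simp add: A'_def)
  have "{\<omega> \<in> space (PM E). conforms F A \<omega> \<and> X < \<omega> f} = {\<omega> \<in> space (PM E). conforms (insert f F) A' \<omega>}"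
    using False by (auto simp: conforms_def A'_def)
  also have "emeasure (PM E) \<dots> = (\<Prod>e\<in>insert f F. emeasure \<mu> {x \<in> space \<mu>. x \<in> A' e})"
    using F f A' by (intro emeasure_conforms) auto
  also have "\<dots> = emeasure \<mu> {x \<in> space \<mu>. X < x} * (\<Prod>e\<in>F. emeasure \<mu> {x \<in> space \<mu>. x \<in> A' e})"
    using F False by (simp add: A'_def)
  also have "(\<Prod>e\<in>F. emeasure \<mu> {x \<in> space \<mu>. x \<in> A' e}) = (\<Prod>e\<in>F. emeasure \<mu> {x \<in> space \<mu>. x \<in> A e})"
    using False by (intro prod.cong) (auto simp: A'_def)
  also have "\<dots> = emeasure (PM E) {\<omega> \<in> space (PM E). conforms F A \<omega>}" by (rule emeasure_conforms[OF F A, symmetric])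
  finally show ?thesis using mult_right_mono[OF \<tau>, of "emeasure (PM E) {\<omega> \<in> space (PM E). conforms F A \<omega>}"]
    by (simp add: mult.commute)
qed

text \<open>Let \<open>e\<close> belong to only one of the sets. With all other weights fixed,
  equality determines the weight of \<open>e\<close>, and single values have probability 0; Fubini
  concludes.\<close>

lemma AE_sums_differ:
  assumes B: "finite B" "B \<subseteq> E" and C: "finite C" "C \<subseteq> E" and ne: "B \<noteq> C"
  shows "AE \<omega> in PM E. (\<Sum>e\<in>B. \<omega> e) \<noteq> (\<Sum>e\<in>C. \<omega> e)"
proof -
  have *: "AE \<omega> in PM E. (\<Sum>e\<in>B. \<omega> e) \<noteq> (\<Sum>e\<in>C. \<omega> e)"
    if B: "finite B" "B \<subseteq> E" and C: "finite C" "C \<subseteq> E" and e: "e \<in> B" "e \<notin> C" for B C e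
  proof -
    define J where "J = B \<union> C - {e}"
    have J: "finite J" "e \<notin> J" "insert e J = B \<union> C" "B - {e} \<subseteq> J" "C \<subseteq> J" "insert e J \<subseteq> E"
      using that by (auto simp: J_def)
    define Z where "Z = {\<omega> \<in> space (PM (insert e J)). (\<Sum>e\<in>B. \<omega> e) = (\<Sum>e\<in>C. \<omega> e)}"
    have Z: "Z \<in> sets (PM (insert e J))"
      unfolding Z_def using sum_measurable[OF B(1), of "insert e J"] sum_measurable[OF C(1), of "insert e J"] J(3)
      by (intro borel_measurable_eq) auto
    have "emeasure (PM (insert e J)) Z = (\<integral>\<^sup>+\<omega>. indicator Z \<omega> \<partial>PM (insert e J))" using Z by simp
    also have "\<dots> = (\<integral>\<^sup>+x. (\<integral>\<^sup>+y. indicator Z (x(e := y)) \<partial>\<mu>) \<partial>PM J)"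
      using Z J by (intro PP.product_nn_integral_insert) auto
    also have "\<dots> = (\<integral>\<^sup>+x. 0 \<partial>PM J)"
    proof (rule nn_integral_cong)
      fix x assume "x \<in> space (PM J)"
      define c where "c = (\<Sum>e\<in>C. x e) - (\<Sum>e\<in>B - {e}. x e)"
      have "(\<integral>\<^sup>+y. indicator Z (x(e := y)) \<partial>\<mu>) \<le> (\<integral>\<^sup>+y. indicator {c} y \<partial>\<mu>)"
      proof (rule nn_integral_mono)
        fix y
        have "(\<Sum>i\<in>B. (x(e := y)) i) = y + (\<Sum>i\<in>B - {e}. x i)"
          using B(1) e(1) by (subst sum.remove[of _ e]) auto
        moreover have "(\<Sum>i\<in>C. (x(e := y)) i) = (\<Sum>i\<in>C. x i)"
          using e(2) by (intro sum.cong) auto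
        ultimately show "indicator Z (x(e := y)) \<le> (indicator {c} y :: ennreal)"
          by (auto simp: Z_def c_def indicator_def)
      qed
      also have "\<dots> = (\<integral>\<^sup>+y. indicator {z \<in> space \<mu>. z \<in> {c}} y \<partial>\<mu>)"
        by (intro nn_integral_cong) (auto simp: indicator_def)
      also have "\<dots> = emeasure \<mu> {z \<in> space \<mu>. z \<in> {c}}" by (intro nn_integral_indicator mu_sets) auto
      also have "\<dots> = 0"
      proof (cases "c \<in> space \<mu>")
        case True
        then have "{z \<in> space \<mu>. z \<in> {c}} = {c}" by auto
        then show ?thesis using atomless by simp
      next
        case False
        then have "{z \<in> space \<mu>. z \<in> {c}} = {}" by auto
        then show ?thesis by (simp only: emeasure_empty)
      qed
      finally show "(\<integral>\<^sup>+y. indicator Z (x(e := y)) \<partial>\<mu>) = 0" by simp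
    qed
    finally have "emeasure (PM (insert e J)) Z = 0" by simp
    then have "AE \<omega> in PM (insert e J). (\<Sum>e\<in>B. \<omega> e) \<noteq> (\<Sum>e\<in>C. \<omega> e)"
      using Z unfolding Z_def by (subst AE_iff_measurable) auto
    then have "AE \<omega> in distr (PM E) (PM (insert e J)) (\<lambda>\<omega>. restrict \<omega> (insert e J)). (\<Sum>e\<in>B. \<omega> e) \<noteq> (\<Sum>e\<in>C. \<omega> e)"
      by (subst PP.distr_PiM_restrict_finite[OF finite.insertI[OF J(1)] J(6)])
    then have "AE \<omega> in PM E. (\<Sum>i\<in>B. restrict \<omega> (insert e J) i) \<noteq> (\<Sum>i\<in>C. restrict \<omega> (insert e J) i)"
      by (rule AE_distrD[OF measurable_restrict_subset[OF J(6)]])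
    moreover have "(\<Sum>i\<in>B. restrict \<omega> (insert e J) i) = (\<Sum>i\<in>B. \<omega> i)" "(\<Sum>i\<in>C. restrict \<omega> (insert e J) i) = (\<Sum>i\<in>C. \<omega> i)" for \<omega> :: "'e \<Rightarrow> real"
      by (intro sum.cong; use J(3) in auto)+
    ultimately show ?thesis by (simp only:)
  qed
  obtain e where "e \<in> B \<and> e \<notin> C \<or> e \<in> C \<and> e \<notin> B" using ne by blast
  then show ?thesis
  proof
    assume "e \<in> C \<and> e \<notin> B"
    then have "AE \<omega> in PM E. (\<Sum>e\<in>C. \<omega> e) \<noteq> (\<Sum>e\<in>B. \<omega> e)" using *[OF C B] by blast
    then show ?thesis by (rule AE_mp) auto
  qed (use *[OF B C] in blast)
qed

lemma AE_positive: "e \<in> E \<Longrightarrow> AE \<omega> in PM E. 0 < \<omega> e"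
proof (rule AE_PiM_component[OF prob_space_axioms])
  have "{z \<in> space \<mu>. z \<in> {0}} = {0}" using space_mu by auto
  moreover from this have "{0} \<in> sets \<mu>" using mu_sets[of "{0}"] by simp
  ultimately have "AE x in \<mu>. x \<notin> {0}" using atomless[of 0] by (intro AE_not_in) (simp add: null_sets_def)
  then show "AE x in \<mu>. 0 < x" by (rule AE_mp) (auto simp: space_mu)
qed

lemma indep_coordinates: "PP.indep_vars (\<lambda>_. \<mu>) (\<lambda>e \<omega>. \<omega> e) E"
proof (subst PP.indep_vars_iff_distr_eq_PiM'[OF E_ne])
  have "distr (PM E) (PM E) (\<lambda>x. \<lambda>i\<in>E. x i) = distr (PM E) (PM E) (\<lambda>x. x)"
    by (rule distr_cong) (auto simp: space_PiM PiE_restrict)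
  also have "\<dots> = PM E" by (rule distr_id)
  also have "\<dots> = PiM E (\<lambda>i. distr (PM E) \<mu> (\<lambda>x. x i))"
    by (rule PiM_cong) (auto simp: PP.PiM_component)
  finally show "distr (PM E) (PM E) (\<lambda>x. \<lambda>i\<in>E. x i) = PiM E (\<lambda>i. distr (PM E) \<mu> (\<lambda>x. x i))" .
qed auto

text \<open>Events on disjoint sets of coordinates are independent, so the probability that none of
  \<open>Suc k\<close> consecutive ones occurs is at most \<open>(1 - p) ^ Suc k\<close>.\<close>

lemma local_events_infinitely_often:
  fixes Q :: "nat \<Rightarrow> ('e \<Rightarrow> real) \<Rightarrow> bool"
  assumes F: "\<And>n. F n \<subseteq> E" "disjoint_family F" and B: "\<And>n. B n \<in> sets (PM (F n))"
    and Q: "\<And>n \<omega>. \<omega> \<in> space (PM E) \<Longrightarrow> Q n \<omega> \<longleftrightarrow> restrict \<omega> (F n) \<in> B n"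
    and p: "0 < p" "\<And>n. p \<le> measure (PM E) {\<omega> \<in> space (PM E). Q n \<omega>}"
  shows "AE \<omega> in PM E. infinite {n. Q n \<omega>}"
proof -
  have rm: "(\<lambda>\<omega>. restrict \<omega> (F n)) \<in> measurable (PM E) (PM (F n))" for n
    by (rule measurable_restrict_subset[OF F(1)])
  have ind: "PP.indep_vars (\<lambda>n. PM (F n)) (\<lambda>n \<omega>. restrict (\<lambda>i. \<omega> i) (F n)) UNIV"
    by (rule PP.indep_vars_restrict[OF indep_coordinates F])
  define C where "C n = space (PM (F n)) - B n" for n
  have C: "C n \<in> sets (PM (F n))" for n using B by (simp add: C_def)
  define Y where "Y n = {\<omega> \<in> space (PM E). \<not> Q n \<omega>}" for n
  have YC: "Y n = (\<lambda>\<omega>. restrict \<omega> (F n)) -` C n \<inter> space (PM E)" for n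
    using Q measurable_space[OF rm] by (auto simp: Y_def C_def)
  have Y: "Y n \<in> sets (PM E)" for n unfolding YC using measurable_sets[OF rm C] .
  have XY: "{\<omega> \<in> space (PM E). Q n \<omega>} = space (PM E) - Y n" for n by (auto simp: Y_def)
  have pY: "measure (PM E) (Y n) \<le> 1 - p" for n
    using p(2)[of n] unfolding XY PP.prob_compl[OF Y] by simp
  have p1: "p \<le> 1" using p(2)[of 0] PP.prob_le_1 order_trans by blast
  have prod: "measure (PM E) (\<Inter>n\<in>{m..m + k}. Y n) \<le> (1 - p) ^ Suc k" for m k
  proof -
    have "measure (PM E) (\<Inter>n\<in>{m..m + k}. Y n) = (\<Prod>n\<in>{m..m + k}. measure (PM E) (Y n))"
      unfolding YC using PP.indep_varsD[OF ind, of "{m..m + k}" C] C by auto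
    also have "\<dots> \<le> (\<Prod>n\<in>{m..m + k}. 1 - p)" using pY by (intro prod_mono) auto
    finally show ?thesis by simp
  qed
  have "AE \<omega> in PM E. \<exists>n\<ge>m. Q n \<omega>" for m
  proof -
    define Z where "Z = (\<Inter>n\<in>{m..}. Y n)"
    have Z: "Z \<in> sets (PM E)" unfolding Z_def using Y by (intro sets.countable_INT') auto
    have "measure (PM E) Z \<le> (1 - p) ^ Suc k" for k
    proof -
      have "measure (PM E) Z \<le> measure (PM E) (\<Inter>n\<in>{m..m + k}. Y n)"
        using Y by (intro PP.finite_measure_mono sets.finite_INT) (auto simp: Z_def)
      then show ?thesis using prod[of m k] by simp
    qed
    moreover have "(\<lambda>k. (1 - p) ^ Suc k) \<longlonglongrightarrow> 0"
      using p(1) p1 by (intro LIMSEQ_Suc LIMSEQ_power_zero) auto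
    ultimately have "measure (PM E) Z \<le> 0" by (intro LIMSEQ_le_const) auto
    then have "Z \<in> null_sets (PM E)"
      using Z by (auto simp: null_sets_def PP.emeasure_eq_measure measure_le_0_iff)
    then have "AE \<omega> in PM E. \<omega> \<notin> Z" by (rule AE_not_in)
    then show ?thesis
      by (rule AE_mp) (rule AE_I2, auto simp: Z_def Y_def)
  qed
  then have "AE \<omega> in PM E. \<forall>m. \<exists>n\<ge>m. Q n \<omega>" by (subst AE_all_countable) auto
  then show ?thesis by (rule AE_mp) (auto simp: infinite_nat_iff_unbounded_le)
qed

end

section \<open>First passage percolation on a hyperbolic Cayley graph\<close>

locale fpp_setting = hyperbolic_cayley_graph G S \<delta> + iid_weights \<mu> "cayley_edges G S"
  for G (structure) and S \<delta> \<mu>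
begin

abbreviation "P \<equiv> measure (PM E)"

lemma edges_in_subset: "edges_in V \<subseteq> E"
  by (auto simp: edges_in_def)

lemma good_sets:
  assumes w: "w \<in> carrier G" and J: "edges_in (nball w (3 * r)) \<subseteq> J" "edges_in (nball w (r + N r)) \<subseteq> J"
  shows "{\<omega> \<in> space (PM J). good N c \<Lambda> \<omega> w r} \<in> sets (PM J)"
proof -
  have imp: "{\<omega> \<in> space (PM J). b \<longrightarrow> Q \<omega>} \<in> sets (PM J)"
    if "b \<Longrightarrow> {\<omega> \<in> space (PM J). Q \<omega>} \<in> sets (PM J)" for b Q
    using that by (cases b) auto
  show ?thesis
    unfolding good_def
  proof (intro sets.sets_Collect_conj sets.sets_Collect_finite_All imp finite_nball[OF w] finite_paths_from)
    fix u v assume uv: "u \<in> nball w (3 * r)" "v \<in> nball w (3 * r)" "{u, v} \<in> E"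
    then have "{u, v} \<in> J" using J(1) by (auto simp: edges_in_def)
    from coordinate_sets[OF this, of "{..\<Lambda> * real r}"]
    show "{\<omega> \<in> space (PM J). \<omega> {u, v} \<le> \<Lambda> * real r} \<in> sets (PM J)" by simp
  next
    fix x p assume p: "x \<in> nball w r" "p \<in> paths_from x (N r)" "distinct p"
    have "path_edges p \<subseteq> J" using path_stays_in_ball[OF w p(2,1)] J(2) by blast
    from sum_measurable[OF finite_path_edges this]
    show "{\<omega> \<in> space (PM J). c * real (N r) \<le> path_length \<omega> p} \<in> sets (PM J)"
      unfolding path_length_eq_sum[OF p(3)] by (intro borel_measurable_le) auto
  qed
qed

text \<open>Union bound, with \<open>d = Suc (card S)\<close>. At most \<open>d ^ (6 * r)\<close>
  edges lie in the ball of radius \<open>3 * r\<close>, and the tail bound beats this number by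
  \<open>16 ^ r\<close>. At most \<open>d ^ r * d ^ N r\<close> paths occur, each too short with
  probability at most \<open>(3 * \<theta>) ^ N r\<close>; since \<open>48 = 3 * 16\<close>, they
  too contribute at most \<open>(1 / 16) ^ r\<close>. All this is relative to the probability of the
  prescribed configuration.\<close>

lemma bad_bound:
  assumes w: "w \<in> carrier G" and F: "finite F" "F \<subseteq> E" and A: "\<And>e. A e \<in> sets borel"
    and l: "0 < l" and \<theta>: "0 \<le> \<theta>" "(\<integral>\<^sup>+x. ennreal (exp (- l * x)) \<partial>\<mu>) \<le> ennreal \<theta>"
    and \<theta>D: "48 * \<theta> * real (Suc (card S)) ^ 2 \<le> 1"
    and tail: "emeasure \<mu> {x \<in> space \<mu>. \<Lambda> * real r < x} \<le> ennreal ((1 / (16 * real (Suc (card S)) ^ 6)) ^ r)"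
    and r: "1 \<le> r" "r \<le> N r"
    and FA: "\<And>e. e \<in> F \<Longrightarrow> A e \<subseteq> {..\<Lambda> * real r}" "\<And>e x. e \<in> F \<Longrightarrow> x \<in> A e \<Longrightarrow> exp (- l * x) \<le> \<theta>"
  shows "P {\<omega> \<in> space (PM E). conforms F A \<omega> \<and> \<not> good N (1 / l) \<Lambda> \<omega> w r}
    \<le> P {\<omega> \<in> space (PM E). conforms F A \<omega>} * (1 / 8) ^ r"
proof -
  define d where "d = real (Suc (card S))"
  have d: "1 \<le> d" by (simp add: d_def)
  define C where "C = P {\<omega> \<in> space (PM E). conforms F A \<omega>}"
  define U1 where "U1 f = {\<omega> \<in> space (PM E). conforms F A \<omega> \<and> \<Lambda> * real r < \<omega> f}" for f
  define U2 where "U2 B = {\<omega> \<in> space (PM E). conforms F A \<omega> \<and> (\<Sum>e\<in>B. \<omega> e) < 1 / l * real (card B)}" for B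
  define P1 where "P1 = {f \<in> (\<lambda>(u, v). {u, v}) ` (nball w (3 * r) \<times> nball w (3 * r)). f \<in> E}"
  define P2 where "P2 = path_edges ` {p \<in> \<Union>x\<in>nball w r. paths_from x (N r). distinct p}"
  have fin: "finite P1" "finite P2"
    by (auto simp: P1_def P2_def finite_nball[OF w] finite_paths_from)
  have cb: "real (card (nball w k)) \<le> d ^ k" for k
    using card_nball[OF w, of k] unfolding d_def by (metis of_nat_le_iff of_nat_power)
  have c1: "real (card P1) \<le> (d ^ 6) ^ r"
  proof -
    have "card P1 \<le> card ((\<lambda>(u, v). {u, v}) ` (nball w (3 * r) \<times> nball w (3 * r)))"
      unfolding P1_def by (intro card_mono finite_imageI finite_cartesian_product finite_nball w) auto
    also have "\<dots> \<le> card (nball w (3 * r) \<times> nball w (3 * r))"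
      by (intro card_image_le finite_cartesian_product finite_nball w)
    also have "\<dots> = card (nball w (3 * r)) * card (nball w (3 * r))" by (rule card_cartesian_product)
    finally have "real (card P1) \<le> real (card (nball w (3 * r))) * real (card (nball w (3 * r)))"
      by (metis of_nat_le_iff of_nat_mult)
    also have "\<dots> \<le> d ^ (3 * r) * d ^ (3 * r)" using cb d by (intro mult_mono) auto
    also have "\<dots> = (d ^ 6) ^ r" by (simp add: power_add[symmetric] power_mult[symmetric])
    finally show ?thesis .
  qed
  have c2: "real (card P2) \<le> (d ^ 2) ^ N r"
  proof -
    have "card P2 \<le> card {p \<in> \<Union>x\<in>nball w r. paths_from x (N r). distinct p}"
      unfolding P2_def by (intro card_image_le) (auto simp: finite_nball[OF w] finite_paths_from)
    also have "\<dots> \<le> card (\<Union>x\<in>nball w r. paths_from x (N r))"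
      by (intro card_mono) (auto simp: finite_nball[OF w] finite_paths_from)
    also have "\<dots> \<le> (\<Sum>x\<in>nball w r. card (paths_from x (N r)))" by (intro card_UN_le finite_nball w)
    also have "\<dots> \<le> of_nat (card (nball w r)) * card S ^ N r" by (intro sum_bounded_above card_paths_from)
    finally have "real (card P2) \<le> real (card (nball w r)) * real (card S) ^ N r"
      by (metis of_nat_id of_nat_le_iff of_nat_mult of_nat_power)
    also have "\<dots> \<le> d ^ N r * d ^ N r"
    proof (intro mult_mono)
      show "real (card (nball w r)) \<le> d ^ N r" using cb[of r] power_increasing[OF r(2) d] by linarith
      show "real (card S) ^ N r \<le> d ^ N r" by (intro power_mono) (auto simp: d_def)
    qed (use d in auto)
    finally show ?thesis by (simp add: power_add[symmetric] power_mult[symmetric] mult_2)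
  qed
  have P2E: "B \<subseteq> E" "finite B" "card B = N r" if "B \<in> P2" for B
  proof -
    obtain p x where p: "B = path_edges p" "p \<in> paths_from x (N r)" "distinct p" using \<open>B \<in> P2\<close> by (auto simp: P2_def)
    then show "B \<subseteq> E" "finite B" "card B = N r"
      using path_edges_subset[of p] finite_path_edges[of p] card_path_edges[OF p(3)] by (auto simp: paths_from_def)
  qed
  have m1: "U1 f \<in> sets (PM E)" if "f \<in> P1" for f
    using that conforms_sets[OF F A] coordinate_sets[of f E "{\<Lambda> * real r<..}"] unfolding U1_def
    by (intro sets.sets_Collect_conj) (auto simp: P1_def)
  have m2: "U2 B \<in> sets (PM E)" if "B \<in> P2" for B
    using conforms_sets[OF F A] sum_measurable[OF P2E(2,1)[OF that]] unfolding U2_def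
    by (intro sets.sets_Collect_conj borel_measurable_less) auto
  have b1: "P (U1 f) \<le> C * (1 / (16 * d ^ 6)) ^ r" if "f \<in> P1" for f
  proof -
    have "emeasure (PM E) (U1 f) \<le> emeasure (PM E) {\<omega> \<in> space (PM E). conforms F A \<omega>} * ennreal ((1 / (16 * d ^ 6)) ^ r)"
      unfolding U1_def using that tail FA by (intro large_coordinate_bound[OF F A]) (auto simp: P1_def d_def)
    then show ?thesis using d by (simp add: PP.emeasure_eq_measure C_def ennreal_mult[symmetric] del: times_divide_eq_left)
  qed
  have b2: "P (U2 B) \<le> C * (3 * \<theta>) ^ N r" if "B \<in> P2" for B
  proof -
    have "emeasure (PM E) (U2 B) \<le> emeasure (PM E) {\<omega> \<in> space (PM E). conforms F A \<omega>} * ennreal ((3 * \<theta>) ^ card B)"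
      unfolding U2_def using FA by (intro small_sum_bound[OF F A P2E(2,1)[OF that] l \<theta>]) auto
    then show ?thesis using \<theta>(1) by (simp add: PP.emeasure_eq_measure C_def ennreal_mult[symmetric] P2E(3)[OF that])
  qed
  have Cnn: "0 \<le> C" by (simp add: C_def)
  have "{\<omega> \<in> space (PM E). conforms F A \<omega> \<and> \<not> good N (1 / l) \<Lambda> \<omega> w r} \<subseteq> (\<Union>f\<in>P1. U1 f) \<union> (\<Union>B\<in>P2. U2 B)"
  proof
    fix \<omega> assume \<omega>: "\<omega> \<in> {\<omega> \<in> space (PM E). conforms F A \<omega> \<and> \<not> good N (1 / l) \<Lambda> \<omega> w r}"
    then consider u v where "u \<in> nball w (3 * r)" "v \<in> nball w (3 * r)" "{u, v} \<in> E" "\<Lambda> * real r < \<omega> {u, v}"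
      | x p where "x \<in> nball w r" "p \<in> paths_from x (N r)" "distinct p" "path_length \<omega> p < 1 / l * real (N r)"
      unfolding good_def by (auto simp: not_le)
    then show "\<omega> \<in> (\<Union>f\<in>P1. U1 f) \<union> (\<Union>B\<in>P2. U2 B)"
    proof cases
      case 1
      then have "{u, v} \<in> P1" "\<omega> \<in> U1 {u, v}" using \<omega> by (auto simp: P1_def U1_def)
      then show ?thesis by blast
    next
      case 2
      then have B: "path_edges p \<in> P2" by (auto simp: P2_def)
      then have "\<omega> \<in> U2 (path_edges p)"
        using 2 \<omega> P2E(3)[OF B] path_length_eq_sum[OF 2(3), of \<omega>] by (simp add: U2_def)
      then show ?thesis using B by blast
    qed
  qed
  then have "P {\<omega> \<in> space (PM E). conforms F A \<omega> \<and> \<not> good N (1 / l) \<Lambda> \<omega> w r} \<le> P ((\<Union>f\<in>P1. U1 f) \<union> (\<Union>B\<in>P2. U2 B))"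
    using m1 m2 fin by (intro PP.finite_measure_mono sets.Un sets.finite_UN) auto
  also have "\<dots> \<le> P (\<Union>f\<in>P1. U1 f) + P (\<Union>B\<in>P2. U2 B)"
    using m1 m2 fin by (intro measure_Un_le sets.finite_UN) auto
  also have "\<dots> \<le> (\<Sum>f\<in>P1. P (U1 f)) + (\<Sum>B\<in>P2. P (U2 B))"
    using m1 m2 fin by (intro add_mono PP.finite_measure_subadditive_finite) auto
  also have "\<dots> \<le> real (card P1) * (C * (1 / (16 * d ^ 6)) ^ r) + real (card P2) * (C * (3 * \<theta>) ^ N r)"
    using b1 b2 by (intro add_mono sum_bounded_above) auto
  also have "\<dots> \<le> (d ^ 6) ^ r * (C * (1 / (16 * d ^ 6)) ^ r) + (d ^ 2) ^ N r * (C * (3 * \<theta>) ^ N r)"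
    using c1 c2 Cnn d \<theta>(1) by (intro add_mono mult_right_mono) auto
  also have "\<dots> = C * (1 / 16) ^ r + C * (3 * \<theta> * d ^ 2) ^ N r"
    using d by (simp add: power_mult_distrib power_divide field_simps)
  also have "\<dots> \<le> C * (1 / 16) ^ r + C * (1 / 16) ^ N r"
    using \<theta>D \<theta>(1) Cnn by (intro add_left_mono mult_left_mono power_mono) (auto simp: d_def)
  also have "\<dots> \<le> C * (1 / 16) ^ r + C * (1 / 16) ^ r"
    using r Cnn by (intro add_left_mono mult_left_mono power_decreasing) auto
  also have "\<dots> \<le> C * (1 / 8) ^ r"
  proof -
    have "(1 / 2) ^ r \<le> (1 / 2 :: real) ^ 1" using r by (intro power_decreasing) auto
    then have "(1 / 8) ^ r * (1 / 2) ^ r \<le> (1 / 8 :: real) ^ r * (1 / 2)" by (intro mult_left_mono) auto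
    then have "2 * (1 / 16 :: real) ^ r \<le> (1 / 8) ^ r" by (simp add: power_mult_distrib[symmetric])
    then show ?thesis using Cnn mult_left_mono[of "2 * (1 / 16) ^ r" "(1 / 8) ^ r" C] by simp
  qed
  finally show ?thesis by (simp add: C_def)
qed

lemma AE_weights: "AE \<omega> in PM E. pos_weight \<omega> \<and> generic \<omega>"
proof -
  have pos: "AE \<omega> in PM E. \<forall>e\<in>E. 0 < \<omega> e"
    using AE_positive by (subst AE_ball_countable[OF countable_edges]) auto
  define FS where "FS = {B. finite B \<and> B \<subseteq> E}"
  have FS: "countable FS" unfolding FS_def by (rule countable_Collect_finite_subset[OF countable_edges])
  have "AE \<omega> in PM E. \<forall>B\<in>FS. \<forall>C\<in>FS. B \<noteq> C \<longrightarrow> (\<Sum>e\<in>B. \<omega> e) \<noteq> (\<Sum>e\<in>C. \<omega> e)"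
    by (intro AE_ball_countable[OF FS, THEN iffD2] ballI AE_impI AE_sums_differ) (auto simp: FS_def)
  then show ?thesis using pos
  proof eventually_elim
    case (elim \<omega>)
    have "generic \<omega>"
      unfolding generic_def
    proof (intro allI impI)
      fix p q assume pq: "edge_path G S p \<and> distinct p \<and> edge_path G S q \<and> distinct q \<and> path_edges p \<noteq> path_edges q"
      then have "path_edges p \<in> FS" "path_edges q \<in> FS"
        using path_edges_subset finite_path_edges by (auto simp: FS_def)
      then show "path_length \<omega> p \<noteq> path_length \<omega> q"
        using elim(1) pq path_length_eq_sum[of p \<omega>] path_length_eq_sum[of q \<omega>] by simp
    qed
    then show ?case using elim(2) by (simp add: pos_weight_def)
  qed
qed

text \<open>\<open>N r\<close> is the integer part of the number of visits in
  \<open>path_visits\<close>; its exponential growth beats the quadratic cost in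
  \<open>good_hit\<close>.\<close>

lemma constants_exist:
  assumes abc: "0 < a" "a \<le> a0" "a0 < b0" "b0 \<le> b1" and c: "0 < c" and \<Lambda>: "0 < \<Lambda>"
  obtains \<epsilon> :: real and N K L R where "0 < \<epsilon>" "exp (2 * \<epsilon> * \<delta>) \<le> 2" "mono N"
    "3 * \<delta> < real K" "exp (- \<epsilon> / 2) ^ K / (1 - exp (- \<epsilon> / 2)) < exp (- \<epsilon> * (3 * \<delta> + 1)) / 2"
    "\<And>r. K \<le> r \<Longrightarrow> real (N r) \<le> exp (\<epsilon> * real r / 2)"
    "\<And>r. K \<le> r \<Longrightarrow> \<Lambda> * real r * (2 * real r) < c * real (N r)"
    "\<And>r. K \<le> r \<Longrightarrow> 1 \<le> r" "\<And>r. K \<le> r \<Longrightarrow> r \<le> N r" "\<And>r. K \<le> r \<Longrightarrow> b1 \<le> \<Lambda> * real r"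
    "K < L" "2 * real K * (b1 + b0) < (b0 - a0) * real L"
    "2 * K + L \<le> R" "2 * b1 * real K + 2 * a0 * real L < a * (real R - real L - real K)"
proof -
  \<comment> \<open>This gives \<open>2 * \<epsilon> * \<delta> \<le> ln 2\<close>; adding 1 keeps
    the denominator positive when \<delta> is 0.\<close>
  define \<epsilon> where "\<epsilon> = ln 2 / (2 * (\<delta> + 1))"
  have \<epsilon>: "0 < \<epsilon>" using delta_nonneg by (simp add: \<epsilon>_def)
  have "2 * \<epsilon> * \<delta> = ln 2 * (\<delta> / (\<delta> + 1))" using delta_nonneg by (simp add: \<epsilon>_def field_simps)
  also have "\<dots> \<le> ln 2 * 1" using delta_nonneg by (intro mult_left_mono) auto
  finally have \<epsilon>2: "exp (2 * \<epsilon> * \<delta>) \<le> 2" using exp_le_cancel_iff[of "2 * \<epsilon> * \<delta>" "ln 2"] by simp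
  define N where "N r = nat \<lfloor>exp (\<epsilon> * real r / 2)\<rfloor>" for r :: nat
  have N1: "real (N r) \<le> exp (\<epsilon> * real r / 2)" for r
    unfolding N_def by (simp add: of_nat_nat)
  have N2: "exp (\<epsilon> * real r / 2) - 1 < real (N r)" for r
    unfolding N_def by (simp add: of_nat_nat)
  have Nmono: "mono N"
    unfolding N_def mono_def using \<epsilon> by (auto intro!: nat_mono floor_mono)
  have q: "0 < exp (- \<epsilon> / 2)" "exp (- \<epsilon> / 2) < 1" using \<epsilon> by auto
  have "(\<lambda>k. exp (- \<epsilon> / 2) ^ k / (1 - exp (- \<epsilon> / 2))) \<longlonglongrightarrow> 0 / (1 - exp (- \<epsilon> / 2))"
    using q by (intro tendsto_divide LIMSEQ_power_zero tendsto_const) auto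
  then have ev1: "eventually (\<lambda>k. exp (- \<epsilon> / 2) ^ k / (1 - exp (- \<epsilon> / 2)) < exp (- \<epsilon> * (3 * \<delta> + 1)) / 2) sequentially"
    by (intro order_tendstoD(2)) auto
  have ev2: "eventually (\<lambda>k::nat. 3 * \<delta> < real k) sequentially"
    using eventually_gt_at_top[of "3 * \<delta>"] filterlim_real_sequentially by (simp add: filterlim_iff)
  have ev3: "eventually (\<lambda>r::nat. real r + 1 \<le> exp (\<epsilon> * real r / 2)) sequentially"
    using \<epsilon> by real_asymp
  have ev4: "eventually (\<lambda>r::nat. \<Lambda> * real r * (2 * real r) < c * (exp (\<epsilon> * real r / 2) - 1)) sequentially"
    using \<epsilon> c \<Lambda> by real_asymp
  have ev5: "eventually (\<lambda>r::nat. b1 \<le> \<Lambda> * real r) sequentially"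
    using \<Lambda> by real_asymp
  have "eventually (\<lambda>r::nat. 1 \<le> r \<and> real r + 1 \<le> exp (\<epsilon> * real r / 2) \<and>
      \<Lambda> * real r * (2 * real r) < c * (exp (\<epsilon> * real r / 2) - 1) \<and> b1 \<le> \<Lambda> * real r \<and> 3 * \<delta> < real r \<and>
      exp (- \<epsilon> / 2) ^ r / (1 - exp (- \<epsilon> / 2)) < exp (- \<epsilon> * (3 * \<delta> + 1)) / 2) sequentially"
    by (intro eventually_conj ev1 ev2 ev3 ev4 ev5 eventually_ge_at_top)
  then obtain K where K: "\<And>r::nat. K \<le> r \<Longrightarrow> 1 \<le> r \<and> real r + 1 \<le> exp (\<epsilon> * real r / 2) \<and>
      \<Lambda> * real r * (2 * real r) < c * (exp (\<epsilon> * real r / 2) - 1) \<and> b1 \<le> \<Lambda> * real r \<and> 3 * \<delta> < real r \<and>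
      exp (- \<epsilon> / 2) ^ r / (1 - exp (- \<epsilon> / 2)) < exp (- \<epsilon> * (3 * \<delta> + 1)) / 2"
    unfolding eventually_sequentially by blast
  have rN: "r \<le> N r" if "K \<le> r" for r using K[OF that] N2[of r] by linarith
  have LN: "\<Lambda> * real r * (2 * real r) < c * real (N r)" if "K \<le> r" for r
  proof -
    have "c * (exp (\<epsilon> * real r / 2) - 1) \<le> c * real (N r)" using N2[of r] c by (intro mult_left_mono) auto
    then show ?thesis using K[OF that] by linarith
  qed
  obtain L0 :: nat where L0: "2 * real K * (b1 + b0) / (b0 - a0) < real L0" using reals_Archimedean2 by blast
  define L where "L = L0 + Suc K"
  have "2 * real K * (b1 + b0) / (b0 - a0) < real L" using L0 by (simp add: L_def)
  then have L: "2 * real K * (b1 + b0) < (b0 - a0) * real L"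
    using abc by (simp add: field_simps)
  obtain R0 :: nat where R0: "(2 * b1 * real K + 2 * a0 * real L) / a < real R0" using reals_Archimedean2 by blast
  define R where "R = R0 + 2 * K + L"
  have "2 * b1 * real K + 2 * a0 * real L < a * real R0" using R0 abc(1) by (simp add: field_simps)
  also have "\<dots> \<le> a * (real R - real L - real K)" using abc(1) by (intro mult_left_mono) (auto simp: R_def)
  finally have R: "2 * b1 * real K + 2 * a0 * real L < a * (real R - real L - real K)" .
  show thesis
  proof (rule that[of \<epsilon> N K L R])
    show "K < L" "2 * K + L \<le> R" by (auto simp: L_def R_def)
  qed (use \<epsilon> \<epsilon>2 Nmono K N1 LN rN L R in auto)
qed

text \<open>The numerical assumptions are what the weight distribution has to provide. In
  particular, \<open>\<theta>a\<close> lets the Laplace bound survive conditioning on weights in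
  \<open>[a, b1]\<close>.\<close>

theorem AE_rays_coalesce:
  assumes xi: "\<xi> \<in> gromov_boundary G S"
    and abc: "0 < a" "a \<le> a0" "a0 < b0" "b0 \<le> b1"
    and pab: "0 < emeasure \<mu> {x \<in> space \<mu>. x \<in> {a..a0}}" "0 < emeasure \<mu> {x \<in> space \<mu>. x \<in> {b0..b1}}"
    and l: "0 < l" and \<theta>: "0 \<le> \<theta>" "(\<integral>\<^sup>+x. ennreal (exp (- l * x)) \<partial>\<mu>) \<le> ennreal \<theta>"
    and \<theta>D: "48 * \<theta> * real (Suc (card S)) ^ 2 \<le> 1" and \<theta>a: "exp (- l * a) \<le> \<theta>"
    and \<Lambda>: "0 < \<Lambda>"
    and tail: "\<And>r. 1 \<le> r \<Longrightarrow> emeasure \<mu> {x \<in> space \<mu>. \<Lambda> * real r < x} \<le> ennreal ((1 / (16 * real (Suc (card S)) ^ 6)) ^ r)"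
  shows "AE \<omega> in PM E. \<forall>o1\<in>carrier G. \<forall>o2\<in>carrier G.
    (\<exists>!r. geodesic_ray_towards G S \<omega> o1 \<xi> r) \<and> (\<exists>!r. geodesic_ray_towards G S \<omega> o2 \<xi> r) \<and>
    coalesce G S (the_ray G S \<omega> o1 \<xi>) (the_ray G S \<omega> o2 \<xi>)"
proof -
  define c where "c = 1 / l"
  have c: "0 < c" using l by (simp add: c_def)
  obtain \<epsilon> :: real and N K L R where \<epsilon>: "0 < \<epsilon>" "exp (2 * \<epsilon> * \<delta>) \<le> 2" and Nmono: "mono N"
    and K: "3 * \<delta> < real K" "exp (- \<epsilon> / 2) ^ K / (1 - exp (- \<epsilon> / 2)) < exp (- \<epsilon> * (3 * \<delta> + 1)) / 2"
    and N: "\<And>r. K \<le> r \<Longrightarrow> real (N r) \<le> exp (\<epsilon> * real r / 2)"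
      "\<And>r. K \<le> r \<Longrightarrow> \<Lambda> * real r * (2 * real r) < c * real (N r)"
    and r1: "\<And>r. K \<le> r \<Longrightarrow> 1 \<le> r" and rN: "\<And>r. K \<le> r \<Longrightarrow> r \<le> N r" and b1: "\<And>r. K \<le> r \<Longrightarrow> b1 \<le> \<Lambda> * real r"
    and KL: "K < L" "2 * real K * (b1 + b0) < (b0 - a0) * real L"
    and R: "2 * K + L \<le> R" "2 * b1 * real K + 2 * a0 * real L < a * (real R - real L - real K)"
    using constants_exist[OF abc c \<Lambda>] by metis
  \<comment> \<open>Large enough for the configuration ball and for all edges that decide goodness,
    up to radius \<open>K + n\<close>, at the two ends of the segment, which are at distance
    \<open>L\<close> from its midpoint.\<close>
  define \<rho> where "\<rho> n = R + L + 3 * (K + n) + N (K + n)" for n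
  have \<rho>mono: "mono \<rho>"
    using Nmono by (auto simp: \<rho>_def mono_def intro!: add_mono)
  obtain x t \<iota> \<sigma> where x: "x \<in> \<xi>" and t: "strict_mono t"
    "\<And>n m. n < m \<Longrightarrow> real (t n) + real L + \<delta> \<le> real (t m)" and \<iota>: "mono \<iota>" "\<And>n. n \<le> \<iota> n"
    and close: "\<And>n i j. \<iota> n \<le> i \<Longrightarrow> \<iota> n \<le> j \<Longrightarrow> real (t n) + real L + \<delta> \<le> gp \<one> (x i) (x j)"
    and seg: "\<And>n. word_segment (\<sigma> n) (2 * L)" and tL: "\<And>n. L \<le> t n"
    and D\<sigma>: "\<And>n i. i \<le> 2 * L \<Longrightarrow> D \<one> (\<sigma> n i) = real (t n - L + i) \<and>
       D (\<sigma> n i) (x (\<iota> n)) = D \<one> (x (\<iota> n)) - real (t n - L + i)"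
    and sep: "\<And>n m. n \<noteq> m \<Longrightarrow> real (\<rho> n) + real (\<rho> m) < D (\<sigma> n L) (\<sigma> m L)"
    using segments_exist[OF xi \<rho>mono, of L] by metis
  have xc: "x i \<in> carrier G" for i using boundary_mem_iff[OF xi x, of x] x by auto
  have \<sigma>c: "\<sigma> n i \<in> carrier G" if "i \<le> 2 * L" for n i using seg[of n] that by (auto simp: word_segment_def)
  have \<sigma>c': "\<sigma> n 0 \<in> carrier G" "\<sigma> n L \<in> carrier G" "\<sigma> n (2 * L) \<in> carrier G" for n using \<sigma>c by auto
  have \<sigma>D: "D (\<sigma> n L) (\<sigma> n 0) = real L" "D (\<sigma> n L) (\<sigma> n (2 * L)) = real L" for n
  proof -
    have "D (\<sigma> n 0) (\<sigma> n L) = real L" "D (\<sigma> n L) (\<sigma> n (2 * L)) = real L"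
      using seg[of n] by (auto simp: word_segment_def)
    then show "D (\<sigma> n L) (\<sigma> n 0) = real L" "D (\<sigma> n L) (\<sigma> n (2 * L)) = real L"
      using D_sym[OF \<sigma>c'(1,2)] by auto
  qed
  define F where "F n = edges_in (nball (\<sigma> n L) (\<rho> n))" for n
  define C where "C n = edges_in (nball (\<sigma> n L) R)" for n
  define A where "A n = segment_config (\<sigma> n) L a a0 b0 b1" for n
  have C: "finite (C n)" "C n \<subseteq> E" for n
    unfolding C_def by (auto intro: finite_edges_in finite_nball \<sigma>c' simp: edges_in_subset)
  have CF: "C n \<subseteq> F n" for n
    unfolding C_def F_def by (rule edges_in_nball_mono[OF \<sigma>c'(2) \<sigma>c'(2)]) (simp add: \<rho>_def D_refl[OF \<sigma>c'(2)])
  have A: "A n e \<in> sets borel" for n e by (simp add: A_def segment_config_def)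
  have Ab: "A n e \<subseteq> {a..b1}" for n e using abc by (auto simp: A_def segment_config_def)
  define G0 where "G0 \<omega> n r \<longleftrightarrow> good N c \<Lambda> \<omega> (\<sigma> n 0) r \<and> good N c \<Lambda> \<omega> (\<sigma> n (2 * L)) r" for \<omega> n r
  have goodF: "edges_in (nball v (3 * r)) \<subseteq> F n" "edges_in (nball v (r + N r)) \<subseteq> F n"
    if "v \<in> {\<sigma> n 0, \<sigma> n (2 * L)}" "r \<le> K + n" for v n r
  proof -
    have v: "v \<in> carrier G" "D (\<sigma> n L) v = real L" using that(1) \<sigma>c' \<sigma>D by auto
    have "N r \<le> N (K + n)" using Nmono that(2) by (simp add: monoD)
    then have "L + 3 * r \<le> \<rho> n \<and> L + (r + N r) \<le> \<rho> n" using that(2) by (simp add: \<rho>_def)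
    then have h: "D (\<sigma> n L) v + real (3 * r) \<le> real (\<rho> n)" "D (\<sigma> n L) v + real (r + N r) \<le> real (\<rho> n)"
      unfolding v(2) by (simp_all flip: of_nat_add)
    show "edges_in (nball v (3 * r)) \<subseteq> F n" "edges_in (nball v (r + N r)) \<subseteq> F n"
      unfolding F_def by (rule edges_in_nball_mono[OF \<sigma>c'(2) v(1) h(1)], rule edges_in_nball_mono[OF \<sigma>c'(2) v(1) h(2)])
  qed
  \<comment> \<open>Only radii up to \<open>K + n\<close> are demanded, so that \<open>Q n\<close>
    depends on the weights in \<open>F n\<close> alone; larger radii are left to
    \<open>evr\<close>.\<close>
  define Q where "Q n \<omega> \<longleftrightarrow> conforms (C n) (A n) \<omega> \<and> (\<forall>r\<in>{K..K + n}. G0 \<omega> n r)" for n \<omega>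
  have G0_sets: "{\<omega> \<in> space (PM E). G0 \<omega> n r} \<in> sets (PM E)" for n r
    unfolding G0_def by (intro sets.sets_Collect_conj good_sets \<sigma>c' edges_in_subset)
  have Q_sets: "{\<omega> \<in> space (PM J). Q n \<omega>} \<in> sets (PM J)" if "F n \<subseteq> J" for J n
    unfolding Q_def G0_def
  proof (intro sets.sets_Collect_conj sets.sets_Collect_finite_All conforms_sets C A)
    show "C n \<subseteq> J" using CF that by blast
    fix r assume r: "r \<in> {K..K + n}"
    show "{\<omega> \<in> space (PM J). good N c \<Lambda> \<omega> (\<sigma> n 0) r} \<in> sets (PM J)"
      using goodF[of "\<sigma> n 0" n r] r that by (intro good_sets \<sigma>c') auto
    show "{\<omega> \<in> space (PM J). good N c \<Lambda> \<omega> (\<sigma> n (2 * L)) r} \<in> sets (PM J)"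
      using goodF[of "\<sigma> n (2 * L)" n r] r that by (intro good_sets \<sigma>c') auto
  qed auto
  define B where "B n = {\<omega> \<in> space (PM (F n)). Q n \<omega>}" for n
  \<comment> \<open>Uniform in the prescribed configuration: it is used with the segment
    configuration and with the empty one.\<close>
  have bad: "P {\<omega> \<in> space (PM E). conforms F' A' \<omega> \<and> \<not> good N c \<Lambda> \<omega> v r} \<le> P {\<omega> \<in> space (PM E). conforms F' A' \<omega>} * (1 / 8) ^ r"
    if "v \<in> carrier G" "finite F'" "F' \<subseteq> E" "\<And>e. A' e \<in> sets borel" "\<And>e. A' e \<subseteq> {a..b1}" "K \<le> r" for v F' A' r
    unfolding c_def
  proof (rule bad_bound[where A = A' and F = F' and w = v and N = N and r = r, OF that(1-4) l \<theta> \<theta>D tail[OF r1[OF that(6)]] r1[OF that(6)] rN[OF that(6)]])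
    show "A' e \<subseteq> {..\<Lambda> * real r}" for e using that(5)[of e] b1[OF that(6)] by auto
    fix e x assume "x \<in> A' e"
    then have "a \<le> x" using that(5)[of e] by auto
    then have "exp (- l * x) \<le> exp (- l * a)" using l by simp
    then show "exp (- l * x) \<le> \<theta>" using \<theta>a by linarith
  qed
  define pm where "pm = min (measure \<mu> {x \<in> space \<mu>. x \<in> {a..a0}}) (measure \<mu> {x \<in> space \<mu>. x \<in> {b0..b1}})"
  have pm: "0 < pm" "pm \<le> 1"
    using pab by (auto simp: pm_def emeasure_eq_measure intro: min.coboundedI1)
  \<comment> \<open>A lower bound for the probability of the configuration that does not depend on
    \<open>n\<close>: the exponent bounds the number of edges in any ball of radius
    \<open>R\<close>.\<close>
  define p0 where "p0 = pm ^ (2 ^ (Suc (card S) ^ R))"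
  have p0: "0 < p0" using pm by (simp add: p0_def)
  have conf_p: "p0 \<le> P {\<omega> \<in> space (PM E). conforms (C n) (A n) \<omega>}" for n
  proof -
    have "card (C n) \<le> 2 ^ card (nball (\<sigma> n L) R)" unfolding C_def by (intro card_edges_in finite_nball \<sigma>c')
    also have "\<dots> \<le> 2 ^ (Suc (card S) ^ R)" using card_nball[OF \<sigma>c'(2)] by (intro power_increasing) auto
    finally have "p0 \<le> pm ^ card (C n)" using pm unfolding p0_def by (intro power_decreasing) auto
    also have "\<dots> = (\<Prod>e\<in>C n. pm)" by simp
    also have "\<dots> \<le> (\<Prod>e\<in>C n. measure \<mu> {x \<in> space \<mu>. x \<in> A n e})"
      using pm by (intro prod_mono) (auto simp: A_def segment_config_def pm_def)
    also have "ennreal \<dots> = emeasure (PM E) {\<omega> \<in> space (PM E). conforms (C n) (A n) \<omega>}"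
      unfolding emeasure_conforms[OF C A] by (simp add: emeasure_eq_measure prod_ennreal)
    then have "(\<Prod>e\<in>C n. measure \<mu> {x \<in> space \<mu>. x \<in> A n e}) = P {\<omega> \<in> space (PM E). conforms (C n) (A n) \<omega>}"
      by (simp add: PP.emeasure_eq_measure prod_nonneg)
    finally show ?thesis .
  qed
  have Q_p: "p0 / 2 \<le> P {\<omega> \<in> space (PM E). Q n \<omega>}" for n
  proof -
    define q where "q = P {\<omega> \<in> space (PM E). conforms (C n) (A n) \<omega>}"
    define U where "U v r = {\<omega> \<in> space (PM E). conforms (C n) (A n) \<omega> \<and> \<not> good N c \<Lambda> \<omega> v r}" for v r
    have Us: "U v r \<in> sets (PM E)" if "v \<in> carrier G" for v r
      unfolding U_def
      by (intro sets.sets_Collect_conj sets.sets_Collect_neg conforms_sets C A good_sets that edges_in_subset)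
    have Ub: "P (U v r) \<le> q * (1 / 8) ^ r" if "v \<in> carrier G" "K \<le> r" for v r
      unfolding U_def q_def using bad[OF that(1) C A Ab that(2)] .
    have "q \<le> P ({\<omega> \<in> space (PM E). Q n \<omega>} \<union> (\<Union>r\<in>{K..K + n}. U (\<sigma> n 0) r \<union> U (\<sigma> n (2 * L)) r))"
      unfolding q_def using Q_sets[of n E] Us \<sigma>c' edges_in_subset
      by (intro PP.finite_measure_mono) (auto simp: U_def Q_def G0_def F_def)
    also have "\<dots> \<le> P {\<omega> \<in> space (PM E). Q n \<omega>} + P (\<Union>r\<in>{K..K + n}. U (\<sigma> n 0) r \<union> U (\<sigma> n (2 * L)) r)"
      using Q_sets[of n E] Us \<sigma>c' edges_in_subset by (intro measure_Un_le) (auto simp: F_def)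
    also have "P (\<Union>r\<in>{K..K + n}. U (\<sigma> n 0) r \<union> U (\<sigma> n (2 * L)) r)
        \<le> (\<Sum>r=K..K + n. P (U (\<sigma> n 0) r \<union> U (\<sigma> n (2 * L)) r))"
      using Us \<sigma>c' by (intro PP.finite_measure_subadditive_finite) auto
    also have "\<dots> \<le> (\<Sum>r=K..K + n. q * (1 / 8) ^ r + q * (1 / 8) ^ r)"
    proof (rule sum_mono)
      fix r assume r: "r \<in> {K..K + n}"
      have "P (U (\<sigma> n 0) r \<union> U (\<sigma> n (2 * L)) r) \<le> P (U (\<sigma> n 0) r) + P (U (\<sigma> n (2 * L)) r)"
        using Us \<sigma>c' by (intro measure_Un_le) auto
      then show "P (U (\<sigma> n 0) r \<union> U (\<sigma> n (2 * L)) r) \<le> q * (1 / 8) ^ r + q * (1 / 8) ^ r"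
        using Ub[OF \<sigma>c'(1)[of n], of r] Ub[OF \<sigma>c'(3)[of n], of r] r by simp
    qed
    also have "\<dots> = 2 * q * (\<Sum>r=K..K + n. (1 / 8) ^ r)" by (simp add: sum_distrib_left mult_ac)
    \<comment> \<open>Since \<open>1 \<le> K\<close>, the series is at most \<open>1 / 7\<close>; so
      the failures at both ends take at most \<open>2 / 7 < 1 / 2\<close> of the probability
      \<open>q\<close> of the configuration.\<close>
    also have "\<dots> \<le> 2 * q * (1 / 7)"
    proof (rule mult_left_mono)
      have "(\<Sum>r=K..K + n. (1 / 8 :: real) ^ r) = ((1 / 8) ^ K - (1 / 8) ^ Suc (K + n)) / (1 - 1 / 8)"
        using sum_gp[of "1 / 8 :: real" K "K + n"] by simp
      also have "\<dots> \<le> (1 / 8) ^ K / (1 - 1 / 8)" by (intro divide_right_mono) auto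
      also have "\<dots> \<le> (1 / 8) ^ 1 / (1 - 1 / 8)"
        using r1[of K] by (intro divide_right_mono power_decreasing) auto
      finally show "(\<Sum>r=K..K + n. (1 / 8 :: real) ^ r) \<le> 1 / 7" by simp
    qed (simp add: q_def)
    finally have "q / 2 \<le> P {\<omega> \<in> space (PM E). Q n \<omega>}" using measure_nonneg[of "PM E"] q_def by (simp add: field_simps)
      (smt (verit) measure_nonneg)
    then show ?thesis using conf_p[of n] by (simp add: q_def)
  qed
  have io: "AE \<omega> in PM E. infinite {n. Q n \<omega>}"
  proof (rule local_events_infinitely_often[where F = F and B = B and p = "p0 / 2"])
    show "F n \<subseteq> E" for n unfolding F_def by (rule edges_in_subset)
    show "disjoint_family F"
      unfolding disjoint_family_on_def F_def using edges_in_disjoint[OF \<sigma>c'(2) \<sigma>c'(2) sep] by blast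
    show "B n \<in> sets (PM (F n))" for n unfolding B_def by (rule Q_sets) simp
    show "Q n \<omega> \<longleftrightarrow> restrict \<omega> (F n) \<in> B n" if "\<omega> \<in> space (PM E)" for n \<omega>
    proof -
      have "restrict \<omega> (F n) \<in> space (PM (F n))"
        using measurable_space[OF measurable_restrict_subset[of "F n" E "\<lambda>_. \<mu>"] that] edges_in_subset by (simp add: F_def)
      moreover have "conforms (C n) (A n) \<omega> \<longleftrightarrow> conforms (C n) (A n) (restrict \<omega> (F n))"
        using CF[of n] by (auto simp: conforms_def)
      moreover have "G0 \<omega> n r \<longleftrightarrow> G0 (restrict \<omega> (F n)) n r" if "r \<in> {K..K + n}" for r
        unfolding G0_def using that goodF[of _ n r]
        by (intro arg_cong2[where f = "(\<and>)"] good_cong[where F = "F n"] \<sigma>c') auto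
      ultimately show ?thesis by (auto simp: B_def Q_def)
    qed
  qed (use p0 Q_p in auto)
  \<comment> \<open>Borel--Cantelli is indexed by the radius: for each \<open>r\<close> the failures
    for all \<open>n < r\<close> are taken together, with probability at most
    \<open>2 * r / 8 ^ r\<close>. For given \<open>n\<close> this concerns radii beyond
    \<open>n\<close>, complementing those in \<open>Q n\<close>.\<close>
  have evr: "AE \<omega> in PM E. eventually (\<lambda>r. \<forall>n<r. G0 \<omega> n r) sequentially"
  proof -
    define H where "H r = (\<Union>n\<in>{..<r}. {\<omega> \<in> space (PM E). \<not> G0 \<omega> n r})" for r
    have Hs: "H r \<in> sets (PM E)" for r
      unfolding H_def by (intro sets.finite_UN sets.sets_Collect_neg G0_sets) auto
    have Hb: "P (H r) \<le> 2 * (1 / 4) ^ r" if r: "K \<le> r" for r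
    proof -
      have g: "P {\<omega> \<in> space (PM E). \<not> good N c \<Lambda> \<omega> v r} \<le> (1 / 8) ^ r" if "v \<in> carrier G" for v
        using bad[OF that, of "{}" "\<lambda>_. {a..b1}" r] r
          prob_space.prob_space[OF PP.prob_space_axioms] by (simp add: conforms_def)
      have gs: "{\<omega> \<in> space (PM E). \<not> good N c \<Lambda> \<omega> v r} \<in> sets (PM E)" if "v \<in> carrier G" for v
        by (intro sets.sets_Collect_neg good_sets that edges_in_subset)
      have "P {\<omega> \<in> space (PM E). \<not> G0 \<omega> n r} \<le> 2 * (1 / 8) ^ r" for n
      proof -
        have "{\<omega> \<in> space (PM E). \<not> G0 \<omega> n r} = {\<omega> \<in> space (PM E). \<not> good N c \<Lambda> \<omega> (\<sigma> n 0) r} \<union>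
            {\<omega> \<in> space (PM E). \<not> good N c \<Lambda> \<omega> (\<sigma> n (2 * L)) r}" by (auto simp: G0_def)
        then have "P {\<omega> \<in> space (PM E). \<not> G0 \<omega> n r} \<le> P {\<omega> \<in> space (PM E). \<not> good N c \<Lambda> \<omega> (\<sigma> n 0) r} +
            P {\<omega> \<in> space (PM E). \<not> good N c \<Lambda> \<omega> (\<sigma> n (2 * L)) r}"
          using gs \<sigma>c' by (simp add: measure_Un_le)
        then show ?thesis using g[OF \<sigma>c'(1)[of n]] g[OF \<sigma>c'(3)[of n]] by simp
      qed
      then have "(\<Sum>n<r. P {\<omega> \<in> space (PM E). \<not> G0 \<omega> n r}) \<le> real (card {..<r}) * (2 * (1 / 8) ^ r)"
        by (intro sum_bounded_above) auto
      moreover have "P (H r) \<le> (\<Sum>n<r. P {\<omega> \<in> space (PM E). \<not> G0 \<omega> n r})"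
        unfolding H_def by (intro PP.finite_measure_subadditive_finite) (auto intro!: sets.sets_Collect_neg G0_sets)
      moreover have "real (card {..<r}) * (2 * (1 / 8) ^ r) \<le> 2 ^ r * (2 * (1 / 8) ^ r)"
        by (intro mult_right_mono) (auto simp: less_imp_le)
      moreover have "2 ^ r * (2 * (1 / 8 :: real) ^ r) = 2 * (1 / 4) ^ r"
        using power_mult_distrib[of 2 "1 / 8 :: real" r] by simp
      ultimately show ?thesis by linarith
    qed
    have "AE \<omega> in PM E. eventually (\<lambda>r. \<omega> \<in> space (PM E) - H r) sequentially"
    proof (rule borel_cantelli_AE1[OF Hs])
      show "emeasure (PM E) (H r) < \<infinity>" for r by (simp add: PP.emeasure_eq_measure)
      show "summable (\<lambda>r. P (H r))"
      proof (rule summable_comparison_test_ev)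
        show "eventually (\<lambda>r. norm (P (H r)) \<le> 2 * (1 / 4) ^ r) sequentially"
          using eventually_ge_at_top[of K] by eventually_elim (use Hb in simp)
        show "summable (\<lambda>r. 2 * (1 / 4 :: real) ^ r)" by (intro summable_mult summable_geometric) simp
      qed
    qed
    then show ?thesis
    proof (rule AE_mp, intro AE_I2 impI)
      fix \<omega> assume \<omega>: "\<omega> \<in> space (PM E)" and ev: "eventually (\<lambda>r. \<omega> \<in> space (PM E) - H r) sequentially"
      show "eventually (\<lambda>r. \<forall>n<r. G0 \<omega> n r) sequentially"
        using ev by eventually_elim (use \<omega> in \<open>auto simp: H_def\<close>)
    qed
  qed
  from io evr AE_weights show ?thesis
  proof eventually_elim
    case (elim \<omega>)
    have pos: "pos_weight \<omega>" and gen: "generic \<omega>" using elim(3) by auto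
    obtain r0 where r0: "\<And>r n. r0 \<le> r \<Longrightarrow> n < r \<Longrightarrow> G0 \<omega> n r"
      using elim(2) unfolding eventually_sequentially by blast
    \<comment> \<open>Dropping the indices below \<open>r0\<close> ensures that a radius
      \<open>r > K + n\<close> also satisfies \<open>r0 \<le> r\<close>.\<close>
    define I where "I = {n. Q n \<omega>} - {..<r0}"
    have infI: "infinite I" unfolding I_def using elim(1) by (intro Diff_infinite_finite) auto
    have all_good: "G0 \<omega> n r" if "n \<in> I" "K \<le> r" for n r
    proof (cases "r \<le> K + n")
      case True
      then show ?thesis using that by (auto simp: I_def Q_def)
    next
      case False
      then show ?thesis using that r0[of r n] by (auto simp: I_def)
    qed
    have uniq: "\<exists>!p. fpp_geodesic G S \<omega> u v p" if "u \<in> carrier G" "v \<in> carrier G" for u v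
    proof -
      \<comment> \<open>Existence needs growth around one base vertex only;
        \<open>\<sigma> 0 0\<close> serves, since \<open>evr\<close> covers \<open>n = 0\<close> for
        all large radii.\<close>
      have "\<exists>p. fpp_geodesic G S \<omega> u v p"
      proof (rule good_geodesic_exists[OF pos_imp_nonneg[OF pos] that \<sigma>c'(1)[of 0] _ _ c, where ?r0.0 = "Suc (max r0 K)"])
        show "good N c \<Lambda> \<omega> (\<sigma> 0 0) r" if "Suc (max r0 K) \<le> r" for r
          using r0[of r 0] that by (auto simp: G0_def)
        show "r \<le> N r" if "Suc (max r0 K) \<le> r" for r using rN that by simp
      qed
      then show ?thesis using geodesic_unique[OF pos gen] by blast
    qed
    interpret cut_points G S \<delta> \<omega> \<xi> x "\<lambda>n. \<sigma> n L" t \<iota> L I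
    proof
      fix n
      have "D \<one> (\<sigma> n L) = real (t n)" "D (\<sigma> n L) (x (\<iota> n)) = D \<one> (x (\<iota> n)) - real (t n)"
        using D\<sigma>[of L n] tL[of n] by auto
      then show "D \<one> (\<sigma> n L) = real (t n)" "gp \<one> (\<sigma> n L) (x (\<iota> n)) = real (t n)"
        using D_sym[OF \<sigma>c'(2)[of n] one_closed] D_sym[OF xc[of "\<iota> n"] one_closed] by (auto simp: gromov_product_def)
    next
      fix n u v p
      assume n: "n \<in> I" and uv: "u \<in> carrier G" "v \<in> carrier G" "gp \<one> u (x (\<iota> n)) + \<delta> + real L < real (t n)"
        "real (t n) + real L \<le> gp \<one> v (x (\<iota> n))" and g: "fpp_geodesic G S \<omega> u v p"
      show "\<sigma> n L \<in> set p"
      proof (rule cut_vertex[OF \<epsilon> pos seg abc _ K N less_imp_le[OF \<Lambda>] _ _ KL R xc tL D\<sigma> uv g])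
        show "\<omega> e \<in> segment_config (\<sigma> n) L a a0 b0 b1 e" if "e \<in> edges_in (nball (\<sigma> n L) R)" for e
          using n that by (auto simp: I_def Q_def conforms_def C_def A_def)
        show "good N c \<Lambda> \<omega> (\<sigma> n 0) r" "good N c \<Lambda> \<omega> (\<sigma> n (2 * L)) r" if "K \<le> r" for r
          using all_good[OF n that] by (auto simp: G0_def)
      qed
    qed (use pos uniq xi x \<sigma>c' t \<iota> close infI in auto)
    show ?case using rays_exist_and_coalesce by blast
  qed
qed

end

section \<open>Constants from the weight distribution\<close>

text \<open>The support is defined pointwise by neighbourhoods. The Lindelof property makes the
  cover of the negative reals by null open sets countable.\<close>

lemma prob_negative_zero:
  fixes \<rho> :: "real measure"
  assumes sets: "sets \<rho> = sets borel" and supp: "measure_support \<rho> \<subseteq> {0..}"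
  shows "emeasure \<rho> {..<0} = 0"
proof -
  define \<U> where "\<U> = {U. open U \<and> emeasure \<rho> U = 0}"
  obtain \<V> where \<V>: "\<V> \<subseteq> \<U>" "countable \<V>" "\<Union>\<V> = \<Union>\<U>"
    using Lindelof[of \<U>] by (auto simp: \<U>_def)
  have "{..<0} \<subseteq> \<Union>\<U>"
  proof
    fix x :: real assume "x \<in> {..<0}"
    then have "x \<notin> measure_support \<rho>" using supp by auto
    then obtain U where "open U" "x \<in> U" "emeasure \<rho> U = 0"
      by (auto simp: measure_support_def zero_less_iff_neq_zero)
    then show "x \<in> \<Union>\<U>" unfolding \<U>_def by blast
  qed
  then have sub: "{..<0} \<subseteq> (\<Union>V\<in>\<V>. V)" using \<V>(3) by simp
  have "(\<Union>V\<in>\<V>. V) \<in> null_sets \<rho>"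
    using \<V>(1,2) sets by (intro null_sets_UN') (auto simp: \<U>_def null_sets_def)
  moreover have "{..<0} \<in> sets \<rho>" by (simp add: sets)
  ultimately have "{..<0} \<in> null_sets \<rho>" using sub by (rule null_sets_subset)
  then show ?thesis by (rule null_setsD1)
qed

locale weight_distribution = prob_space \<rho> for \<rho> :: "real measure" +
  assumes sets_rho: "sets \<rho> = sets borel" and support: "measure_support \<rho> \<subseteq> {0..}"
    and no_atoms: "emeasure \<rho> {x} = 0"
begin

abbreviation "\<mu> \<equiv> restrict_space \<rho> {0..}"

lemma nonneg_full: "emeasure \<rho> {0..} = 1"
proof -
  have "AE x in \<rho>. x \<notin> {..<0}"
    using prob_negative_zero[OF sets_rho support] sets_rho by (intro AE_not_in) (simp add: null_sets_def)
  then have "emeasure \<rho> {x \<in> space \<rho>. x \<notin> {..<0}} = 1"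
    using sets_rho by (intro emeasure_eq_1_AE) auto
  moreover have "{x \<in> space \<rho>. x \<notin> {..<0}} = {0..}"
    using sets_eq_imp_space_eq[OF sets_rho] by auto
  ultimately show ?thesis by simp
qed

lemma prob_space_mu: "prob_space \<mu>"
  using sets_rho nonneg_full by (intro prob_space_restrict_space) auto

lemma sets_mu': "sets \<mu> = sets (restrict_space borel {0..})"
  by (rule sets_restrict_space_cong[OF sets_rho])

lemma space_mu': "space \<mu> = {0..}"
  using sets_eq_imp_space_eq[OF sets_rho] by (simp add: space_restrict_space)

lemma emeasure_mu:
  assumes "A \<in> sets borel"
  shows "emeasure \<mu> {x \<in> space \<mu>. x \<in> A} = emeasure \<rho> ({0..} \<inter> A)"
proof -
  have "{x \<in> space \<mu>. x \<in> A} = {0..} \<inter> A" by (auto simp: space_mu')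
  then show ?thesis using sets_rho assms sets_eq_imp_space_eq[OF sets_rho]
    by (simp add: emeasure_restrict_space)
qed

lemma atomless_mu: "emeasure \<mu> {x} = 0"
proof (cases "0 \<le> x")
  case True
  then show ?thesis using no_atoms sets_rho sets_eq_imp_space_eq[OF sets_rho]
    by (subst emeasure_restrict_space) auto
next
  case False
  then have "{x} \<notin> sets \<mu>" using sets.sets_into_space[of "{x}" \<mu>] by (auto simp: space_mu')
  then show ?thesis by (rule emeasure_notin_sets)
qed

text \<open>Without atoms the distribution function is continuous; it vanishes at 0 and tends to
  1.\<close>

lemma quantile:
  assumes "0 < y" "y < 1"
  obtains x where "0 < x" "cdf \<rho> x = y"
proof -
  interpret real_distribution \<rho>
    using sets_rho sets_eq_imp_space_eq[OF sets_rho] by unfold_locales auto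
  have cont: "isCont (cdf \<rho>) x" for x using no_atoms[of x] by (simp add: isCont_cdf measure_def)
  have "{..0::real} = {..<0} \<union> {0}" by auto
  then have "emeasure \<rho> {..0} \<le> emeasure \<rho> {..<0} + emeasure \<rho> {0}"
    using emeasure_subadditive[of "{..<0}" \<rho> "{0}"] sets_rho by simp
  then have c0: "cdf \<rho> 0 = 0"
    using prob_negative_zero[OF sets_rho support] no_atoms[of 0] by (simp add: cdf_def measure_def)
  have "eventually (\<lambda>x. y < cdf \<rho> x) at_top"
    using cdf_lim_at_top_prob assms(2) by (rule order_tendstoD(1))
  then obtain M where M: "\<And>x. M \<le> x \<Longrightarrow> y < cdf \<rho> x" unfolding eventually_at_top_linorder by blast
  have "\<exists>x\<ge>0. x \<le> max M 0 \<and> cdf \<rho> x = y"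
    using c0 assms M[of "max M 0"] cont by (intro IVT) auto
  then obtain x where x: "0 \<le> x" "cdf \<rho> x = y" by blast
  then have "x \<noteq> 0" using c0 assms by auto
  then have "0 < x" using x(1) by simp
  then show thesis using that x(2) by blast
qed

lemma interval_positive:
  assumes "0 < u" "cdf \<rho> u < cdf \<rho> v"
  shows "u < v" "0 < emeasure \<mu> {x \<in> space \<mu>. x \<in> {u..v}}"
proof -
  interpret real_distribution \<rho>
    using sets_rho sets_eq_imp_space_eq[OF sets_rho] by unfold_locales auto
  show uv: "u < v" using assms(2) cdf_nondecreasing[of v u] by force
  have "0 < measure \<rho> {u<..v}" using cdf_diff_eq[OF uv] assms(2) by simp
  also have "\<dots> \<le> measure \<rho> ({0..} \<inter> {u..v})"
    using assms(1) sets_rho by (intro finite_measure_mono) auto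
  finally show "0 < emeasure \<mu> {x \<in> space \<mu>. x \<in> {u..v}}"
    using emeasure_mu[of "{u..v}"] by (simp add: emeasure_eq_measure)
qed

text \<open>Split at a quantile \<tau>: weights up to \<tau> have mass \<open>\<theta> / 2\<close>,
  and beyond \<tau> the integrand is at most \<open>\<theta> / 2\<close> for large
  \<open>l\<close>.\<close>

lemma laplace_constant:
  assumes "0 < a" "0 < \<theta>" "\<theta> \<le> 1"
  obtains l where "0 < l" "(\<integral>\<^sup>+x. ennreal (exp (- l * x)) \<partial>\<mu>) \<le> ennreal \<theta>" "exp (- l * a) \<le> \<theta>"
proof -
  interpret mu: prob_space \<mu> by (rule prob_space_mu)
  obtain \<tau> where \<tau>: "0 < \<tau>" "cdf \<rho> \<tau> = \<theta> / 2" using quantile[of "\<theta> / 2"] assms by auto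
  \<comment> \<open>The minimum with \<open>a\<close> makes the same \<open>l\<close> work for
    \<open>exp (- l * a)\<close>.\<close>
  define m where "m = min \<tau> a"
  have m: "0 < m" "m \<le> \<tau>" "m \<le> a" using \<tau> assms by (auto simp: m_def)
  define l where "l = ln (2 / \<theta>) / m"
  have l: "0 < l" using m assms by (simp add: l_def)
  have small: "exp (- l * x) \<le> \<theta> / 2" if "m \<le> x" for x
  proof -
    have "exp (- l * x) \<le> exp (- l * m)" using l that by simp
    also have "- l * m = ln (\<theta> / 2)" using m assms by (simp add: l_def ln_div)
    finally show ?thesis using assms by simp
  qed
  have "(\<integral>\<^sup>+x. ennreal (exp (- l * x)) \<partial>\<mu>) \<le> (\<integral>\<^sup>+x. indicator {x \<in> space \<mu>. x \<in> {..\<tau>}} x + ennreal (\<theta> / 2) \<partial>\<mu>)"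
  proof (rule nn_integral_mono)
    fix x assume x: "x \<in> space \<mu>"
    show "ennreal (exp (- l * x)) \<le> indicator {x \<in> space \<mu>. x \<in> {..\<tau>}} x + ennreal (\<theta> / 2)"
    proof (cases "x \<le> \<tau>")
      case True
      have "exp (- l * x) \<le> 1" using x l by (simp add: space_mu')
      then have "ennreal (exp (- l * x)) \<le> 1" by (simp add: ennreal_le_1)
      also have "\<dots> \<le> 1 + ennreal (\<theta> / 2)" by simp
      finally show ?thesis using True x by simp
    next
      case False
      then show ?thesis using small[of x] m by (auto intro: ennreal_leI)
    qed
  qed
  also have "\<dots> = emeasure \<mu> {x \<in> space \<mu>. x \<in> {..\<tau>}} + ennreal (\<theta> / 2)"
  proof -
    have "{x \<in> space \<mu>. x \<in> {..\<tau>}} \<in> sets \<mu>"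
    proof -
      have "{x \<in> space \<mu>. x \<in> {..\<tau>}} = {0..} \<inter> {..\<tau>}" by (auto simp: space_mu')
      then show ?thesis unfolding sets_mu' by (auto simp: sets_restrict_space)
    qed
    then show ?thesis by (subst nn_integral_add) (auto simp: mu.emeasure_space_1)
  qed
  also have "emeasure \<mu> {x \<in> space \<mu>. x \<in> {..\<tau>}} \<le> emeasure \<rho> {..\<tau>}"
    unfolding emeasure_mu[OF borel_closed[OF closed_atMost]] using sets_rho by (intro emeasure_mono) auto
  also have "emeasure \<rho> {..\<tau>} = ennreal (\<theta> / 2)"
    unfolding \<tau>(2)[symmetric] cdf_def by (rule emeasure_eq_measure)
  also have "ennreal (\<theta> / 2) + ennreal (\<theta> / 2) = ennreal \<theta>" using assms by (simp flip: ennreal_plus)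
  finally have int: "(\<integral>\<^sup>+x. ennreal (exp (- l * x)) \<partial>\<mu>) \<le> ennreal \<theta>" by (simp add: add_right_mono)
  have "exp (- l * a) \<le> \<theta>" using small[OF m(3)] assms by linarith
  then show thesis using that l int by blast
qed

text \<open>Markov's inequality for \<open>exp (\<alpha> * x\<^sup>2)\<close> at
  \<open>\<Lambda> * r\<close>, together with \<open>r \<le> r\<^sup>2\<close>; \<Lambda> is such
  that \<open>exp (- (\<alpha> * \<Lambda>\<^sup>2)) \<le> \<kappa> / C'\<close>.\<close>

lemma tail_constant:
  assumes \<alpha>: "0 < \<alpha>" "(\<integral>\<^sup>+x. ennreal (exp (\<alpha> * x^2)) \<partial>\<rho>) < \<infinity>" and \<kappa>: "0 < \<kappa>" "\<kappa> \<le> 1"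
  obtains \<Lambda> where "0 < \<Lambda>"
    "\<And>r. 1 \<le> r \<Longrightarrow> emeasure \<mu> {x \<in> space \<mu>. \<Lambda> * real r < x} \<le> ennreal (\<kappa> ^ r)"
proof -
  obtain C where C: "0 \<le> C" "(\<integral>\<^sup>+x. ennreal (exp (\<alpha> * x^2)) \<partial>\<rho>) = ennreal C"
    using \<alpha>(2) by (metis ennreal_cases infinity_ennreal_def less_irrefl)
  \<comment> \<open>At least 1, so that the single factor \<open>C'\<close> is covered by
    \<open>C' ^ r\<close>.\<close>
  define C' where "C' = max C 1"
  have C': "1 \<le> C'" "C \<le> C'" by (auto simp: C'_def)
  have q1: "1 \<le> C' / \<kappa>" using C' \<kappa> by simp
  define \<Lambda> where "\<Lambda> = sqrt ((ln (C' / \<kappa>) + 1) / \<alpha>)"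
  have ln0: "0 \<le> ln (C' / \<kappa>)" using q1 by simp
  have \<Lambda>: "0 < \<Lambda>" "\<alpha> * \<Lambda>\<^sup>2 = ln (C' / \<kappa>) + 1"
    using ln0 \<alpha>(1) by (auto simp: \<Lambda>_def)
  have "exp (- (\<alpha> * \<Lambda>\<^sup>2)) \<le> exp (- ln (C' / \<kappa>))" unfolding \<Lambda>(2) by simp
  also have "\<dots> = \<kappa> / C'" using C' \<kappa> by (simp add: exp_minus)
  finally have e: "exp (- (\<alpha> * \<Lambda>\<^sup>2)) \<le> \<kappa> / C'" .
  show thesis
  proof (rule that[OF \<Lambda>(1)])
    fix r :: nat assume r: "1 \<le> r"
    define X where "X = \<Lambda> * real r"
    have "emeasure \<mu> {x \<in> space \<mu>. \<Lambda> * real r < x} = emeasure \<rho> ({0..} \<inter> {X<..})"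
      using emeasure_mu[of "{X<..}"] by (simp add: X_def)
    also have "\<dots> \<le> emeasure \<rho> {X<..}" using sets_rho by (intro emeasure_mono) auto
    also have "\<dots> = (\<integral>\<^sup>+x. indicator {X<..} x \<partial>\<rho>)" using sets_rho by simp
    also have "\<dots> \<le> (\<integral>\<^sup>+x. ennreal (exp (- (\<alpha> * X\<^sup>2))) * ennreal (exp (\<alpha> * x\<^sup>2)) \<partial>\<rho>)"
    proof (rule nn_integral_mono)
      fix x
      have "1 \<le> exp (- (\<alpha> * X\<^sup>2)) * exp (\<alpha> * x\<^sup>2)" if "X < x"
      proof -
        have "0 \<le> X" using \<Lambda>(1) by (simp add: X_def)
        then have "\<alpha> * X\<^sup>2 \<le> \<alpha> * x\<^sup>2" using that \<alpha>(1) by (intro mult_left_mono power_mono) auto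
        then show ?thesis by (simp flip: exp_add)
      qed
      then show "indicator {X<..} x \<le> ennreal (exp (- (\<alpha> * X\<^sup>2))) * ennreal (exp (\<alpha> * x\<^sup>2))"
        by (auto simp: indicator_def ennreal_ge_1 simp flip: ennreal_mult)
    qed
    also have "\<dots> = ennreal (exp (- (\<alpha> * X\<^sup>2))) * ennreal C"
    proof -
      have "(\<lambda>x. ennreal (exp (\<alpha> * x\<^sup>2))) \<in> borel_measurable \<rho>"
        by (subst measurable_cong_sets[OF sets_rho refl]) measurable
      then show ?thesis by (simp add: nn_integral_cmult C(2))
    qed
    also have "\<dots> = ennreal (exp (- (\<alpha> * X\<^sup>2)) * C)" using C(1) by (simp add: ennreal_mult)
    also have "\<dots> \<le> ennreal (\<kappa> ^ r)"
    proof (rule ennreal_leI)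
      have "real r \<le> (real r)\<^sup>2" using r by (simp add: power2_eq_square)
      then have "\<alpha> * \<Lambda>\<^sup>2 * real r \<le> \<alpha> * \<Lambda>\<^sup>2 * (real r)\<^sup>2" using \<alpha>(1) by (intro mult_left_mono) auto
      then have "exp (- (\<alpha> * X\<^sup>2)) \<le> exp (real r * (- (\<alpha> * \<Lambda>\<^sup>2)))"
        by (simp add: X_def power_mult_distrib mult_ac)
      also have "\<dots> = exp (- (\<alpha> * \<Lambda>\<^sup>2)) ^ r" by (rule exp_of_nat_mult)
      also have "\<dots> \<le> (\<kappa> / C') ^ r" using e by (intro power_mono) auto
      finally have "exp (- (\<alpha> * X\<^sup>2)) * C \<le> (\<kappa> / C') ^ r * C'" using C C' \<kappa> by (intro mult_mono) auto
      also have "\<dots> = \<kappa> ^ r * (C' / C' ^ r)" by (simp add: power_divide)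
      also have "\<dots> \<le> \<kappa> ^ r * 1"
      proof (rule mult_left_mono)
        have "C' ^ 1 \<le> C' ^ r" using r C' by (intro power_increasing) auto
        then show "C' / C' ^ r \<le> 1" using C' by (simp add: divide_le_eq)
      qed (use \<kappa> in simp)
      finally show "exp (- (\<alpha> * X\<^sup>2)) * C \<le> \<kappa> ^ r" by simp
    qed
    finally show "emeasure \<mu> {x \<in> space \<mu>. \<Lambda> * real r < x} \<le> ennreal (\<kappa> ^ r)" .
  qed
qed

end

text \<open>A sequence tending to infinity leaves the identity, and a word geodesic to one of its
  members has an edge. This provides the nonempty index set for the independent weights.\<close>

lemma (in hyperbolic_cayley_graph) edges_nonempty:
  assumes "\<xi> \<in> gromov_boundary G S"
  shows "E \<noteq> {}"
proof -
  obtain x where x: "x \<in> \<xi>" using boundary_nonempty[OF assms] by blast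
  then have c: "x i \<in> carrier G" and "product_diverges G S x x" for i
    using boundary_mem_iff[OF assms x, of x] by auto
  then obtain i where "1 \<le> gp \<one> (x i) (x i)" unfolding product_diverges_iff by blast
  then have "0 < ndist \<one> (x i)" using gp_refl[OF one_closed c] D_eq_ndist[OF one_closed c, of i] by simp
  then show ?thesis using word_geodesic_nth[OF one_closed c, of i] by (metis empty_iff)
qed

text \<open>Existence and uniqueness belong to the conclusion because \<open>the_ray\<close> is a
  definite description.\<close>

theorem theorem7p9:
  fixes G :: "('a, 'b) monoid_scheme" and S :: "'a set"
    and \<rho> :: "real measure" and \<xi> :: "(nat \<Rightarrow> 'a) set"
  assumes "group G"
    and "finite S" and "S \<subseteq> carrier G"
    and "\<And>s. s \<in> S \<Longrightarrow> inv\<^bsub>G\<^esub> s \<in> S"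
    and "generate G S = carrier G"
    and "gromov_hyperbolic G S"
    and "prob_space \<rho>" and "sets \<rho> = sets borel"
    and "measure_support \<rho> \<subseteq> {0..}"
    and "\<And>x. emeasure \<rho> {x} = 0"
    and "\<exists>a>0. (\<integral>\<^sup>+ x. ennreal (exp (a * x^2)) \<partial>\<rho>) < \<infinity>"
    and "\<xi> \<in> gromov_boundary G S"
  shows "AE \<omega> in fpp_measure G S \<rho>. \<forall>o1\<in>carrier G. \<forall>o2\<in>carrier G.
           (\<exists>!r. geodesic_ray_towards G S \<omega> o1 \<xi> r) \<and>
           (\<exists>!r. geodesic_ray_towards G S \<omega> o2 \<xi> r) \<and>
           coalesce G S (the_ray G S \<omega> o1 \<xi>) (the_ray G S \<omega> o2 \<xi>)"
proof -
  obtain \<delta> where \<delta>: "\<delta> \<ge> 0" "\<forall>w\<in>carrier G. \<forall>x\<in>carrier G. \<forall>y\<in>carrier G. \<forall>z\<in>carrier G.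
        gromov_product G S w x z \<ge> min (gromov_product G S w x y) (gromov_product G S w y z) - \<delta>"
    using assms(6) unfolding gromov_hyperbolic_def by blast
  interpret group G by fact
  interpret hyperbolic_cayley_graph G S \<delta>
    by unfold_locales (use assms(2-5) \<delta> in auto)
  interpret W: weight_distribution \<rho>
    using assms(7-10) by (intro weight_distribution.intro weight_distribution_axioms.intro)
  interpret fpp_setting G S \<delta> "restrict_space \<rho> {0..}"
    by (intro fpp_setting.intro hyperbolic_cayley_graph_axioms iid_weights.intro iid_weights_axioms.intro
        W.prob_space_mu W.sets_mu' W.atomless_mu edges_nonempty[OF assms(12)])
  define d where "d = real (Suc (card S))"
  have d: "1 \<le> d" by (simp add: d_def)
  \<comment> \<open>The largest value allowed by the path count in \<open>bad_bound\<close>.\<close>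
  define \<theta> where "\<theta> = 1 / (48 * d ^ 2)"
  have d2: "1 \<le> d ^ 2" "1 \<le> d ^ 6" using d by (auto intro: one_le_power)
  have \<theta>: "0 < \<theta>" "\<theta> \<le> 1" using d2 by (auto simp: \<theta>_def divide_le_eq)
  \<comment> \<open>Four quantiles: the intervals \<open>[a, a0]\<close> and \<open>[b0, b1]\<close>
    are disjoint, and each has mass 1/5.\<close>
  obtain a where a: "0 < a" "cdf \<rho> a = 1 / 5" using W.quantile[of "1 / 5"] by auto
  obtain a0 where a0: "0 < a0" "cdf \<rho> a0 = 2 / 5" using W.quantile[of "2 / 5"] by auto
  obtain b0 where b0: "0 < b0" "cdf \<rho> b0 = 3 / 5" using W.quantile[of "3 / 5"] by auto
  obtain b1 where b1: "0 < b1" "cdf \<rho> b1 = 4 / 5" using W.quantile[of "4 / 5"] by auto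
  have ord: "a \<le> a0" "a0 < b0" "b0 \<le> b1"
    using W.interval_positive(1)[of a a0] W.interval_positive(1)[of a0 b0] W.interval_positive(1)[of b0 b1] a a0 b0 b1
    by auto
  obtain l where l: "0 < l" "(\<integral>\<^sup>+x. ennreal (exp (- l * x)) \<partial>restrict_space \<rho> {0..}) \<le> ennreal \<theta>"
    "exp (- l * a) \<le> \<theta>"
    using W.laplace_constant[OF a(1) \<theta>] by blast
  obtain \<alpha> where \<alpha>: "0 < \<alpha>" "(\<integral>\<^sup>+ x. ennreal (exp (\<alpha> * x^2)) \<partial>\<rho>) < \<infinity>" using assms(11) by blast
  have \<kappa>: "0 < 1 / (16 * d ^ 6)" "1 / (16 * d ^ 6) \<le> 1" using d2 by (auto simp: divide_le_eq)
  obtain \<Lambda> where \<Lambda>: "0 < \<Lambda>" "\<And>r. 1 \<le> r \<Longrightarrow>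
      emeasure (restrict_space \<rho> {0..}) {x \<in> space (restrict_space \<rho> {0..}). \<Lambda> * real r < x} \<le> ennreal ((1 / (16 * d ^ 6)) ^ r)"
    using W.tail_constant[OF \<alpha> \<kappa>] by blast
  have \<theta>D: "48 * \<theta> * real (Suc (card S)) ^ 2 \<le> 1" using d unfolding d_def[symmetric] by (simp add: \<theta>_def)
  have pab: "0 < emeasure (restrict_space \<rho> {0..}) {x \<in> space (restrict_space \<rho> {0..}). x \<in> {a..a0}}"
    "0 < emeasure (restrict_space \<rho> {0..}) {x \<in> space (restrict_space \<rho> {0..}). x \<in> {b0..b1}}"
    by (intro W.interval_positive(2); simp add: a a0 b0 b1)+
  show ?thesis
    unfolding fpp_measure_def
    by (rule AE_rays_coalesce[OF assms(12) a(1) ord pab l(1) less_imp_le[OF \<theta>(1)] l(2) \<theta>D l(3) \<Lambda>(1) \<Lambda>(2)[unfolded d_def]])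
qed

end
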